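(* Let $t,s,u$ be complex parameters with $|t|,|s|,|u|<1$ and $|pq|<|t^2s^2u|$. Whenever two functions $\alpha$ and $\beta$ form an integral elliptic Bailey pair with respect to their parameter, the relation holding at the parameter value $st$, i.e. $$\beta(w,st)=\kappa\int_{\mathbb{T}}\Gamma(stw^\pm z^\pm)\,\alpha(z,st)\,\frac{dz}{z},\qquad w\in\mathbb{T},$$ the new functions defined for $w\in\mathbb{T}$ by $$\alpha'(w,t)=\kappa\,\frac{\Gamma(s^2t^2,\,uw^\pm)}{\Gamma(s^2,\,t^2,\,w^{\pm2},\,t^2s^2uw^{\pm})}\int_{\mathbb{T}}\frac{\Gamma(t^2sux^\pm,\,sw^\pm x^\pm)}{\Gamma(sux^\pm)}\,\alpha(x,st)\,\frac{dx}{x}$$ and $$\beta'(w,t)=\frac{\Gamma(tuw^\pm)}{\Gamma(ts^2uw^\pm)}\,\beta(w,st)$$ form an integral elliptic Bailey pair with respect to $t$, that is, $$\beta'(w,t)=\kappa\int_{\mathbb{T}}\Gamma(tw^\pm z^\pm)\,\alpha'(z,t)\,\frac{dz}{z},\qquad w\in\mathbb{T}.$$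
   Context: $\mathbb{T}$ is the positively oriented unit circle in $\mathbb{C}$; $q,p$ are fixed complex numbers with $|q|,|p|<1$. The elliptic gamma function is $$\Gamma(z)=\Gamma(z;q,p)=\prod_{j,k=0}^\infty\frac{1-z^{-1}q^{j+1}p^{k+1}}{1-zq^jp^k}.$$ Conventions: $\Gamma(a_1,\ldots,a_m)=\prod_{r=1}^m\Gamma(a_r;q,p)$; $\Gamma(az^\pm)=\Gamma(az,az^{-1})$; $\Gamma(z^{\pm2})=\Gamma(z^2,z^{-2})$; $\Gamma(az^\pm x^\pm)=\Gamma(azx,azx^{-1},az^{-1}x,az^{-1}x^{-1})$. An entry carrying $\pm$ signs inside a list of arguments is expanded in this way. The function $1/\Gamma(z^{\pm2})$ is understood as its holomorphic extension to $\mathbb{C}\setminus\{0\}$ (so it vanishes, e.g., at $z=\pm1$). Also $(q;q)_\infty=\prod_{n=1}^\infty(1-q^n)$, $(p;p)_\infty=\prod_{n=1}^\infty(1-p^n)$ and $$\kappa=\frac{(p;p)_\infty(q;q)_\infty}{4\pi i}.$$ Definition. Two functions $\alpha(z,\tau)$ and $\beta(z,\tau)$ form an integral elliptic Bailey pair with respect to the parameter (value) $\tau$ if $$\beta(w,\tau)=\kappa\int_{\mathbb{T}}\Gamma(\tau w^\pm z^\pm)\,\alpha(z,\tau)\,\frac{dz}{z}$$ for $w\in\mathbb{T}$, where the integral is required to exist (as a Lebesgue integral). *)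

theory Defs
  imports "HOL-Complex_Analysis.Complex_Analysis"
begin

text \<open>
  The elliptic gamma function with bases \<open>q\<close>, \<open>p\<close>. For \<open>\<bar>q\<bar>, \<bar>p\<bar> < 1\<close> and \<open>z \<noteq> 0\<close> the double product
  converges absolutely, so it may be written as an iterated product. At a pole, the value is
  the meaningless \<open>0\<close> coming from division by zero.
\<close>
definition ell_gamma :: "complex \<Rightarrow> complex \<Rightarrow> complex \<Rightarrow> complex" where
  "ell_gamma q p z =
     (\<Prod>j. \<Prod>k. (1 - inverse z * q ^ (j + 1) * p ^ (k + 1)) / (1 - z * q ^ j * p ^ k))"

text \<open>\<open>\<Gamma>(az\<^sup>\<plusminus>)\<close>\<close>
definition ell_gamma_pm :: "complex \<Rightarrow> complex \<Rightarrow> complex \<Rightarrow> complex \<Rightarrow> complex" where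
  "ell_gamma_pm q p a z = ell_gamma q p (a * z) * ell_gamma q p (a * inverse z)"

text \<open>\<open>\<Gamma>(az\<^sup>\<plusminus>x\<^sup>\<plusminus>)\<close>\<close>
definition ell_gamma_pm2 ::
    "complex \<Rightarrow> complex \<Rightarrow> complex \<Rightarrow> complex \<Rightarrow> complex \<Rightarrow> complex" where
  "ell_gamma_pm2 q p a z x =
     ell_gamma q p (a * z * x) * ell_gamma q p (a * z * inverse x) *
     ell_gamma q p (a * inverse z * x) * ell_gamma q p (a * inverse z * inverse x)"

text \<open>
  The holomorphic extension of \<open>1/\<Gamma>(z\<^sup>\<plusminus>\<^sup>2)\<close> to \<open>z \<noteq> 0\<close>: \<^const>\<open>remove_sings\<close> replaces
  the value at each point by the limit there. In particular the poles of \<open>\<Gamma>(z\<^sup>\<plusminus>\<^sup>2)\<close> at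
  \<open>z = 1\<close> and \<open>z = -1\<close>, which lie on the contour, become zeros.
\<close>
definition rec_ell_gamma_sq :: "complex \<Rightarrow> complex \<Rightarrow> complex \<Rightarrow> complex" where
  "rec_ell_gamma_sq q p =
     remove_sings (\<lambda>z. 1 / (ell_gamma q p (z ^ 2) * ell_gamma q p (inverse (z ^ 2))))"

text \<open>\<open>(q;q)\<^sub>\<infinity>\<close>\<close>
definition qpoch_inf :: "complex \<Rightarrow> complex" where
  "qpoch_inf q = (\<Prod>n. 1 - q ^ (n + 1))"

definition bailey_kappa :: "complex \<Rightarrow> complex \<Rightarrow> complex" where
  "bailey_kappa q p = qpoch_inf p * qpoch_inf q / (4 * of_real pi * \<i>)"

text \<open>
  Existence of the integral of \<open>f\<close> over the unit circle as a Lebesgue integral. The integrand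
  is the one in the definition of \<^const>\<open>has_contour_integral\<close>, which by itself
  only asks for Henstock-Kurzweil integrability; when it is absolutely integrable, the Lebesgue
  integral is \<open>contour_integral (circlepath 0 1) f\<close>.
\<close>
definition unit_circle_integrable :: "(complex \<Rightarrow> complex) \<Rightarrow> bool" where
  "unit_circle_integrable f \<longleftrightarrow>
     (\<lambda>x. f (circlepath 0 1 x) * vector_derivative (circlepath 0 1) (at x within {0..1}))
       absolutely_integrable_on {0..1}"

text \<open>
  The functions take the variable first and the parameter second; \<open>\<tau>\<close> is the
  parameter value at which the relation holds.
\<close>
definition ell_bailey_pair :: "complex \<Rightarrow> complex \<Rightarrow>
    (complex \<Rightarrow> complex \<Rightarrow> complex) \<Rightarrow> (complex \<Rightarrow> complex \<Rightarrow> complex) \<Rightarrow> complex \<Rightarrow> bool" where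
  "ell_bailey_pair q p \<alpha> \<beta> \<tau> \<longleftrightarrow>
     (\<forall>w\<in>sphere 0 1.
        unit_circle_integrable (\<lambda>z. ell_gamma_pm2 q p \<tau> w z * \<alpha> z \<tau> / z) \<and>
        \<beta> w \<tau> = bailey_kappa q p *
          contour_integral (circlepath 0 1) (\<lambda>z. ell_gamma_pm2 q p \<tau> w z * \<alpha> z \<tau> / z))"

definition bailey_kernel :: "complex \<Rightarrow> complex \<Rightarrow> complex \<Rightarrow> complex \<Rightarrow>
    (complex \<Rightarrow> complex \<Rightarrow> complex) \<Rightarrow> complex \<Rightarrow> complex \<Rightarrow> complex \<Rightarrow> complex" where
  "bailey_kernel q p s u \<alpha> w t x =
     ell_gamma_pm q p (t ^ 2 * s * u) x * ell_gamma_pm2 q p s w x / ell_gamma_pm q p (s * u) x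
       * \<alpha> x (s * t) / x"

definition bailey_alpha' :: "complex \<Rightarrow> complex \<Rightarrow> complex \<Rightarrow> complex \<Rightarrow>
    (complex \<Rightarrow> complex \<Rightarrow> complex) \<Rightarrow> complex \<Rightarrow> complex \<Rightarrow> complex" where
  "bailey_alpha' q p s u \<alpha> w t =
     bailey_kappa q p *
     (ell_gamma q p (s ^ 2 * t ^ 2) * ell_gamma_pm q p u w /
        (ell_gamma q p (s ^ 2) * ell_gamma q p (t ^ 2) * ell_gamma_pm q p (t ^ 2 * s ^ 2 * u) w)
        * rec_ell_gamma_sq q p w) *
     contour_integral (circlepath 0 1) (bailey_kernel q p s u \<alpha> w t)"

definition bailey_beta' :: "complex \<Rightarrow> complex \<Rightarrow> complex \<Rightarrow> complex \<Rightarrow>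
    (complex \<Rightarrow> complex \<Rightarrow> complex) \<Rightarrow> complex \<Rightarrow> complex \<Rightarrow> complex" where
  "bailey_beta' q p s u \<beta> w t =
     ell_gamma_pm q p (t * u) w / ell_gamma_pm q p (t * s ^ 2 * u) w * \<beta> w (s * t)"

end

theory Submission
  imports Defs
begin

text \<open>
  After Fubini, the theorem is Spiridonov's elliptic beta integral with the five parameters
  \<open>tw, t/w, u, sx, s/x\<close>, whose product is \<open>t\<^sup>2s\<^sup>2u\<close>. To evaluate that integral, add the sixth parameter
  that makes the product of all six equal to \<open>pq\<close>. The addition formula for theta functions and the shift of
  the contour by \<open>q\<^sup>1\<^sup>/\<^sup>2\<close> give a contiguous relation which multiplies three of the parameters by \<open>q\<^sup>1\<^sup>/\<^sup>2\<close>
  and divides the other three by it. Applied twice, it shows that the quotient of the integral and its expected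
  value does not change when one parameter is multiplied by \<open>q\<close>. When \<open>p\<close> is small, this quotient is
  holomorphic in that parameter on an annulus wider than a period, hence constant by the maximum principle. The constant is
  found by letting two parameters tend to \<open>i\<close> and \<open>-i\<close>, where the integrand concentrates like a
  Poisson kernel. The remaining parameters and bases follow by analytic continuation.
\<close>

section \<open>Infinite products\<close>

text \<open>The six-parameter integral is symmetric and suits the contiguous relation, but its last
  parameter \<open>p * q / (a * b * c * d * e)\<close> degenerates when a base is 0. Reflection of
  the gamma function turns the sixth factor into a denominator, and this five-parameter form is the
  one that is continued analytically. Smallness of \<open>p\<close> has a geometric reason: the
  first parameter ranges over the annulus between |pq|/|bcde| and 1, which is wider than a period
  \<open>q\<close> exactly when |p| < |bcde|. The limit points i and -i have product 1, so that the
  expected value acquires a pole, and the contour is pinched at z = i and z = -i. There the weight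
  \<open>1/\<Gamma>(z\<^sup>\<plusminus>\<^sup>2)\<close> does not vanish, whereas it would at 1 and
  -1. About \<open>\<alpha>\<close> it is only known that its product with a kernel is integrable.
  The kernel is continuous without zeros on the circle, so \<open>\<alpha>\<close> itself is
  integrable, and this is what makes Fubini available.\<close>

lemma uniform_limit_prodinf_geometric:
  fixes f :: "nat \<Rightarrow> 'a :: topological_space \<Rightarrow> complex"
  assumes A: "compact A" and cont: "\<And>n. continuous_on A (f n)"
    and bd: "\<And>n x. x \<in> A \<Longrightarrow> norm (f n x - 1) \<le> M * r ^ n" and r: "0 \<le> r" "r < 1"
  shows "uniform_limit A (\<lambda>N x. \<Prod>n<N. f n x) (\<lambda>x. \<Prod>n. f n x) sequentially"
proof -
  have "uniformly_convergent_on A (\<lambda>N x. \<Prod>n<N. f n x)"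
  proof (rule uniformly_convergent_on_prod'[OF cont A])
    show "uniformly_convergent_on A (\<lambda>N x. \<Sum>n<N. norm (f n x - 1))"
      by (rule Weierstrass_m_test'[where M = "\<lambda>n. M * r ^ n"])
         (use bd r in \<open>auto intro!: summable_mult summable_geometric\<close>)
  qed
  then obtain l where l: "uniform_limit A (\<lambda>N x. \<Prod>n<N. f n x) l sequentially"
    unfolding uniformly_convergent_on_def by blast
  have "l x = (\<Prod>n. f n x)" if x: "x \<in> A" for x
  proof -
    have "summable (\<lambda>n. norm (f n x - 1))"
      by (rule summable_comparison_test[where g = "\<lambda>n. M * r ^ n"])
         (use bd[OF x] r in \<open>auto intro!: summable_mult summable_geometric\<close>)
    then have "abs_convergent_prod (\<lambda>n. f n x)"
      by (simp add: abs_convergent_prod_conv_summable)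
    then have "convergent_prod (\<lambda>n. f n x)"
      by (rule abs_convergent_prod_imp_convergent_prod)
    then have "(\<lambda>n. f n x) has_prod (\<Prod>n. f n x)" by blast
    then have "(\<lambda>N. \<Prod>n<N. f n x) \<longlonglongrightarrow> (\<Prod>n. f n x)"
      by (rule has_prod_imp_tendsto')
    moreover have "(\<lambda>N. \<Prod>n<N. f n x) \<longlonglongrightarrow> l x"
      using l x by (rule tendsto_uniform_limitI)
    ultimately show ?thesis using LIMSEQ_unique by blast
  qed
  then show ?thesis using l by (subst uniform_limit_cong'[where g = "\<lambda>N x. \<Prod>n<N. f n x" and i = l]) auto
qed

lemma continuous_on_prodinf_geometric:
  fixes f :: "nat \<Rightarrow> 'a :: topological_space \<Rightarrow> complex"
  assumes A: "compact A" and cont: "\<And>n. continuous_on A (f n)"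
    and bd: "\<And>n x. x \<in> A \<Longrightarrow> norm (f n x - 1) \<le> M * r ^ n" and r: "0 \<le> r" "r < 1"
  shows "continuous_on A (\<lambda>x. \<Prod>n. f n x)"
proof (rule uniform_limit_theorem[OF _ uniform_limit_prodinf_geometric[OF assms]])
  show "\<forall>\<^sub>F n in sequentially. continuous_on A (\<lambda>x. \<Prod>n<n. f n x)"
    by (intro always_eventually allI continuous_on_prod cont)
qed auto

text \<open>\<open>M\<close> and \<open>r\<close> may depend on the compact set. This freedom is
  essential for variable bases, whose norm stays below 1 only locally uniformly.\<close>

lemma holomorphic_on_prodinf_geometric:
  assumes U: "open U" and hol: "\<And>n. f n holomorphic_on U"
    and bd: "\<And>K. compact K \<Longrightarrow> K \<subseteq> U \<Longrightarrow>
      \<exists>M r. 0 \<le> r \<and> r < 1 \<and> (\<forall>n. \<forall>w\<in>K. norm (f n w - 1) \<le> M * r ^ n)"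
  shows "(\<lambda>w. \<Prod>n. f n w) holomorphic_on U"
proof (rule holomorphic_uniform_sequence[OF U])
  show "(\<lambda>w. \<Prod>n<N. f n w) holomorphic_on U" for N
    by (intro holomorphic_intros hol)
  fix w assume "w \<in> U"
  then obtain d where d: "d > 0" "cball w d \<subseteq> U"
    using U open_contains_cball by blast
  then obtain M r where "0 \<le> r" "r < 1" "\<And>n x. x \<in> cball w d \<Longrightarrow> norm (f n x - 1) \<le> M * r ^ n"
    using bd[OF compact_cball, of w d] by blast
  then have "uniform_limit (cball w d) (\<lambda>N x. \<Prod>n<N. f n x) (\<lambda>x. \<Prod>n. f n x) sequentially"
    by (intro uniform_limit_prodinf_geometric[where M = M and r = r])
       (use hol d in \<open>auto intro!: holomorphic_on_imp_continuous_on intro: holomorphic_on_subset\<close>)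
  then show "\<exists>d>0. cball w d \<subseteq> U \<and>
      uniform_limit (cball w d) (\<lambda>N x. \<Prod>n<N. f n x) (\<lambda>w. \<Prod>n. f n w) sequentially"
    using d by blast
qed

section \<open>q-Pochhammer symbols with one and with two bases\<close>

definition qpoch :: "complex \<Rightarrow> complex \<Rightarrow> complex" where
  "qpoch p x = (\<Prod>k. 1 - x * p ^ k)"

definition qpoch2 :: "complex \<Rightarrow> complex \<Rightarrow> complex \<Rightarrow> complex" where
  "qpoch2 q p x = (\<Prod>j. qpoch p (x * q ^ j))"

lemma has_prod_qpoch:
  assumes "norm p < 1" shows "(\<lambda>k. 1 - x * p ^ k) has_prod qpoch p x"
proof -
  have "summable (\<lambda>k. norm ((1 - x * p ^ k) - 1))"
    using assms by (auto simp: norm_mult norm_power intro!: summable_mult summable_geometric)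
  then have "abs_convergent_prod (\<lambda>k. 1 - x * p ^ k)"
    by (subst abs_convergent_prod_conv_summable) 
  then have "convergent_prod (\<lambda>k. 1 - x * p ^ k)"
    by (rule abs_convergent_prod_imp_convergent_prod)
  then show ?thesis unfolding qpoch_def by blast
qed

lemma qpoch_rec: "norm p < 1 \<Longrightarrow> qpoch p x = (1 - x) * qpoch p (p * x)"
proof -
  assume p: "norm p < 1"
  have "(\<lambda>k. 1 - x * p ^ Suc k) has_prod qpoch p (p * x)"
    using has_prod_qpoch[OF p, of "p * x"] by (simp add: mult_ac)
  from has_prod_Suc_imp[OF this] have "(\<lambda>k. 1 - x * p ^ k) has_prod (qpoch p (p * x) * (1 - x))"
    by simp
  from has_prod_unique2[OF this has_prod_qpoch[OF p, of x]]
  show "qpoch p x = (1 - x) * qpoch p (p * x)" by (simp only: mult.commute)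
qed

lemma qpoch_eq_0_iff: "norm p < 1 \<Longrightarrow> qpoch p x = 0 \<longleftrightarrow> (\<exists>k. x * p ^ k = 1)"
  using has_prod_eq_0_iff[OF has_prod_qpoch, of p x] by auto

text \<open>The chain is |prod (1 + a) - 1| \<le> exp (sum |a|) - 1 \<le> y * exp y. The factor
  \<open>norm x\<close> in the bound matters: along \<open>x * q ^ j\<close> it decays
  geometrically, which makes the outer product over j converge.\<close>

lemma norm_qpoch_minus_1_le:
  assumes "norm p \<le> r" "r < 1"
  shows "norm (qpoch p x - 1) \<le> norm x / (1 - r) * exp (norm x / (1 - r))"
proof -
  have r: "0 \<le> r" using assms norm_ge_zero[of p] by linarith
  define y where "y = norm x / (1 - r)"
  have y: "y \<ge> 0" using assms by (simp add: y_def)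
  have sm: "(\<Sum>k<N. norm (- (x * p ^ k))) \<le> y" for N
  proof -
    have "(\<Sum>k<N. norm (- (x * p ^ k))) \<le> (\<Sum>k<N. norm x * r ^ k)"
      using assms by (intro sum_mono) (auto simp: norm_mult norm_power intro!: mult_left_mono power_mono)
    also have "\<dots> \<le> (\<Sum>k. norm x * r ^ k)"
      using assms r by (intro sum_le_suminf) (auto intro!: summable_mult summable_geometric)
    also have "\<dots> = y"
      using assms r by (subst suminf_mult) (auto simp: y_def suminf_geometric divide_inverse intro!: summable_geometric)
    finally show ?thesis .
  qed
  have fin: "norm ((\<Prod>k<N. 1 - x * p ^ k) - 1) \<le> y * exp y" for N
  proof -
    have "norm ((\<Prod>k<N. 1 + (- (x * p ^ k))) - 1) \<le> (\<Prod>k<N. 1 + norm (- (x * p ^ k))) - 1"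
      by (rule norm_prod_minus1_le_prod_minus1)
    also have "(\<Prod>k<N. 1 + norm (- (x * p ^ k))) \<le> exp (\<Sum>k<N. norm (- (x * p ^ k)))"
      by (rule prod_le_exp_sum) auto
    also have "\<dots> \<le> exp y" using sm by simp
    also have "exp y \<le> 1 + y * exp y"
    proof -
      have "exp y * (1 - y) \<le> exp y * exp (- y)"
        using exp_ge_add_one_self[of "-y"] by (intro mult_left_mono) auto
      then show ?thesis by (simp add: exp_minus algebra_simps)
    qed
    finally show ?thesis by simp
  qed
  have "norm p < 1" using assms by simp
  from has_prod_imp_tendsto'[OF has_prod_qpoch[OF this, of x]]
  have "(\<lambda>N. norm ((\<Prod>k<N. 1 - x * p ^ k) - 1)) \<longlonglongrightarrow> norm (qpoch p x - 1)"
    by (intro tendsto_intros)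
  from LIMSEQ_le_const2[OF this, of "y * exp y"] fin show ?thesis by (auto simp: y_def)
qed

lemma norm_qpoch_power_minus_1_le:
  assumes "norm x \<le> R" "norm q \<le> r" "norm p \<le> r" "r < 1"
  shows "norm (qpoch p (x * q ^ j) - 1) \<le> R / (1 - r) * exp (R / (1 - r)) * r ^ j"
proof -
  have r: "0 \<le> r" using assms(3) norm_ge_zero[of p] by linarith
  have R: "0 \<le> R" using assms(1) norm_ge_zero[of x] by linarith
  have le: "norm (x * q ^ j) \<le> R * r ^ j"
    using assms R by (auto simp: norm_mult norm_power intro!: mult_mono power_mono)
  moreover have "R * r ^ j \<le> R" using r R assms by (intro mult_left_le power_le_one) auto
  ultimately have le': "norm (x * q ^ j) \<le> R" by linarith
  have "norm (qpoch p (x * q ^ j) - 1) \<le> norm (x * q ^ j) / (1 - r) * exp (norm (x * q ^ j) / (1 - r))"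
    using assms by (intro norm_qpoch_minus_1_le) auto
  also have "\<dots> \<le> (R * r ^ j) / (1 - r) * exp (R / (1 - r))"
    using le le' assms r R by (intro mult_mono divide_right_mono) (auto intro!: divide_right_mono)
  finally show ?thesis by (simp add: mult_ac)
qed

lemma has_prod_qpoch2:
  assumes "norm q < 1" "norm p < 1" shows "(\<lambda>j. qpoch p (x * q ^ j)) has_prod qpoch2 q p x"
proof -
  define r where "r = max (norm q) (norm p)"
  have r: "norm q \<le> r" "norm p \<le> r" "r < 1" "0 \<le> r" using assms by (auto simp: r_def le_max_iff_disj)
  have "summable (\<lambda>j. norm (qpoch p (x * q ^ j) - 1))"
    by (rule summable_comparison_test[where g = "\<lambda>j. norm x / (1 - r) * exp (norm x / (1 - r)) * r ^ j"])
       (use norm_qpoch_power_minus_1_le[OF order.refl r(1,2,3)] r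
         in \<open>auto intro!: summable_mult summable_geometric simp del: exp_le_cancel_iff\<close>)
  then have "abs_convergent_prod (\<lambda>j. qpoch p (x * q ^ j))"
    by (subst abs_convergent_prod_conv_summable) 
  then have "convergent_prod (\<lambda>j. qpoch p (x * q ^ j))"
    by (rule abs_convergent_prod_imp_convergent_prod)
  then show ?thesis unfolding qpoch2_def by blast
qed

lemma qpoch2_rec:
  assumes "norm q < 1" "norm p < 1" shows "qpoch2 q p x = qpoch p x * qpoch2 q p (q * x)"
proof -
  have "(\<lambda>j. qpoch p (x * q ^ Suc j)) has_prod qpoch2 q p (q * x)"
    using has_prod_qpoch2[OF assms, of "q * x"] by (simp add: mult_ac)
  from has_prod_Suc_imp[OF this] have "(\<lambda>j. qpoch p (x * q ^ j)) has_prod (qpoch2 q p (q * x) * qpoch p x)"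
    by simp
  from has_prod_unique2[OF this has_prod_qpoch2[OF assms, of x]]
  show ?thesis by (simp only: mult.commute)
qed

text \<open>The definition treats the two bases differently. Splitting off the factor k = 0 from
  every inner product gives the recursion in the other base.\<close>

lemma qpoch2_rec':
  assumes "norm q < 1" "norm p < 1" shows "qpoch2 q p x = qpoch q x * qpoch2 q p (p * x)"
proof -
  have "(\<lambda>j. (1 - x * q ^ j) * qpoch p (p * x * q ^ j)) has_prod (qpoch q x * qpoch2 q p (p * x))"
    by (intro has_prod_mult has_prod_qpoch has_prod_qpoch2 assms)
  also have "(\<lambda>j. (1 - x * q ^ j) * qpoch p (p * x * q ^ j)) = (\<lambda>j. qpoch p (x * q ^ j))"
  proof
    show "(1 - x * q ^ j) * qpoch p (p * x * q ^ j) = qpoch p (x * q ^ j)" for j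
      using qpoch_rec[OF assms(2), of "x * q ^ j"] by (simp only: mult.assoc)
  qed
  finally show ?thesis using has_prod_unique2 has_prod_qpoch2[OF assms, of x] by blast
qed


lemma qpoch_nonzero: "norm p < 1 \<Longrightarrow> norm x < 1 \<Longrightarrow> qpoch p x \<noteq> 0"
proof
  assume a: "norm p < 1" "norm x < 1" "qpoch p x = 0"
  then obtain k where "x * p ^ k = 1" using qpoch_eq_0_iff by blast
  then have "norm x * norm p ^ k = 1" by (metis norm_mult norm_one norm_power)
  moreover have "norm x * norm p ^ k \<le> norm x * 1" using a by (intro mult_left_mono power_le_one) auto
  ultimately show False using a by simp
qed

lemma qpoch2_nonzero:
  assumes "norm q < 1" "norm p < 1" "norm x < 1" shows "qpoch2 q p x \<noteq> 0"
proof
  assume "qpoch2 q p x = 0"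
  then obtain j where "qpoch p (x * q ^ j) = 0"
    using has_prod_eq_0_iff[OF has_prod_qpoch2[OF assms(1,2)], of x] by auto
  moreover have "norm (x * q ^ j) < 1"
  proof -
    have "norm x * norm q ^ j \<le> norm x * 1" using assms by (intro mult_left_mono power_le_one) auto
    then show ?thesis using assms by (simp add: norm_mult norm_power)
  qed
  ultimately show False using qpoch_nonzero assms by blast
qed

text \<open>The maximum is attained, so a strict pointwise bound becomes a uniform one; this
  supplies the ratio of the geometric majorants.\<close>

lemma compact_norm_less_bound:
  fixes f :: "'a :: topological_space \<Rightarrow> complex"
  assumes "compact K" "continuous_on K f" "\<And>w. w \<in> K \<Longrightarrow> norm (f w) < 1"
  obtains r where "0 \<le> r" "r < 1" "\<And>w. w \<in> K \<Longrightarrow> norm (f w) \<le> r"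
proof (cases "K = {}")
  case True then show ?thesis using that[of 0] by auto
next
  case False
  have "continuous_on K (\<lambda>w. norm (f w))" by (intro continuous_intros assms)
  from continuous_attains_sup[OF assms(1) False this]
  obtain a where "a \<in> K" "\<forall>y\<in>K. norm (f y) \<le> norm (f a)" by blast
  then show ?thesis using that[of "norm (f a)"] assms by auto
qed

lemma compact_norm_bound:
  fixes f :: "'a :: topological_space \<Rightarrow> complex"
  assumes "compact K" "continuous_on K f"
  obtains R where "0 \<le> R" "\<And>w. w \<in> K \<Longrightarrow> norm (f w) \<le> R"
proof -
  have "compact (f ` K)" using assms compact_continuous_image by blast
  then obtain R where "R > 0" "\<forall>y\<in>f ` K. norm y \<le> R"
    using compact_imp_bounded bounded_pos by blast
  then show ?thesis using that[of R] by auto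
qed

lemma qpoch_bounds:
  fixes x p :: "'a :: topological_space \<Rightarrow> complex"
  assumes "compact K" "continuous_on K x" "continuous_on K p" "\<And>w. w \<in> K \<Longrightarrow> norm (p w) < 1"
  shows "\<exists>M r. 0 \<le> r \<and> r < 1 \<and> (\<forall>n. \<forall>w\<in>K. norm ((1 - x w * p w ^ n) - 1) \<le> M * r ^ n)"
proof -
  obtain r where r: "0 \<le> r" "r < 1" "\<And>w. w \<in> K \<Longrightarrow> norm (p w) \<le> r"
    using compact_norm_less_bound assms(1,3,4) by blast
  obtain R where R: "0 \<le> R" "\<And>w. w \<in> K \<Longrightarrow> norm (x w) \<le> R"
    using compact_norm_bound assms(1,2) by blast
  have "\<forall>n. \<forall>w\<in>K. norm ((1 - x w * p w ^ n) - 1) \<le> R * r ^ n"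
    using r R by (auto simp: norm_mult norm_power intro!: mult_mono power_mono)
  then show ?thesis using r by blast
qed

lemma qpoch2_bounds:
  fixes x q p :: "'a :: topological_space \<Rightarrow> complex"
  assumes "compact K" "continuous_on K x" "continuous_on K q" "continuous_on K p"
    "\<And>w. w \<in> K \<Longrightarrow> norm (q w) < 1" "\<And>w. w \<in> K \<Longrightarrow> norm (p w) < 1"
  shows "\<exists>M r. 0 \<le> r \<and> r < 1 \<and> (\<forall>n. \<forall>w\<in>K. norm (qpoch (p w) (x w * q w ^ n) - 1) \<le> M * r ^ n)"
proof -
  obtain r1 where r1: "0 \<le> r1" "r1 < 1" "\<And>w. w \<in> K \<Longrightarrow> norm (p w) \<le> r1"
    using compact_norm_less_bound assms(1,4,6) by blast
  obtain r2 where r2: "0 \<le> r2" "r2 < 1" "\<And>w. w \<in> K \<Longrightarrow> norm (q w) \<le> r2"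
    using compact_norm_less_bound assms(1,3,5) by blast
  obtain R where R: "0 \<le> R" "\<And>w. w \<in> K \<Longrightarrow> norm (x w) \<le> R"
    using compact_norm_bound assms(1,2) by blast
  define r where "r = max r1 r2"
  have r: "0 \<le> r" "r < 1" using r1 r2 by (auto simp: r_def)
  have "\<forall>n. \<forall>w\<in>K. norm (qpoch (p w) (x w * q w ^ n) - 1) \<le> R / (1 - r) * exp (R / (1 - r)) * r ^ n"
  proof (intro allI ballI norm_qpoch_power_minus_1_le)
    fix w assume "w \<in> K"
    then show "norm (x w) \<le> R" "norm (q w) \<le> r" "norm (p w) \<le> r"
      using R r1(3)[of w] r2(3)[of w] by (auto simp: r_def le_max_iff_disj)
  qed (use r in auto)
  then show ?thesis using r by blast
qed

lemma continuous_on_qpoch_compact: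
  fixes x p :: "'a :: topological_space \<Rightarrow> complex"
  assumes "compact K" "continuous_on K x" "continuous_on K p" "\<And>w. w \<in> K \<Longrightarrow> norm (p w) < 1"
  shows "continuous_on K (\<lambda>w. qpoch (p w) (x w))"
proof -
  obtain M r where "0 \<le> r" "r < 1" "\<And>n w. w \<in> K \<Longrightarrow> norm ((1 - x w * p w ^ n) - 1) \<le> M * r ^ n"
    using qpoch_bounds[OF assms] by blast
  then show ?thesis unfolding qpoch_def
    by (intro continuous_on_prodinf_geometric[where M = M and r = r] continuous_intros assms(1-3)) auto
qed

lemma continuous_on_qpoch2_compact:
  fixes x q p :: "'a :: topological_space \<Rightarrow> complex"
  assumes "compact K" "continuous_on K x" "continuous_on K q" "continuous_on K p"
    "\<And>w. w \<in> K \<Longrightarrow> norm (q w) < 1" "\<And>w. w \<in> K \<Longrightarrow> norm (p w) < 1"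
  shows "continuous_on K (\<lambda>w. qpoch2 (q w) (p w) (x w))"
proof -
  obtain M r where "0 \<le> r" "r < 1" "\<And>n w. w \<in> K \<Longrightarrow> norm (qpoch (p w) (x w * q w ^ n) - 1) \<le> M * r ^ n"
    using qpoch2_bounds[OF assms] by blast
  then show ?thesis unfolding qpoch2_def
    by (intro continuous_on_prodinf_geometric[where M = M and r = r] continuous_on_qpoch_compact 
          continuous_intros assms) auto
qed

lemma continuous_on_open_compactI:
  fixes f :: "'a :: euclidean_space \<Rightarrow> 'b :: topological_space"
  assumes "open S" "\<And>K. compact K \<Longrightarrow> K \<subseteq> S \<Longrightarrow> continuous_on K f"
  shows "continuous_on S f"
proof (rule continuous_at_imp_continuous_on, rule ballI)
  fix x assume "x \<in> S"
  then obtain d where "d > 0" "cball x d \<subseteq> S" using assms(1) open_contains_cball by blast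
  then have "continuous_on (ball x d) f"
    using continuous_on_subset[OF assms(2)[OF compact_cball] ball_subset_cball] by blast
  then show "isCont f x"
    using \<open>d > 0\<close> continuous_on_eq_continuous_at[OF open_ball] centre_in_ball by blast
qed

text \<open>On an arbitrary set \<open>S\<close> the convergence need not be uniform. Continuity is
  therefore shown on the open set of all admissible pairs of argument and base, where compact
  subsets suffice, and then pulled back along \<open>w \<mapsto> (x w, p w)\<close>.\<close>

lemma continuous_on_qpoch [continuous_intros]:
  assumes "continuous_on S x" "continuous_on S p" "\<And>w. w \<in> S \<Longrightarrow> norm (p w) < 1"
  shows "continuous_on S (\<lambda>w. qpoch (p w) (x w))"
proof -
  let ?T = "UNIV \<times> ball 0 1 :: (complex \<times> complex) set"
  have "continuous_on ?T (\<lambda>z. qpoch (snd z) (fst z))"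
  proof (rule continuous_on_open_compactI)
    show "open ?T" by (intro open_Times) auto
    fix K assume K: "compact K" "K \<subseteq> ?T"
    show "continuous_on K (\<lambda>z. qpoch (snd z) (fst z))"
      by (rule continuous_on_qpoch_compact) (use K in \<open>auto intro!: continuous_intros\<close>)
  qed
  moreover have "continuous_on S (\<lambda>w. (x w, p w))" by (intro continuous_intros assms)
  ultimately have "continuous_on S (\<lambda>w. qpoch (snd (x w, p w)) (fst (x w, p w)))"
    by (rule continuous_on_compose2) (use assms in auto)
  then show ?thesis by simp
qed

lemma continuous_on_qpoch2 [continuous_intros]:
  assumes "continuous_on S x" "continuous_on S q" "continuous_on S p" 
    "\<And>w. w \<in> S \<Longrightarrow> norm (q w) < 1" "\<And>w. w \<in> S \<Longrightarrow> norm (p w) < 1"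
  shows "continuous_on S (\<lambda>w. qpoch2 (q w) (p w) (x w))"
proof -
  let ?T = "UNIV \<times> ball 0 1 \<times> ball 0 1 :: (complex \<times> complex \<times> complex) set"
  let ?f = "\<lambda>z. qpoch2 (fst (snd z)) (snd (snd z)) (fst z)"
  have "continuous_on ?T ?f"
  proof (rule continuous_on_open_compactI)
    show "open ?T" by (intro open_Times) auto
    fix K assume K: "compact K" "K \<subseteq> ?T"
    show "continuous_on K ?f"
      by (rule continuous_on_qpoch2_compact) (use K in \<open>auto intro!: continuous_intros\<close>)
  qed
  moreover have "continuous_on S (\<lambda>w. (x w, q w, p w))" by (intro continuous_intros assms)
  ultimately have "continuous_on S (\<lambda>w. ?f (x w, q w, p w))"
    by (rule continuous_on_compose2) (use assms in auto)
  then show ?thesis by simp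
qed

lemma holomorphic_on_qpoch:
  assumes "open U" "x holomorphic_on U" "p holomorphic_on U" "\<And>w. w \<in> U \<Longrightarrow> norm (p w) < 1"
  shows "(\<lambda>w. qpoch (p w) (x w)) holomorphic_on U"
  unfolding qpoch_def
proof (rule holomorphic_on_prodinf_geometric[OF assms(1)])
  fix K assume "compact K" "K \<subseteq> U"
  then show "\<exists>M r. 0 \<le> r \<and> r < 1 \<and> (\<forall>n. \<forall>w\<in>K. norm ((1 - x w * p w ^ n) - 1) \<le> M * r ^ n)"
    using assms by (intro qpoch_bounds) (auto intro: holomorphic_on_imp_continuous_on holomorphic_on_subset)
qed (intro holomorphic_intros assms)

lemma holomorphic_on_qpoch2:
  assumes "open U" "x holomorphic_on U" "q holomorphic_on U" "p holomorphic_on U"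
    "\<And>w. w \<in> U \<Longrightarrow> norm (q w) < 1" "\<And>w. w \<in> U \<Longrightarrow> norm (p w) < 1"
  shows "(\<lambda>w. qpoch2 (q w) (p w) (x w)) holomorphic_on U"
  unfolding qpoch2_def
proof (rule holomorphic_on_prodinf_geometric[OF assms(1)])
  fix K assume "compact K" "K \<subseteq> U"
  then show "\<exists>M r. 0 \<le> r \<and> r < 1 \<and> (\<forall>n. \<forall>w\<in>K. norm (qpoch (p w) (x w * q w ^ n) - 1) \<le> M * r ^ n)"
    using assms by (intro qpoch2_bounds) (auto intro: holomorphic_on_imp_continuous_on holomorphic_on_subset)
qed (intro holomorphic_on_qpoch holomorphic_intros assms)

section \<open>The elliptic gamma function as a quotient of entire double products\<close>

definition egam :: "complex \<Rightarrow> complex \<Rightarrow> complex \<Rightarrow> complex" where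
  "egam q p x = qpoch2 q p (q * p / x) / qpoch2 q p x"

text \<open>Convergent products may be divided factor by factor, even where a denominator vanishes,
  under the convention that division by zero gives 0. Hence the equation has no exceptional points:
  it also covers poles and \<open>x = 0\<close>.\<close>

lemma ell_gamma_eq:
  assumes "norm q < 1" "norm p < 1"
  shows "ell_gamma q p x = egam q p x"
proof -
  have *: "(\<Prod>k. (1 - inverse x * q ^ (j + 1) * p ^ (k + 1)) / (1 - x * q ^ j * p ^ k)) =
      qpoch p (q * p / x * q ^ j) / qpoch p (x * q ^ j)" for j
  proof -
    have "(\<lambda>k. (1 - (q * p / x * q ^ j) * p ^ k) / (1 - x * q ^ j * p ^ k)) has_prod
        (qpoch p (q * p / x * q ^ j) / qpoch p (x * q ^ j))"
      by (intro has_prod_divide has_prod_qpoch assms)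
    from has_prod_unique[OF this] show ?thesis by (simp add: divide_inverse mult_ac)
  qed
  have "(\<lambda>j. qpoch p (q * p / x * q ^ j) / qpoch p (x * q ^ j)) has_prod egam q p x"
    unfolding egam_def by (intro has_prod_divide has_prod_qpoch2 assms)
  from has_prod_unique[OF this] show ?thesis unfolding ell_gamma_def * by (rule sym)
qed

lemma qpoch_inf_eq: "qpoch_inf q = qpoch q q"
  by (simp add: qpoch_inf_def qpoch_def)

section \<open>Theta functions\<close>

lemma egam_nonzero:
  assumes "norm q < 1" "norm p < 1" "norm (q * p) < norm x" "norm x < 1"
  shows "egam q p x \<noteq> 0"
proof -
  have "norm (q * p / x) < 1"
    using assms norm_ge_zero[of "q * p"] by (auto simp: norm_divide divide_simps simp del: norm_ge_zero)
  then show ?thesis unfolding egam_def using qpoch2_nonzero assms by simp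
qed

text \<open>The substitution of \<open>q * p / x\<close> for \<open>x\<close> exchanges numerator
  and denominator.\<close>

lemma egam_reflect: "x \<noteq> 0 \<Longrightarrow> q * p \<noteq> 0 \<Longrightarrow> egam q p (q * p / x) = 1 / egam q p x"
  by (simp add: egam_def)

lemma continuous_on_egam [continuous_intros]:
  assumes "continuous_on S x" "continuous_on S q" "continuous_on S p"
    "\<And>w. w \<in> S \<Longrightarrow> norm (q w) < 1" "\<And>w. w \<in> S \<Longrightarrow> norm (p w) < 1"
    "\<And>w. w \<in> S \<Longrightarrow> norm (x w) < 1" "\<And>w. w \<in> S \<Longrightarrow> x w \<noteq> 0"
  shows "continuous_on S (\<lambda>w. egam (q w) (p w) (x w))"
  unfolding egam_def by (intro continuous_intros assms) (use assms qpoch2_nonzero in blast)+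

lemma holomorphic_on_egam:
  assumes "open U" "x holomorphic_on U" "q holomorphic_on U" "p holomorphic_on U"
    "\<And>w. w \<in> U \<Longrightarrow> norm (q w) < 1" "\<And>w. w \<in> U \<Longrightarrow> norm (p w) < 1"
    "\<And>w. w \<in> U \<Longrightarrow> norm (x w) < 1" "\<And>w. w \<in> U \<Longrightarrow> x w \<noteq> 0"
  shows "(\<lambda>w. egam (q w) (p w) (x w)) holomorphic_on U"
  unfolding egam_def by (intro holomorphic_intros holomorphic_on_qpoch2 assms) (use assms qpoch2_nonzero in blast)+

text \<open>Jacobi's theta function in multiplicative notation, up to normalization; for
  \<open>p \<noteq> 0\<close> its zeros are the integer powers of \<open>p\<close>.\<close>

definition theta :: "complex \<Rightarrow> complex \<Rightarrow> complex" where
  "theta p x = qpoch p x * qpoch p (p / x)"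

text \<open>Multiplying the argument by \<open>q\<close> adds one factor to the numerator product
  and removes one from the denominator product; together they form \<open>theta p x\<close>. The
  bound \<open>norm x < 1\<close> makes the removed factor nonzero.\<close>

lemma egam_shift:
  assumes "norm q < 1" "norm p < 1" "norm x < 1" "x \<noteq> 0" "q \<noteq> 0"
  shows "egam q p (q * x) = theta p x * egam q p x"
proof -
  have "q * p / (q * x) = p / x" using assms by simp
  moreover have "qpoch2 q p (p / x) = qpoch p (p / x) * qpoch2 q p (q * p / x)"
    using qpoch2_rec[of q p "p / x"] assms by simp
  moreover have "qpoch2 q p x = qpoch p x * qpoch2 q p (q * x)"
    using qpoch2_rec assms by blast
  ultimately show ?thesis
    using qpoch_nonzero[of p x] assms by (simp add: egam_def theta_def)
qed

text \<open>Once the first factors \<open>1 - x\<close> and \<open>1 - 1 / x\<close> are split off,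
  the remaining product is the same at \<open>x\<close> and at \<open>1 / x\<close>.\<close>

lemma theta_inverse:
  assumes "norm p < 1" "x \<noteq> 0" shows "theta p (1 / x) = - theta p x / x"
proof -
  have "qpoch p x = (1 - x) * qpoch p (p * x)" "qpoch p (1 / x) = (1 - 1 / x) * qpoch p (p / x)"
    using qpoch_rec[OF assms(1), of x] qpoch_rec[OF assms(1), of "1 / x"] by simp_all
  moreover have "(1 - 1 / x) = - (1 - x) / x" using assms by (simp add: field_simps)
  ultimately have *: "theta p (1 / x) = - (1 - x) / x * qpoch p (p / x) * qpoch p (p * x)"
      "theta p x = (1 - x) * qpoch p (p * x) * qpoch p (p / x)"
    unfolding theta_def by simp_all
  show ?thesis unfolding * using assms(2) by (simp add: field_simps)
qed

lemma theta_reflect: "x \<noteq> 0 \<Longrightarrow> p \<noteq> 0 \<Longrightarrow> theta p (p / x) = theta p x"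
  by (simp add: theta_def)

lemma theta_mult_p:
  assumes "norm p < 1" "x \<noteq> 0" "p \<noteq> 0" shows "theta p (p * x) = - theta p x / x"
  using theta_reflect[of "1 / x" p] theta_inverse[of p x] assms by simp

lemma holomorphic_theta: "norm p < 1 \<Longrightarrow> theta p holomorphic_on -{0}"
  unfolding theta_def by (intro holomorphic_intros holomorphic_on_qpoch) auto

lemma holomorphic_on_theta [holomorphic_intros]:
  assumes "norm p < 1" "f holomorphic_on S" "\<And>x. x \<in> S \<Longrightarrow> f x \<noteq> 0"
  shows "(\<lambda>x. theta p (f x)) holomorphic_on S"
  using holomorphic_on_compose_gen[OF assms(2) holomorphic_theta[OF assms(1)]] assms(3)
  by (force simp: o_def)

lemma continuous_on_theta [continuous_intros]:
  assumes "norm p < 1" "continuous_on S f" "\<And>x. x \<in> S \<Longrightarrow> f x \<noteq> 0"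
  shows "continuous_on S (\<lambda>x. theta p (f x))"
  using continuous_on_compose2[OF holomorphic_on_imp_continuous_on[OF holomorphic_theta[OF assms(1)]] assms(2)]
    assms(3) by force

text \<open>An induction principle over the zeros of theta: they form the single orbit of 1 under
  multiplication by powers of \<open>p\<close>, so an invariant property holding at 1 holds at all
  of them. Integer exponents never have to be handled.\<close>

lemma theta_zero_induct:
  assumes "norm p < 1" "p \<noteq> 0" "theta p y = 0" "y \<noteq> 0"
    and 1: "P 1" and step: "\<And>y. y \<noteq> 0 \<Longrightarrow> P y \<longleftrightarrow> P (p * y)"
  shows "P y"
proof -
  have up: "P (p ^ k)" for k
  proof (induction k)
    case (Suc k)
    then show ?case using step[of "p ^ k"] assms(2) by simp
  qed (simp add: 1)
  have down: "y * p ^ k = 1 \<Longrightarrow> y \<noteq> 0 \<Longrightarrow> P y" for k y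
  proof (induction k arbitrary: y)
    case (Suc k)
    have "P (p * y)" using Suc.prems assms(2) by (intro Suc.IH) (auto simp: mult_ac)
    then show ?case using step Suc.prems by blast
  qed (use 1 in auto)
  \<comment> \<open>The first factor of theta gives the zeros with exponent at most 0, the second
    one those with positive exponent.\<close>
  consider k where "y * p ^ k = 1" | k where "p / y * p ^ k = 1"
    using assms(3) qpoch_eq_0_iff[OF assms(1)] by (auto simp: theta_def)
  then show ?thesis
  proof cases
    case 1 then show ?thesis using down assms by blast
  next
    case 2 then have "y = p ^ Suc k" using assms(4) by (simp add: field_simps)
    then show ?thesis using up by blast
  qed
qed

lemma theta_1: "theta p 1 = 0" if "norm p < 1"
  using qpoch_eq_0_iff[OF that, of 1] by (auto simp: theta_def intro: exI[of _ 0])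

lemma theta_field_derivative:
  "norm p < 1 \<Longrightarrow> x \<noteq> 0 \<Longrightarrow> (theta p has_field_derivative deriv (theta p) x) (at x)"
  using holomorphic_derivI[OF holomorphic_theta, of p x] by auto

lemma DERIV_theta:
  assumes "norm p < 1" "(g has_field_derivative D) (at x)" "g x \<noteq> 0"
  shows "((\<lambda>x. theta p (g x)) has_field_derivative deriv (theta p) (g x) * D) (at x)"
  using DERIV_chain2[where f = "theta p" and g = g, OF theta_field_derivative[OF assms(1,3)] assms(2)] .

text \<open>The zero at 1 is simple because the cofactor \<open>h\<close> of \<open>1 - x\<close>
  does not vanish there; the functional equation under \<open>y \<mapsto> p * y\<close> carries
  simplicity to all other zeros.\<close>

lemma theta_deriv_nonzero:
  assumes p: "norm p < 1" "p \<noteq> 0" and "theta p y = 0" "y \<noteq> 0"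
  shows "deriv (theta p) y \<noteq> 0"
proof -
  have "theta p y = 0 \<and> deriv (theta p) y \<noteq> 0"
  proof (rule theta_zero_induct[OF assms])
    define h where "h = (\<lambda>x. qpoch p (p * x) * qpoch p (p / x))"
    have h: "h holomorphic_on -{0}" unfolding h_def
      by (intro holomorphic_intros holomorphic_on_qpoch) (use p in auto)
    have eq: "theta p = (\<lambda>x. (1 - x) * h x)"
      unfolding theta_def h_def by (subst qpoch_rec[OF p(1)]) (simp only: mult.assoc)
    have "((\<lambda>x. (1 - x) * h x) has_field_derivative (1 - 1) * deriv h 1 + (-1) * h 1) (at 1)"
      using holomorphic_derivI[OF h, of 1] by (auto intro!: derivative_eq_intros)
    then have "deriv (theta p) 1 = - h 1" unfolding eq by (intro DERIV_imp_deriv) simp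
    moreover have "h 1 \<noteq> 0" unfolding h_def using qpoch_nonzero[OF p(1)] p by simp
    ultimately show "theta p 1 = 0 \<and> deriv (theta p) 1 \<noteq> 0" using theta_1 p by simp
  next
    fix y :: complex assume y: "y \<noteq> 0"
    show "(theta p y = 0 \<and> deriv (theta p) y \<noteq> 0) \<longleftrightarrow>
          (theta p (p * y) = 0 \<and> deriv (theta p) (p * y) \<noteq> 0)"
    proof (cases "theta p y = 0")
      case True
      have d1: "((\<lambda>x. theta p (p * x)) has_field_derivative p * deriv (theta p) (p * y)) (at y)"
      proof -
        have "((\<lambda>x. p * x) has_field_derivative p) (at y)" by (auto intro!: derivative_eq_intros)
        from DERIV_theta[OF p(1) this] show ?thesis using y p by (simp add: mult.commute[of _ p])
      qed
      have "((\<lambda>x. - theta p x / x) has_field_derivative - deriv (theta p) y / y) (at y)"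
        using y True by (auto intro!: derivative_eq_intros theta_field_derivative[OF p(1)] simp: field_simps)
      then have "((\<lambda>x. theta p (p * x)) has_field_derivative - deriv (theta p) y / y) (at y)"
        by (rule has_field_derivative_transform_within_open[of _ _ _ "-{0}"])
           (use y p theta_mult_p in auto)
      from DERIV_unique[OF d1 this] have "p * deriv (theta p) (p * y) = - deriv (theta p) y / y" .
      then show ?thesis using True theta_mult_p[OF p(1) y p(2)] y p by (auto simp: field_simps)
    qed (use theta_mult_p[OF p(1) y p(2)] y in auto)
  qed
  then show ?thesis by simp
qed

section \<open>Cancelling simple zeros, and functions with a multiplicative period\<close>

lemma DERIV_nonzero_eventually_nonzero:
  fixes f :: "complex \<Rightarrow> complex"
  assumes "(f has_field_derivative D) (at x)" "D \<noteq> 0 \<or> f x \<noteq> 0"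
  shows "eventually (\<lambda>y. f y \<noteq> 0) (at x)"
proof (cases "f x = 0")
  case True
  then have "((\<lambda>y. f y / (y - x)) \<longlongrightarrow> D) (at x)"
    using assms(1) by (simp add: has_field_derivative_iff)
  from tendsto_imp_eventually_ne[OF this, of 0] show ?thesis
    using assms(2) True by (auto elim!: eventually_mono)
next
  case False
  have "(f \<longlongrightarrow> f x) (at x)" using DERIV_isCont[OF assms(1)] isCont_def by blast
  from tendsto_imp_eventually_ne[OF this False] show ?thesis .
qed

lemma theta_eventually_nonzero:
  assumes "norm p < 1" "p \<noteq> 0" "c \<noteq> 0" "x \<noteq> 0"
  shows "eventually (\<lambda>y. theta p (y * c) \<noteq> 0) (at x)"
proof (rule DERIV_nonzero_eventually_nonzero)
  show "((\<lambda>y. theta p (y * c)) has_field_derivative deriv (theta p) (x * c) * c) (at x)"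
    by (rule DERIV_theta) (use assms in \<open>auto intro!: derivative_eq_intros\<close>)
  show "deriv (theta p) (x * c) * c \<noteq> 0 \<or> theta p (x * c) \<noteq> 0"
    using theta_deriv_nonzero[of p "x * c"] assms by auto
qed

text \<open>Simple zeros of \<open>H\<close> are cancelled by zeros of \<open>D\<close>. Near such a
  zero, \<open>D\<close> and \<open>H\<close> are replaced by their difference quotients
  \<open>D1\<close> and \<open>H1\<close>, which are holomorphic, and \<open>H1\<close> equals the
  nonzero derivative at the zero itself.\<close>

lemma holomorphic_quotient:
  assumes S: "open S" and D: "D holomorphic_on S" and H: "H holomorphic_on S"
    and z: "\<And>x. x \<in> S \<Longrightarrow> H x = 0 \<Longrightarrow> D x = 0 \<and> deriv H x \<noteq> 0"
  obtains E where "E holomorphic_on S" "\<And>x. x \<in> S \<Longrightarrow> D x = E x * H x"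
proof
  define E where "E = (\<lambda>x. if H x = 0 then deriv D x / deriv H x else D x / H x)"
  show "D x = E x * H x" if "x \<in> S" for x using z[OF that] by (auto simp: E_def)
  show "E holomorphic_on S"
  proof (subst holomorphic_on_open[OF S], rule ballI)
    fix a assume a: "a \<in> S"
    define D1 where "D1 = (\<lambda>z. if z = a then deriv D a else (D z - D a) / (z - a))"
    define H1 where "H1 = (\<lambda>z. if z = a then deriv H a else (H z - H a) / (z - a))"
    have D1: "D1 holomorphic_on S" unfolding D1_def by (rule pole_lemma_open[OF D S])
    have H1: "H1 holomorphic_on S" unfolding H1_def by (rule pole_lemma_open[OF H S])
    show "\<exists>f'. (E has_field_derivative f') (at a)"
    proof (cases "H a = 0")
      case False
      define T where "T = {x \<in> S. H x \<noteq> 0}"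
      have "T = S \<inter> H -` (-{0})" by (auto simp: T_def)
      then have "open T"
        using continuous_open_preimage[OF holomorphic_on_imp_continuous_on[OF H] S, of "-{0}"] by (simp add: open_Compl)
      moreover have "E holomorphic_on T"
      proof -
        have "(\<lambda>x. D x / H x) holomorphic_on T"
          by (intro holomorphic_intros holomorphic_on_subset[OF D] holomorphic_on_subset[OF H]) (auto simp: T_def)
        then show ?thesis by (rule holomorphic_transform) (auto simp: T_def E_def)
      qed
      ultimately show ?thesis using a False by (auto simp: T_def holomorphic_on_open)
    next
      case True
      \<comment> \<open>Any other zero of \<open>H\<close> is a zero of \<open>H1\<close> and hence
        lies outside \<open>T\<close>, so \<open>E\<close> agrees with \<open>D1 / H1\<close> on all
        of \<open>T\<close>.\<close>
      define T where "T = {x \<in> S. H1 x \<noteq> 0}"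
      have "T = S \<inter> H1 -` (-{0})" by (auto simp: T_def)
      then have "open T"
        using continuous_open_preimage[OF holomorphic_on_imp_continuous_on[OF H1] S, of "-{0}"] by (simp add: open_Compl)
      moreover have "E holomorphic_on T"
      proof -
        have "(\<lambda>x. D1 x / H1 x) holomorphic_on T"
          by (intro holomorphic_intros holomorphic_on_subset[OF D1] holomorphic_on_subset[OF H1]) (auto simp: T_def)
        then show ?thesis
          by (rule holomorphic_transform) (use z[OF a True] True in \<open>auto simp: T_def E_def D1_def H1_def\<close>)
      qed
      moreover have "a \<in> T" using a z[OF a True] by (auto simp: T_def H1_def)
      ultimately show ?thesis by (auto simp: holomorphic_on_open)
    qed
  qed
qed

text \<open>All values of \<open>f\<close> occur on \<open>K\<close>, so its modulus attains a
  maximum at a point of the open set \<open>S\<close>, and the maximum principle applies.\<close>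

lemma constant_of_compact_representatives:
  assumes f: "f holomorphic_on S" and S: "open S" "connected S" and K: "compact K" "K \<subseteq> S"
    and rep: "\<And>x. x \<in> S \<Longrightarrow> \<exists>y\<in>K. f x = f y" and xy: "x \<in> S" "y \<in> S"
  shows "f x = f y"
proof -
  have "K \<noteq> {}" using rep xy by blast
  moreover have "continuous_on K (\<lambda>x. norm (f x))"
    using f K by (intro continuous_intros holomorphic_on_imp_continuous_on) (auto intro: holomorphic_on_subset)
  ultimately obtain k where k: "k \<in> K" "\<forall>y\<in>K. norm (f y) \<le> norm (f k)"
    using continuous_attains_sup K by blast
  have "f constant_on S"
  proof (rule maximum_modulus_principle[OF f S S(1) order.refl])
    show "k \<in> S" using k K by blast
    show "norm (f z) \<le> norm (f k)" if "z \<in> S" for z using rep[OF that] k by auto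
  qed
  then show ?thesis using xy by (auto simp: constant_on_def)
qed

lemma multiplicative_period_representative:
  fixes p x :: complex and f :: "complex \<Rightarrow> 'a"
  assumes p: "0 < norm p" "norm p < 1" and r: "0 \<le> r" "r < norm p * \<rho>" "\<rho> < R"
    and per: "\<And>x. r < norm x \<Longrightarrow> norm x < R \<Longrightarrow> r < norm (p * x) \<Longrightarrow> f (p * x) = f x"
    and x: "r < norm x" "norm x < R"
  shows "\<exists>y. norm p * \<rho> \<le> norm y \<and> norm y \<le> \<rho> \<and> f x = f y"
proof -
  have "0 < norm p * \<rho>" using r by simp
  then have \<rho>: "0 < \<rho>" using p(1) by (simp add: zero_less_mult_iff)
  \<comment> \<open>Periodicity is assumed only inside the annulus. The moduli of the intermediate
    points lie between those of \<open>p ^ n * x\<close> and \<open>x\<close>, so the whole chain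
    stays there.\<close>
  have down: "f (p ^ n * x) = f x" if "r < norm (p ^ n * x)" "norm x < R" for n x
    using that
  proof (induction n)
    case (Suc n)
    have "norm p * norm (p ^ n * x) \<le> 1 * norm (p ^ n * x)" using p by (intro mult_right_mono) auto
    then have lt: "r < norm (p ^ n * x)" using Suc.prems by (simp add: norm_mult mult_ac)
    have "norm (p ^ n) * norm x \<le> 1 * norm x"
      using p by (intro mult_right_mono) (auto simp: norm_power intro!: power_le_one)
    then have "f (p * (p ^ n * x)) = f (p ^ n * x)"
      using Suc.prems lt by (intro per) (auto simp: norm_mult mult_ac)
    then show ?case using Suc lt by (simp add: mult_ac)
  qed auto
  have x0: "0 < norm x" using x r by linarith
  show ?thesis
  proof (cases "norm x \<le> \<rho>")
    case False
    \<comment> \<open>The first power that brings \<open>x\<close> below \<open>\<rho>\<close>; by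
      minimality it overshoots by at most one factor \<open>norm p\<close>.\<close>
    define n where "n = (LEAST n. norm p ^ n < \<rho> / norm x)"
    have ex: "\<exists>n. norm p ^ n < \<rho> / norm x" using real_arch_pow_inv p \<rho> x0 by simp
    have n: "norm p ^ n < \<rho> / norm x" unfolding n_def by (rule LeastI_ex[OF ex])
    have "n \<noteq> 0" using n False x0 by (intro notI) (simp add: field_simps)
    then obtain m where m: "n = Suc m" using not0_implies_Suc by blast
    have "\<not> norm p ^ m < \<rho> / norm x" using not_less_Least[of m "\<lambda>n. norm p ^ n < \<rho> / norm x"] m n_def by simp
    then have "norm p * (\<rho> / norm x) \<le> norm p * norm p ^ m" using p by (intro mult_left_mono) auto
    then have 1: "norm p * \<rho> \<le> norm (p ^ n * x)"
      using x0 m by (simp add: norm_mult norm_power field_simps)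
    have 2: "norm (p ^ n * x) \<le> \<rho>" using n x0 by (simp add: norm_mult norm_power field_simps)
    show ?thesis using 1 2 down[of n x] x r by (intro exI[of _ "p ^ n * x"]) auto
  next
    case True
    \<comment> \<open>Here \<open>x\<close> is too close to 0 and has to be divided by a power of
      \<open>p\<close>; the periodicity is then read from \<open>x / p ^ n\<close> down to
      \<open>x\<close>.\<close>
    define n where "n = (LEAST n. norm p ^ n < norm x / (norm p * \<rho>))"
    show ?thesis
    proof (cases "norm x < norm p * \<rho>")
      case False then show ?thesis using True by (intro exI[of _ x]) auto
    next
      case lt: True
      have ex: "\<exists>n. norm p ^ n < norm x / (norm p * \<rho>)" using real_arch_pow_inv p \<rho> x0 by simp
      have n: "norm p ^ n < norm x / (norm p * \<rho>)" unfolding n_def by (rule LeastI_ex[OF ex])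
      have "n \<noteq> 0" using n lt x0 \<rho> p by (intro notI) (simp add: field_simps)
      then obtain m where m: "n = Suc m" using not0_implies_Suc by blast
      have "\<not> norm p ^ m < norm x / (norm p * \<rho>)"
        using not_less_Least[of m "\<lambda>n. norm p ^ n < norm x / (norm p * \<rho>)"] m n_def by simp
      then have 1: "norm x / norm p ^ n \<le> \<rho>"
        using p \<rho> x0 m by (simp add: field_simps)
      have 2: "norm p * \<rho> \<le> norm x / norm p ^ n" using n p \<rho> by (simp add: field_simps)
      have "f (p ^ n * (x / p ^ n)) = f (x / p ^ n)"
        using 1 r x p by (intro down) (auto simp: norm_divide norm_power)
      then have "f x = f (x / p ^ n)" using p by simp
      then show ?thesis using 1 2 by (intro exI[of _ "x / p ^ n"]) (auto simp: norm_divide norm_power)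
    qed
  qed
qed

text \<open>The condition \<open>r < norm p * R\<close> says that the annulus is wider than a
  period. Hence some closed fundamental annulus, from \<open>norm p * \<rho>\<close> to
  \<open>\<rho>\<close>, lies inside it and serves as the compact set of representatives.\<close>

lemma multiplicative_periodic_constant:
  fixes p :: complex
  assumes p: "0 < norm p" "norm p < 1" and r: "0 \<le> r" "r < norm p * R"
    and f: "f holomorphic_on {x. r < norm x \<and> norm x < R}"
    and per: "\<And>x. r < norm x \<Longrightarrow> norm x < R \<Longrightarrow> r < norm (p * x) \<Longrightarrow> f (p * x) = f x"
    and x: "r < norm x" "norm x < R" and y: "r < norm y" "norm y < R"
  shows "f x = f y"
proof -
  obtain \<rho> where \<rho>: "r / norm p < \<rho>" "\<rho> < R"
    using dense[of "r / norm p" R] p r by (auto simp: field_simps)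
  then have r\<rho>: "r < norm p * \<rho>" using p by (simp add: field_simps)
  let ?K = "cball 0 \<rho> - ball 0 (norm p * \<rho>) :: complex set"
  show ?thesis
  proof (rule constant_of_compact_representatives[OF f])
    show "open {x::complex. r < norm x \<and> norm x < R}"
      by (intro open_Collect_conj open_Collect_less continuous_intros)
    show "connected {x::complex. r < norm x \<and> norm x < R}"
      using connected_annulus(1)[of r "0::complex" R] by simp
    show "compact ?K" by (intro compact_diff compact_cball open_ball)
    show "?K \<subseteq> {x. r < norm x \<and> norm x < R}" using \<rho> r\<rho> by auto
    show "\<exists>y\<in>?K. f x = f y" if "x \<in> {x. r < norm x \<and> norm x < R}" for x
      using multiplicative_period_representative[where f = f, OF p r(1) r\<rho> \<rho>(2) per, of x] that by auto
  qed (use x y in auto)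
qed

lemma periodic_constant_punctured_plane:
  fixes p :: complex
  assumes p: "0 < norm p" "norm p < 1" and f: "f holomorphic_on -{0}"
    and per: "\<And>x. x \<noteq> 0 \<Longrightarrow> f (p * x) = f x" and xy: "x \<noteq> 0" "y \<noteq> 0"
  shows "f x = f y"
proof -
  define R where "R = norm x + norm y + 1"
  show ?thesis
    by (rule multiplicative_periodic_constant[OF p, of 0 R])
       (use p xy in \<open>auto simp: R_def intro: holomorphic_on_subset[OF f] per intro!: mult_pos_pos add_nonneg_pos\<close>)
qed

text \<open>Removes genericity conditions: \<open>h\<close> encodes the condition, and it has no
  zeros in a punctured neighbourhood of \<open>x\<close>.\<close>

lemma eq_by_continuity:
  fixes f g h :: "complex \<Rightarrow> complex"
  assumes "continuous_on S f" "continuous_on S g" "open S" "x \<in> S"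
    and ev: "eventually (\<lambda>y. h y \<noteq> 0) (at x)" and eq: "\<And>y. y \<in> S \<Longrightarrow> h y \<noteq> 0 \<Longrightarrow> f y = g y"
  shows "f x = g x"
proof -
  have f: "(f \<longlongrightarrow> f x) (at x)" and g: "(g \<longlongrightarrow> g x) (at x)"
    using assms(1-4) continuous_on_eq_continuous_at isCont_def by blast+
  have "eventually (\<lambda>y. y \<in> S) (at x)" using assms(3,4) by (rule eventually_at_in_open')
  with ev have "eventually (\<lambda>y. f y = g y) (at x)" by eventually_elim (rule eq)
  then have "(f \<longlongrightarrow> g x) (at x)" using g by (subst tendsto_cong) 
  then show ?thesis using f tendsto_unique[OF at_neq_bot] by blast
qed

section \<open>The addition formula for theta functions\<close>

text \<open>This is Weierstrass's three-term identity. As functions of \<open>x\<close>, the left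
  side \<open>D\<close> and \<open>H\<close> acquire the same multiplier under
  \<open>x \<mapsto> p * x\<close>, and \<open>D\<close> vanishes at the zeros of \<open>H\<close>.
  Their quotient is thus holomorphic and periodic on the punctured plane, hence constant, and its
  value is found at \<open>x = z\<close>.\<close>

lemma theta_addition_generic:
  fixes p z u v :: complex
  assumes p: "norm p < 1" "p \<noteq> 0" and nz: "z \<noteq> 0" "u \<noteq> 0" "v \<noteq> 0"
    and gen: "theta p (z * u) \<noteq> 0" "theta p (z * v) \<noteq> 0" "theta p (u / v) \<noteq> 0" and x: "x \<noteq> 0"
  shows "theta p (x * z) * theta p (x * u * v / z) * theta p (u * z) * theta p (v * z)
     - z ^ 2 * (theta p (x / z) * theta p (x * u * v * z) * theta p (u / z) * theta p (v / z))
     = theta p (z ^ 2) * theta p (u * v) * theta p (x * u) * theta p (x * v)"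
proof -
  note th = theta_mult_p[OF p(1) _ p(2)]
  define D where "D = (\<lambda>x. theta p (x * z) * theta p (x * u * v / z) * theta p (u * z) * theta p (v * z)
     - z ^ 2 * (theta p (x / z) * theta p (x * u * v * z) * theta p (u / z) * theta p (v / z)))"
  define H where "H = (\<lambda>x. theta p (x * u) * theta p (x * v))"
  have Dp: "D (p * y) = D y / (u * v * y ^ 2)" if "y \<noteq> 0" for y
    using th[of "y * z"] th[of "y * u * v / z"] th[of "y / z"] th[of "y * u * v * z"] that nz
    by (simp add: D_def mult.assoc) (simp add: field_simps power2_eq_square)
  have Hp: "H (p * y) = H y / (u * v * y ^ 2)" if "y \<noteq> 0" for y
    using th[of "y * u"] th[of "y * v"] that nz
    by (simp add: H_def mult.assoc) (simp add: field_simps power2_eq_square)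
  have inv: "theta p (1 / (a * b)) = - theta p (a * b) / (a * b)" "theta p (a / b) = - theta p (b / a) * a / b"
    if "a \<noteq> 0" "b \<noteq> 0" for a b
    using theta_inverse[OF p(1), of "a * b"] theta_inverse[OF p(1), of "b / a"] that by auto
  \<comment> \<open>At these two points the inversion formula for theta makes the two terms of
    \<open>D\<close> equal.\<close>
  have D1: "D (1 / u) = 0" "D (1 / v) = 0"
    using inv(1)[of u z] inv(1)[of v z] inv(2)[of u z] inv(2)[of v z] nz
    by (simp_all add: D_def) (simp_all add: field_simps power2_eq_square)
  have zero: "D y = 0" if "theta p (y * c) = 0" "y \<noteq> 0" "c = u \<or> c = v" for y c
  proof -
    have "D (y * c / c) = 0"
    proof (rule theta_zero_induct[OF p that(1)])
      show "y * c \<noteq> 0" "D (1 / c) = 0" using that nz D1 by auto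
      show "D (y / c) = 0 \<longleftrightarrow> D (p * y / c) = 0" if "y \<noteq> 0" for y
        using Dp[of "y / c"] that nz \<open>c = u \<or> c = v\<close> by auto
    qed
    then show ?thesis using that nz by auto
  qed
  have holD: "D holomorphic_on -{0}" unfolding D_def by (intro holomorphic_intros p) (use nz in auto)
  have holH: "H holomorphic_on -{0}" unfolding H_def by (intro holomorphic_intros p) (use nz in auto)
  have simple: "D y = 0 \<and> deriv H y \<noteq> 0" if y: "y \<in> -{0}" "H y = 0" for y
  proof
    show "D y = 0" using that zero[of y u] zero[of y v] by (auto simp: H_def)
    \<comment> \<open>A common zero of the two factors would make \<open>u / v\<close> a zero of
      theta, since dividing by a power of \<open>p\<close> preserves zeros. So all zeros of
      \<open>H\<close> are simple.\<close>
    have not_both: "\<not> (theta p (y * u) = 0 \<and> theta p (y * v) = 0)"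
    proof
      assume a: "theta p (y * u) = 0 \<and> theta p (y * v) = 0"
      have "theta p (y * u / (y * v)) = 0"
      proof (rule theta_zero_induct[OF p(1,2), of "y * v" "\<lambda>w. theta p (y * u / w) = 0"])
        show "theta p (y * u / w) = 0 \<longleftrightarrow> theta p (y * u / (p * w)) = 0" if "w \<noteq> 0" for w
          using th[of "y * u / (p * w)"] that p nz y by (auto simp: field_simps)
      qed (use a y nz in auto)
      then show False using gen y nz by simp
    qed
    have "(H has_field_derivative deriv (theta p) (y * u) * u * theta p (y * v)
             + deriv (theta p) (y * v) * v * theta p (y * u)) (at y)"
    proof -
      have *: "((\<lambda>y. theta p (y * c)) has_field_derivative deriv (theta p) (y * c) * c) (at y)" if "c \<noteq> 0" for c
        by (rule DERIV_theta) (use p y that in \<open>auto intro!: derivative_eq_intros\<close>)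
      show ?thesis unfolding H_def
        using DERIV_mult[OF *[OF nz(2)] *[OF nz(3)]] by simp
    qed
    then have "deriv H y = deriv (theta p) (y * u) * u * theta p (y * v)
             + deriv (theta p) (y * v) * v * theta p (y * u)" by (rule DERIV_imp_deriv)
    then show "deriv H y \<noteq> 0"
      using y not_both theta_deriv_nonzero[OF p, of "y * u"] theta_deriv_nonzero[OF p, of "y * v"] nz
      by (auto simp: H_def)
  qed
  obtain E where E: "E holomorphic_on -{0}" "\<And>x. x \<in> -{0} \<Longrightarrow> D x = E x * H x"
    using holomorphic_quotient[OF _ holD holH simple] by (metis open_Compl closed_singleton)
  have per: "E (p * y) = E y" if "y \<noteq> 0" for y
  proof (rule eq_by_continuity[where h = H and S = "-{0}" and f = "\<lambda>y. E (p * y)" and g = E and x = y])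
    show "continuous_on (-{0}) (\<lambda>y. E (p * y))"
      by (rule continuous_on_compose2[OF holomorphic_on_imp_continuous_on[OF E(1)]])
         (use p in \<open>auto intro!: continuous_intros\<close>)
    show "continuous_on (-{0}) E" by (rule holomorphic_on_imp_continuous_on[OF E(1)])
    show "\<forall>\<^sub>F y in at y. H y \<noteq> 0"
      using theta_eventually_nonzero[OF p nz(2) that] theta_eventually_nonzero[OF p nz(3) that]
      by eventually_elim (simp add: H_def)
    show "E (p * y) = E y" if "y \<in> -{0}" "H y \<noteq> 0" for y
      using E(2)[of y] E(2)[of "p * y"] Dp[of y] Hp[of y] that p nz by auto
  qed (use that in auto)
  have "E x = E z"
    by (rule periodic_constant_punctured_plane[OF _ p(1) E(1) per]) (use p nz x in auto)
  moreover have "E z = theta p (z ^ 2) * theta p (u * v)"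
  proof -
    \<comment> \<open>At \<open>x = z\<close> the subtracted term contains \<open>theta p 1\<close>,
      which is 0.\<close>
    have "D z = theta p (z ^ 2) * theta p (u * v) * H z"
      using theta_1[OF p(1)] nz by (simp add: D_def H_def power2_eq_square mult_ac)
    moreover have "H z \<noteq> 0" using gen by (simp add: H_def)
    ultimately show ?thesis using E(2)[of z] nz by simp
  qed
  ultimately have "D x = theta p (z ^ 2) * theta p (u * v) * H x" using E(2)[of x] x by simp
  then show ?thesis unfolding D_def H_def by (simp only: mult.assoc)
qed

text \<open>The generic identity extends by continuity, first in \<open>z\<close> for fixed
  \<open>u\<close> with \<open>u / v\<close> generic, then in \<open>u\<close>.\<close>

lemma theta_addition:
  fixes p z u v x :: complex
  assumes p: "norm p < 1" "p \<noteq> 0" and nz: "z \<noteq> 0" "u \<noteq> 0" "v \<noteq> 0" "x \<noteq> 0"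
  shows "theta p (x * z) * theta p (x * u * v / z) * theta p (u * z) * theta p (v * z)
     - z ^ 2 * (theta p (x / z) * theta p (x * u * v * z) * theta p (u / z) * theta p (v / z))
     = theta p (z ^ 2) * theta p (u * v) * theta p (x * u) * theta p (x * v)"
proof -
  let ?L = "\<lambda>z u. theta p (x * z) * theta p (x * u * v / z) * theta p (u * z) * theta p (v * z)
     - z ^ 2 * (theta p (x / z) * theta p (x * u * v * z) * theta p (u / z) * theta p (v / z))"
  let ?R = "\<lambda>z u. theta p (z ^ 2) * theta p (u * v) * theta p (x * u) * theta p (x * v)"
  have 1: "?L z u = ?R z u" if "theta p (u / v) \<noteq> 0" "u \<noteq> 0" for u
  proof (rule eq_by_continuity[where h = "\<lambda>z. theta p (z * u) * theta p (z * v)" and S = "-{0}" and f = "\<lambda>z. ?L z u" and g = "\<lambda>z. ?R z u" and x = z])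
    show "\<forall>\<^sub>F y in at z. theta p (y * u) * theta p (y * v) \<noteq> 0"
      using theta_eventually_nonzero[OF p that(2) nz(1)] theta_eventually_nonzero[OF p nz(3) nz(1)]
      by eventually_elim simp
    show "?L z u = ?R z u" if "z \<in> -{0}" "theta p (z * u) * theta p (z * v) \<noteq> 0" for z
      by (rule theta_addition_generic) (use that \<open>u \<noteq> 0\<close> \<open>theta p (u / v) \<noteq> 0\<close> p nz in auto)
  qed (use nz that p in \<open>auto intro!: continuous_intros\<close>)
  show ?thesis
  proof (rule eq_by_continuity[where h = "\<lambda>u. theta p (u * (1 / v))" and S = "-{0}" and f = "\<lambda>u. ?L z u" and g = "\<lambda>u. ?R z u" and x = u])
    show "\<forall>\<^sub>F y in at u. theta p (y * (1 / v)) \<noteq> 0"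
      using theta_eventually_nonzero[OF p, of "1 / v" u] nz by simp
    show "?L z u = ?R z u" if "u \<in> -{0}" "theta p (u * (1 / v)) \<noteq> 0" for u
      by (rule 1) (use that in auto)
  qed (use nz p in \<open>auto intro!: continuous_intros\<close>)
qed

section \<open>Integrals over the unit circle\<close>

text \<open>Integration against dz/z gives 2 pi i times the mean over the circle, which is invariant
  under inversion and insensitive to scaling of the variable under a contour shift.\<close>

definition circle_integral :: "(complex \<Rightarrow> complex) \<Rightarrow> complex" where
  "circle_integral f = contour_integral (circlepath 0 1) (\<lambda>z. f z / z)"

definition unit_exp :: "real \<Rightarrow> complex" where
  "unit_exp x = exp (2 * of_real pi * \<i> * of_real x)"

lemma norm_unit_exp [simp]: "norm (unit_exp x) = 1"
  by (simp add: unit_exp_def norm_exp_eq_Re)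

lemma unit_exp_nonzero [simp]: "unit_exp x \<noteq> 0"
  by (simp add: unit_exp_def)

lemma circlepath_unit: "circlepath 0 1 x = unit_exp x"
  by (simp add: circlepath unit_exp_def)

lemma has_vector_derivative_circlepath_unit:
  "(circlepath 0 1 has_vector_derivative 2 * of_real pi * \<i> * unit_exp x) (at x within A)"
  using has_vector_derivative_circlepath[of 0 1 x A] by (simp add: unit_exp_def)

lemma vector_derivative_circlepath_unit:
  "vector_derivative (circlepath 0 1) (at x) = 2 * of_real pi * \<i> * unit_exp x"
  by (rule vector_derivative_at[OF has_vector_derivative_circlepath_unit])

lemma continuous_on_unit_exp [continuous_intros]:
  "continuous_on A f \<Longrightarrow> continuous_on A (\<lambda>x. unit_exp (f x))"
  unfolding unit_exp_def by (intro continuous_intros)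

lemma circle_integral_eq:
  "circle_integral f = 2 * of_real pi * \<i> * integral {0..1} (\<lambda>x. f (unit_exp x))"
proof -
  have "circle_integral f = integral {0..1} (\<lambda>x. 2 * of_real pi * \<i> * f (unit_exp x))"
    unfolding circle_integral_def contour_integral_integral
    by (intro integral_cong) (simp add: vector_derivative_circlepath_unit circlepath_unit)
  then show ?thesis by simp
qed

lemma circle_integral_cong:
  "(\<And>z. norm z = 1 \<Longrightarrow> f z = g z) \<Longrightarrow> circle_integral f = circle_integral g"
  by (simp add: circle_integral_eq)

lemma circle_integral_cmult: "circle_integral (\<lambda>z. c * f z) = c * circle_integral f"
  by (simp add: circle_integral_eq)

lemma continuous_on_circle_compose:
  assumes "continuous_on (sphere 0 1) f" shows "continuous_on A (\<lambda>x. f (unit_exp x))"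
  by (rule continuous_on_compose2[OF assms]) (auto intro!: continuous_intros)

lemma circle_integral_add:
  assumes "continuous_on (sphere 0 1) f" "continuous_on (sphere 0 1) g"
  shows "circle_integral (\<lambda>z. f z + g z) = circle_integral f + circle_integral g"
  unfolding circle_integral_eq
  by (subst integral_add)
     (auto intro!: integrable_continuous_interval continuous_on_circle_compose assms simp: ring_distribs)

lemma circle_integral_inverse:
  assumes "continuous_on (sphere 0 1) f"
  shows "circle_integral (\<lambda>z. f (1 / z)) = circle_integral f"
proof -
  have "((\<lambda>x. f (unit_exp x)) has_integral integral {0..1} (\<lambda>x. f (unit_exp x))) (cbox 0 1)"
    using integrable_integral[OF integrable_continuous_interval[OF continuous_on_circle_compose[OF assms]]] by simp
  from has_integral_affinity[OF this, of "-1" 1]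
  have "((\<lambda>x. f (unit_exp (1 - x))) has_integral integral {0..1} (\<lambda>x. f (unit_exp x))) {0..1}"
    by simp
  moreover have "unit_exp (1 - x) = 1 / unit_exp x" for x
    by (simp add: unit_exp_def exp_diff ring_distribs)
  ultimately have "integral {0..1} (\<lambda>x. f (1 / unit_exp x)) = integral {0..1} (\<lambda>x. f (unit_exp x))"
    by (simp add: integral_unique)
  then show ?thesis by (simp add: circle_integral_eq)
qed

lemma circle_integral_symmetrize:
  assumes "continuous_on (sphere 0 1) f"
  shows "circle_integral (\<lambda>z. f z + f (1 / z)) = 2 * circle_integral f"
proof -
  have "continuous_on (sphere 0 1) (\<lambda>z. f (1 / z))"
    by (rule continuous_on_compose2[OF assms]) (auto intro!: continuous_intros simp: norm_divide)
  then show ?thesis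
    using circle_integral_add[OF assms] circle_integral_inverse[OF assms] by simp
qed

text \<open>The unit circle is shrunk to radius \<open>norm h\<close> and rotated at the same time,
  through multiplication by \<open>exp (t * L)\<close> with t from 0 to 1; dz/z does not see the
  factor \<open>h\<close>.\<close>

lemma circle_integral_shift:
  assumes f: "f holomorphic_on S" "open S" and h: "h \<noteq> 0"
    and S: "\<And>y. norm h \<le> norm y \<Longrightarrow> norm y \<le> 1 \<Longrightarrow> y \<in> S" and h1: "norm h \<le> 1"
  shows "circle_integral f = circle_integral (\<lambda>z. f (h * z))"
proof -
  define \<gamma> where "\<gamma> = (\<lambda>x. h * circlepath 0 1 x)"
  define L where "L = Ln h"
  have L: "exp L = h" using h by (simp add: L_def)
  have ReL: "Re L \<le> 0" using h1 by (simp add: L_def h)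
  have vd: "(\<gamma> has_vector_derivative h * (2 * of_real pi * \<i> * unit_exp x)) (at x)" for x
    unfolding \<gamma>_def
    by (rule has_vector_derivative_mult_right[OF has_vector_derivative_circlepath_unit])
  have "homotopic_loops (S - {0}) (circlepath 0 1) \<gamma>"
    unfolding homotopic_loops
  proof (intro exI conjI)
    let ?H = "\<lambda>z :: real \<times> real. exp (of_real (fst z) * L) * circlepath 0 1 (snd z)"
    show "continuous_on ({0..1} \<times> {0..1}) ?H"
      unfolding circlepath_unit by (intro continuous_intros)
    show "?H \<in> {0..1} \<times> {0..1} \<rightarrow> S - {0}"
    proof
      fix z :: "real \<times> real" assume "z \<in> {0..1} \<times> {0..1}"
      then have z: "0 \<le> fst z" "fst z \<le> 1" by auto
      have n: "norm (?H z) = exp (fst z * Re L)"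
        by (simp add: norm_mult circlepath_unit norm_exp_eq_Re)
      have "fst z * Re L \<le> 0" using z ReL by (simp add: mult_nonneg_nonpos)
      moreover have "1 * Re L \<le> fst z * Re L" using z ReL by (intro mult_right_mono_neg) auto
      moreover have "norm h = exp (Re L)" using L norm_exp_eq_Re by metis
      ultimately have "?H z \<in> S" by (intro S) (auto simp: n)
      then show "?H z \<in> S - {0}" by (simp add: circlepath_unit)
    qed
    show "\<forall>x\<in>{0..1}. ?H (0, x) = circlepath 0 1 x" by simp
    show "\<forall>x\<in>{0..1}. ?H (1, x) = \<gamma> x" using L by (simp add: \<gamma>_def)
    show "\<forall>t\<in>{0..1}. pathfinish (?H \<circ> Pair t) = pathstart (?H \<circ> Pair t)"
      by (simp add: pathfinish_def pathstart_def circlepath_unit unit_exp_def)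
  qed
  moreover have "valid_path \<gamma>" unfolding \<gamma>_def
    using valid_path_compose_holomorphic[of "circlepath 0 1" "\<lambda>z. h * z" UNIV]
    by (auto simp: o_def intro!: holomorphic_intros)
  moreover have "(\<lambda>z. f z / z) holomorphic_on (S - {0})"
    using f by (intro holomorphic_intros holomorphic_on_subset[OF f(1)]) auto
  ultimately have "circle_integral f = contour_integral \<gamma> (\<lambda>z. f z / z)"
    unfolding circle_integral_def
    by (intro Cauchy_theorem_homotopic_loops[where S = "S - {0}"]) (use f in auto)
  also have "\<dots> = integral {0..1} (\<lambda>x. 2 * of_real pi * \<i> * f (h * unit_exp x))"
    unfolding contour_integral_integral vector_derivative_at[OF vd] 
    by (intro integral_cong) (simp add: \<gamma>_def circlepath_unit h)
  also have "\<dots> = circle_integral (\<lambda>z. f (h * z))" by (simp add: circle_integral_eq)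
  finally show ?thesis .
qed

lemma continuous_on_circle_integral:
  fixes f :: "'a :: topological_space \<Rightarrow> complex \<Rightarrow> complex"
  assumes "continuous_on (U \<times> sphere 0 1) (\<lambda>(w, z). f w z)"
  shows "continuous_on U (\<lambda>w. circle_integral (f w))"
proof -
  have "continuous_on (U \<times> cbox 0 1) (\<lambda>(w, x). f w (unit_exp x))"
  proof -
    have "continuous_on (U \<times> cbox 0 1) (\<lambda>y. (\<lambda>(w, z). f w z) (fst y, unit_exp (snd y)))"
      by (rule continuous_on_compose2[OF assms]) (auto intro!: continuous_intros)
    then show ?thesis by (simp add: split_beta)
  qed
  from integral_continuous_on_param[OF this]
  show ?thesis unfolding circle_integral_eq by (intro continuous_intros) simp
qed

text \<open>Morera's theorem: the integral over a triangle is exchanged with the circle integral,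
  and the inner triangle integrals vanish by Cauchy's theorem.\<close>

lemma holomorphic_on_circle_integral:
  fixes f :: "complex \<Rightarrow> complex \<Rightarrow> complex"
  assumes U: "open U" and cont: "continuous_on (U \<times> sphere 0 1) (\<lambda>(w, z). f w z)"
    and hol: "\<And>z. norm z = 1 \<Longrightarrow> (\<lambda>w. f w z) holomorphic_on U"
  shows "(\<lambda>w. circle_integral (f w)) holomorphic_on U"
proof (rule analytic_imp_holomorphic, rule Morera_triangle[OF continuous_on_circle_integral[OF cont] U], rule impI)
  fix a b c assume sub: "convex hull {a, b, c} \<subseteq> U"
  define I where "I = (\<lambda>a b z. contour_integral (linepath a b) (\<lambda>w. f w z))"
  have key: "contour_integral (linepath a b) (\<lambda>w. circle_integral (f w)) = circle_integral (I a b) \<and>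
      continuous_on (sphere 0 1) (I a b)" if ab: "closed_segment a b \<subseteq> U" for a b
  proof
    have "contour_integral (linepath a b) (\<lambda>w. circle_integral (f w)) =
        contour_integral (linepath a b) (\<lambda>w. contour_integral (circlepath 0 1) (\<lambda>z. f w z / z))"
      by (simp add: circle_integral_def)
    also have "\<dots> = contour_integral (circlepath 0 1) (\<lambda>z. contour_integral (linepath a b) (\<lambda>w. f w z / z))"
    proof (rule contour_integral_swap)
      have "continuous_on (closed_segment a b \<times> sphere 0 1) (\<lambda>y. (\<lambda>(w, z). f w z) y / snd y)"
        by (intro continuous_intros continuous_on_subset[OF cont]) (use ab in auto)
      then show "continuous_on (path_image (linepath a b) \<times> path_image (circlepath 0 1)) (\<lambda>(y1, y2). f y1 y2 / y2)"
        by (simp add: split_beta)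
      show "continuous_on {0..1} (\<lambda>t. vector_derivative (circlepath 0 1) (at t))"
        by (auto simp: vector_derivative_circlepath_unit intro!: continuous_intros)
    qed auto
    also have "\<dots> = circle_integral (I a b)"
      by (simp add: circle_integral_def I_def contour_integral_integral)
    finally show "contour_integral (linepath a b) (\<lambda>w. circle_integral (f w)) = circle_integral (I a b)" .
    have "continuous_on (sphere 0 1 \<times> cbox 0 1) (\<lambda>(z, t). f (linepath a b t) z * (b - a))"
    proof -
      have lin: "linepath a b t \<in> U" if "t \<in> {0..1}" for t
        using ab linepath_in_path[OF that] by blast
      have "continuous_on (sphere 0 1 \<times> cbox 0 (1::real)) (\<lambda>y. (\<lambda>(w, z). f w z) (linepath a b (snd y), fst y))"
      proof (rule continuous_on_compose2[OF cont])
        show "continuous_on (sphere 0 1 \<times> cbox 0 (1::real)) (\<lambda>y. (linepath a b (snd y), fst y))"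
          unfolding linepath_def by (intro continuous_intros)
      qed (use lin in auto)
      then show ?thesis by (auto simp: split_beta intro!: continuous_intros)
    qed
    from integral_continuous_on_param[OF this] show "continuous_on (sphere 0 1) (I a b)"
      unfolding I_def contour_integral_integral by simp
  qed
  have seg: "closed_segment a b \<subseteq> U" "closed_segment b c \<subseteq> U" "closed_segment c a \<subseteq> U"
    using order.trans[OF segments_subset_convex_hull(1) sub] order.trans[OF segments_subset_convex_hull(3) sub]
      order.trans[OF segments_subset_convex_hull(5) sub] by simp_all
  have "contour_integral (linepath a b) (\<lambda>w. circle_integral (f w)) +
        contour_integral (linepath b c) (\<lambda>w. circle_integral (f w)) +
        contour_integral (linepath c a) (\<lambda>w. circle_integral (f w)) =
        circle_integral (\<lambda>z. I a b z + I b c z + I c a z)"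
    using key[OF seg(1)] key[OF seg(2)] key[OF seg(3)]
    by (simp add: circle_integral_add continuous_on_add)
  also have "\<dots> = circle_integral (\<lambda>z. 0)"
  proof (rule circle_integral_cong)
    fix z :: complex assume z: "norm z = 1"
    have h: "(\<lambda>w. f w z) holomorphic_on (convex hull {a, b, c})"
      using hol[OF z] sub holomorphic_on_subset by blast
    have "((\<lambda>w. f w z) has_contour_integral 0) (linepath a b +++ linepath b c +++ linepath c a)"
      by (rule Cauchy_theorem_triangle[OF h])
    then have "contour_integral (linepath a b +++ linepath b c +++ linepath c a) (\<lambda>w. f w z) = 0"
      by (rule contour_integral_unique)
    moreover have "(\<lambda>w. f w z) contour_integrable_on linepath x y" if "closed_segment x y \<subseteq> U" for x y
      using holomorphic_on_imp_continuous_on[OF hol[OF z]] that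
      by (intro contour_integrable_continuous_linepath) (rule continuous_on_subset)
    ultimately show "I a b z + I b c z + I c a z = 0"
      using seg by (simp add: I_def add.assoc)
  qed
  also have "\<dots> = 0" by (simp add: circle_integral_eq)
  finally show "contour_integral (linepath a b) (\<lambda>w. circle_integral (f w)) +
        contour_integral (linepath b c) (\<lambda>w. circle_integral (f w)) +
        contour_integral (linepath c a) (\<lambda>w. circle_integral (f w)) = 0" .
qed

section \<open>The contiguous relation\<close>

definition egam_pm :: "complex \<Rightarrow> complex \<Rightarrow> complex \<Rightarrow> complex \<Rightarrow> complex" where
  "egam_pm q p a z = egam q p (a * z) * egam q p (a / z)"

text \<open>\<open>1/\<Gamma>(z\<^sup>\<plusminus>\<^sup>2)\<close> written without singularities on the unit circle\<close>
definition rec_egam_sq :: "complex \<Rightarrow> complex \<Rightarrow> complex \<Rightarrow> complex" where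
  "rec_egam_sq q p z = qpoch2 q p (z ^ 2) * qpoch2 q p (1 / z ^ 2) /
     (qpoch2 q p (q * p * z ^ 2) * qpoch2 q p (q * p / z ^ 2))"

text \<open>The elliptic beta integral in its symmetric form, meant for parameters with product
  \<open>p * q\<close>. Its expected value, up to a constant, has one gamma factor for each of the
  15 pairs.\<close>

definition beta6 where
  "beta6 q p a b c d e f = circle_integral (\<lambda>z. egam_pm q p a z * egam_pm q p b z * egam_pm q p c z *
     egam_pm q p d z * egam_pm q p e z * egam_pm q p f z * rec_egam_sq q p z)"

definition beta6_rhs where
  "beta6_rhs q p a b c d e f =
     egam q p (a * b) * egam q p (a * c) * egam q p (a * d) * egam q p (a * e) * egam q p (a * f) *
     egam q p (b * c) * egam q p (b * d) * egam q p (b * e) * egam q p (b * f) *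
     egam q p (c * d) * egam q p (c * e) * egam q p (c * f) *
     egam q p (d * e) * egam q p (d * f) * egam q p (e * f)"

text \<open>Isolates the factor \<open>1 - x\<close>, which vanishes on the circle when
  \<open>x\<close> is the square of 1 or -1; the cofactor has shifted arguments.\<close>

lemma qpoch2_ratio:
  assumes "norm q < 1" "norm p < 1" "norm (p * x) < 1"
  shows "qpoch2 q p x / qpoch2 q p (p * x) = (1 - x) * (qpoch2 q p (q * x) / qpoch2 q p (q * p * x))"
proof -
  have "qpoch2 q p x = (1 - x) * qpoch p (p * x) * qpoch2 q p (q * x)"
    using qpoch2_rec[OF assms(1,2), of x] qpoch_rec[OF assms(2), of x] by simp
  moreover have "qpoch2 q p (p * x) = qpoch p (p * x) * qpoch2 q p (q * p * x)"
    using qpoch2_rec[OF assms(1,2), of "p * x"] by (simp add: mult_ac)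
  ultimately show ?thesis using qpoch_nonzero[OF assms(2,3)] by simp
qed

text \<open>\<open>N z\<close> equals \<open>N (1 / z)\<close> times \<open>- (z ^ 2)\<close>, so
  the sum on the left is the left side of the addition formula times \<open>N (1 / z)\<close>. The
  factor \<open>theta p (z ^ 2)\<close> which the formula produces completes this to the
  weight.\<close>

lemma theta_symmetrized:
  assumes q: "norm q < 1" and p: "norm p < 1" "p \<noteq> 0" and nz: "a \<noteq> 0" "b \<noteq> 0" "c \<noteq> 0" and z: "norm z = 1"
  defines "N \<equiv> \<lambda>z. qpoch2 q p (z ^ 2) * qpoch2 q p (q / z ^ 2) / (qpoch2 q p (p * z ^ 2) * qpoch2 q p (q * p / z ^ 2))"
  shows "theta p (a * z) * theta p (b * z) * theta p (c * z) * theta p (a * b * c / z) * N (1 / z) +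
         theta p (a / z) * theta p (b / z) * theta p (c / z) * theta p (a * b * c * z) * N z =
         theta p (a * b) * theta p (a * c) * theta p (b * c) * rec_egam_sq q p z"
proof -
  have z0: "z \<noteq> 0" using z by auto
  \<comment> \<open>The part common to \<open>N z\<close>, \<open>N (1 / z)\<close> and the weight;
    it is invariant under inversion of z.\<close>
  define M where "M = (qpoch2 q p (q * z ^ 2) / qpoch2 q p (q * p * z ^ 2)) * (qpoch2 q p (q / z ^ 2) / qpoch2 q p (q * p / z ^ 2))"
  have N: "N z = (1 - z ^ 2) * M"
  proof -
    have "N z = (qpoch2 q p (z ^ 2) / qpoch2 q p (p * z ^ 2)) * (qpoch2 q p (q / z ^ 2) / qpoch2 q p (q * p / z ^ 2))"
      by (simp add: N_def)
    then show ?thesis unfolding M_def mult.assoc[symmetric]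
      using qpoch2_ratio[OF q p(1), of "z ^ 2"] z p by (simp add: norm_mult norm_power)
  qed
  have N': "N (1 / z) = (1 - 1 / z ^ 2) * M"
  proof -
    have "N (1 / z) = (qpoch2 q p (1 / z ^ 2) / qpoch2 q p (p / z ^ 2)) * (qpoch2 q p (q * z ^ 2) / qpoch2 q p (q * p * z ^ 2))"
      by (simp add: N_def power_divide)
    also have "qpoch2 q p (1 / z ^ 2) / qpoch2 q p (p / z ^ 2) = (1 - 1 / z ^ 2) * (qpoch2 q p (q / z ^ 2) / qpoch2 q p (q * p / z ^ 2))"
      using qpoch2_ratio[OF q p(1), of "1 / z ^ 2"] z p by (simp add: norm_divide norm_power)
    finally show ?thesis unfolding M_def by (simp only: mult_ac)
  qed
  have R: "rec_egam_sq q p z = theta p (z ^ 2) * (1 - 1 / z ^ 2) * M"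
  proof -
    have "qpoch2 q p (z ^ 2) = qpoch p (z ^ 2) * qpoch2 q p (q * z ^ 2)"
      "qpoch2 q p (1 / z ^ 2) = (1 - 1 / z ^ 2) * qpoch p (p / z ^ 2) * qpoch2 q p (q / z ^ 2)"
      using qpoch2_rec[OF q p(1), of "z ^ 2"] qpoch2_rec[OF q p(1), of "1 / z ^ 2"] qpoch_rec[OF p(1), of "1 / z ^ 2"]
      by simp_all
    then show ?thesis unfolding rec_egam_sq_def M_def theta_def by (simp only:) simp
  qed
  have "- (z ^ 2) * (1 - 1 / z ^ 2) = 1 - z ^ 2" using z0 by (simp add: field_simps)
  then have N'': "N z = - (z ^ 2) * ((1 - 1 / z ^ 2) * M)" using N by (simp only: mult.assoc[symmetric])
  have "theta p (a * z) * theta p (b * z) * theta p (c * z) * theta p (a * b * c / z) * N (1 / z) +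
         theta p (a / z) * theta p (b / z) * theta p (c / z) * theta p (a * b * c * z) * N z =
    (theta p (a * z) * theta p (a * b * c / z) * theta p (b * z) * theta p (c * z)
     - z ^ 2 * (theta p (a / z) * theta p (a * b * c * z) * theta p (b / z) * theta p (c / z))) * ((1 - 1 / z ^ 2) * M)"
    unfolding N' N'' by (simp only: ring_distribs) (simp add: mult_ac)
  also have "\<dots> = theta p (z ^ 2) * theta p (b * c) * theta p (a * b) * theta p (a * c) * ((1 - 1 / z ^ 2) * M)"
    by (subst theta_addition[OF p z0 nz(2,3,1)]) (rule refl)
  finally show ?thesis unfolding R by (simp only: mult_ac)
qed

text \<open>Here \<open>h\<close> is a square root of \<open>q\<close>. The stronger bounds on
  \<open>d\<close>, \<open>e\<close>, \<open>f\<close> keep the divided parameters in the unit disc,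
  so that no pole lies between the circles of radius \<open>norm h\<close> and 1.\<close>

lemma beta6_contiguous:
  assumes q: "norm q < 1" and p: "norm p < 1" "p \<noteq> 0" and h: "h ^ 2 = q" "h \<noteq> 0"
    and nz: "a \<noteq> 0" "b \<noteq> 0" "c \<noteq> 0" "d \<noteq> 0" "e \<noteq> 0" "f \<noteq> 0"
    and n: "norm a < 1" "norm b < 1" "norm c < 1" "norm d < norm h" "norm e < norm h" "norm f < norm h"
    and bal: "a * b * c * d * e * f = p * q"
  shows "theta p (a * b) * theta p (a * c) * theta p (b * c) * beta6 q p a b c d e f =
    theta p (d * e / q) * theta p (d * f / q) * theta p (e * f / q) *
      beta6 q p (h * a) (h * b) (h * c) (d / h) (e / h) (f / h)"
proof -
  have q0: "q \<noteq> 0" using h by auto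
  have nh: "norm h < 1" using q h(1) by (metis norm_ge_zero norm_power one_le_power linorder_not_le)
  define N where "N = (\<lambda>z. qpoch2 q p (z ^ 2) * qpoch2 q p (q / z ^ 2) / (qpoch2 q p (p * z ^ 2) * qpoch2 q p (q * p / z ^ 2)))"
  define G where "G = (\<lambda>\<alpha> \<delta> y. egam q p (\<alpha> * y) * egam q p (\<delta> / y))"
  \<comment> \<open>Symmetrizing \<open>\<Psi> (h * z)\<close> and \<open>\<Psi> z\<close> in \<open>z \<mapsto> 1/z\<close> gives multiples of the two integrands,
    while \<open>\<Psi>\<close> and \<open>\<Psi> (h * z)\<close> have the same integral by Cauchy's theorem.\<close>
  define \<Psi> where "\<Psi> = (\<lambda>y. G (h * a) (h * a) y * G (h * b) (h * b) y * G (h * c) (h * c) y *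
     G (d / h) (h * d) y * G (e / h) (h * e) y * G (f / h) (h * f) y * theta p (h * a * b * c / y) * N y)"
  \<comment> \<open>Each inequality keeps away from the poles of one factor of
    \<open>\<Psi>\<close>; all of them hold on the closed annulus swept by the contour.\<close>
  define S where "S = {y. norm (h * a * y) < 1 \<and> norm (h * b * y) < 1 \<and> norm (h * c * y) < 1 \<and>
     norm (d / h * y) < 1 \<and> norm (e / h * y) < 1 \<and> norm (f / h * y) < 1 \<and>
     norm (h * a) < norm y \<and> norm (h * b) < norm y \<and> norm (h * c) < norm y \<and>
     norm (h * d) < norm y \<and> norm (h * e) < norm y \<and> norm (h * f) < norm y \<and>
     norm (p * y ^ 2) < 1 \<and> norm (q * p) < norm (y ^ 2)}"
  have S: "open S" unfolding S_def
    by (intro open_Collect_conj open_Collect_less continuous_intros)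
  have S0: "y \<noteq> 0" if "y \<in> S" for y using that by (auto simp: S_def)
  have ann: "y \<in> S" if y: "norm h \<le> norm y" "norm y \<le> 1" for y
  proof -
    have y0: "y \<noteq> 0" using y h by auto
    have 1: "norm (h * x * y) < 1" "norm (h * x) < norm y" if "norm x < 1" for x
    proof -
      have hx: "norm (h * x) < norm h" using that h by (simp add: norm_mult)
      then show "norm (h * x) < norm y" using y by simp
      have "norm (h * x) * norm y \<le> norm (h * x) * 1" using y by (intro mult_left_mono) auto
      then show "norm (h * x * y) < 1" using hx nh by (simp add: norm_mult)
    qed
    have 2: "norm (x / h * y) < 1" if "norm x < norm h" for x
    proof -
      have "norm (x / h) * norm y \<le> norm (x / h) * 1" using y by (intro mult_left_mono) auto
      moreover have "norm (x / h) < 1" using that h by (simp add: norm_divide)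
      moreover have "norm (x / h * y) = norm (x / h) * norm y" by (rule norm_mult)
      ultimately show ?thesis by linarith
    qed
    have "norm p * norm y ^ 2 \<le> norm p * 1" using y by (intro mult_left_mono power_le_one) auto
    moreover have "norm (p * y ^ 2) = norm p * norm y ^ 2" by (simp add: norm_mult norm_power)
    ultimately have 3: "norm (p * y ^ 2) < 1" using p(1) by linarith
    have "norm (q * p) < norm q" using p q0 by (simp add: norm_mult)
    also have "norm q = norm h ^ 2" using h(1) by (metis norm_power)
    also have "\<dots> \<le> norm y ^ 2" using y by (intro power_mono) auto
    finally have 4: "norm (q * p) < norm (y ^ 2)" by (simp add: norm_power)
    show ?thesis unfolding S_def using 1 2 3 4 n nh by simp
  qed
  have holG: "G \<alpha> \<delta> holomorphic_on S" if "\<alpha> \<noteq> 0" "\<delta> \<noteq> 0" "\<And>y. y \<in> S \<Longrightarrow> norm (\<alpha> * y) < 1" "\<And>y. y \<in> S \<Longrightarrow> norm \<delta> < norm y" for \<alpha> \<delta>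
    unfolding G_def
    by (intro holomorphic_intros holomorphic_on_egam S)
       (use that S0 q p in \<open>auto simp: norm_divide field_simps intro!: divide_less_eq_1\<close>)
  have holN: "N holomorphic_on S"
    unfolding N_def
  proof (intro holomorphic_intros holomorphic_on_qpoch2 S)
    fix y assume y: "y \<in> S"
    then have "norm (q * p / y ^ 2) < 1" "norm (p * y ^ 2) < 1"
      using S0[OF y] by (auto simp: S_def norm_divide divide_less_eq)
    then show "qpoch2 q p (p * y ^ 2) * qpoch2 q p (q * p / y ^ 2) \<noteq> 0"
      using qpoch2_nonzero[OF q p(1)] by simp
  qed (use S0 q p in auto)
  have hol: "\<Psi> holomorphic_on S"
  proof -
    have "G (h * a) (h * a) holomorphic_on S" "G (h * b) (h * b) holomorphic_on S"
      "G (h * c) (h * c) holomorphic_on S" "G (d / h) (h * d) holomorphic_on S"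
      "G (e / h) (h * e) holomorphic_on S" "G (f / h) (h * f) holomorphic_on S"
      by (rule holG; use nz h in \<open>simp add: S_def\<close>)+
    moreover have "(\<lambda>y. theta p (h * a * b * c / y)) holomorphic_on S"
      by (intro holomorphic_intros p) (use nz h S0 in auto)
    ultimately show ?thesis unfolding \<Psi>_def by (intro holomorphic_on_mult holN)
  qed
  have sub: "sphere 0 1 \<subseteq> S" using ann nh by auto
  have cont: "continuous_on (sphere 0 1) \<Psi>"
    using holomorphic_on_imp_continuous_on[OF hol] sub continuous_on_subset by blast
  have cont': "continuous_on (sphere 0 1) (\<lambda>z. \<Psi> (h * z))"
    by (rule continuous_on_compose2[OF holomorphic_on_imp_continuous_on[OF hol]])
       (use ann nh in \<open>auto intro!: continuous_intros simp: norm_mult\<close>)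
  have shift: "egam q p (q * x) = theta p x * egam q p x" if "x \<noteq> 0" "norm x < 1" for x
    using egam_shift[OF q p(1) that(2,1) q0] .
  have 1: "\<Psi> (h * z) + \<Psi> (h * (1 / z)) = theta p (a * b) * theta p (a * c) * theta p (b * c) *
      (egam_pm q p a z * egam_pm q p b z * egam_pm q p c z * egam_pm q p d z * egam_pm q p e z * egam_pm q p f z * rec_egam_sq q p z)"
    if z: "norm z = 1" for z
  proof -
    have z0: "z \<noteq> 0" using z by auto
    define K where "K = egam_pm q p a z * egam_pm q p b z * egam_pm q p c z * egam_pm q p d z * egam_pm q p e z * egam_pm q p f z"
    \<comment> \<open>On the circle of radius \<open>norm h\<close> one argument becomes
      \<open>q * (x * w)\<close>, and shifting it back costs a theta factor. This happens for
      \<open>a\<close>, \<open>b\<close>, \<open>c\<close> only; for the other three the powers of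
      \<open>h\<close> cancel, as in \<open>G2\<close>.\<close>
    have G1: "G (h * x) (h * x) (h * w) = theta p (x * w) * (egam q p (x * w) * egam q p (x / w))"
      if "x \<noteq> 0" "norm x < 1" "norm w = 1" for x w
    proof -
      have *: "h * x * (h * w) = q * (x * w)" "h * x / (h * w) = x / w" using h by (simp_all add: power2_eq_square mult_ac)
      have "w \<noteq> 0" using that by auto
      then have "egam q p (q * (x * w)) = theta p (x * w) * egam q p (x * w)"
        using that by (intro shift) (auto simp: norm_mult)
      then show ?thesis unfolding G_def * by (simp only: mult.assoc)
    qed
    have G2: "G (x / h) (h * x) (h * w) = egam q p (x * w) * egam q p (x / w)" for x w
      using h by (simp add: G_def)
    have N1: "N (h * w) = N (1 / w)" if "norm w = 1" for w
    proof -
      have "(h * w) ^ 2 = q * w ^ 2" using h by (simp add: power_mult_distrib)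
      moreover have "w \<noteq> 0" using that by auto
      ultimately show ?thesis using q0 by (simp add: N_def power_divide mult_ac)
    qed
    have th: "theta p (h * a * b * c / (h * w)) = theta p (a * b * c / w)" for w
      using h by (simp add: mult.assoc)
    have iz: "norm (1 / z) = 1" using z by (simp add: norm_divide)
    have A: "\<Psi> (h * z) = K * (theta p (a * z) * theta p (b * z) * theta p (c * z) * theta p (a * b * c / z) * N (1 / z))"
      unfolding \<Psi>_def G2 th N1[OF z] G1[OF nz(1) n(1) z] G1[OF nz(2) n(2) z] G1[OF nz(3) n(3) z] K_def egam_pm_def
      by (simp only: mult_ac)
    have B: "\<Psi> (h * (1 / z)) = K * (theta p (a / z) * theta p (b / z) * theta p (c / z) * theta p (a * b * c * z) * N z)"
      unfolding \<Psi>_def G2 th N1[OF iz] G1[OF nz(1) n(1) iz] G1[OF nz(2) n(2) iz] G1[OF nz(3) n(3) iz] K_def egam_pm_def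
      by (simp add: mult_ac)
    show ?thesis
      unfolding A B K_def[symmetric] distrib_left[symmetric] N_def theta_symmetrized[OF q p nz(1,2,3) z]
      by (simp only: mult_ac)
  qed
  have dh: "norm (d / h) < 1" "norm (e / h) < 1" "norm (f / h) < 1"
    using n h by (auto simp: norm_divide)
  have nzh: "d / h \<noteq> 0" "e / h \<noteq> 0" "f / h \<noteq> 0" using nz h by auto
  have prods: "d / h * (e / h) = d * e / q" "d / h * (f / h) = d * f / q" "e / h * (f / h) = e * f / q"
    using h by (auto simp: power2_eq_square)
  have 2: "\<Psi> z + \<Psi> (1 / z) = theta p (d * e / q) * theta p (d * f / q) * theta p (e * f / q) *
      (egam_pm q p (h * a) z * egam_pm q p (h * b) z * egam_pm q p (h * c) z *
       egam_pm q p (d / h) z * egam_pm q p (e / h) z * egam_pm q p (f / h) z * rec_egam_sq q p z)"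
    if z: "norm z = 1" for z
  proof -
    have z0: "z \<noteq> 0" using z by auto
    define K where "K = egam_pm q p (h * a) z * egam_pm q p (h * b) z * egam_pm q p (h * c) z *
       egam_pm q p (d / h) z * egam_pm q p (e / h) z * egam_pm q p (f / h) z"
    \<comment> \<open>On the unit circle the roles are exchanged: now \<open>d\<close>,
      \<open>e\<close>, \<open>f\<close> produce the theta factors.\<close>
    have G2: "G (x / h) (h * x) w = theta p (x / h / w) * (egam q p (x / h * w) * egam q p (x / h / w))"
      if "x / h \<noteq> 0" "norm (x / h) < 1" "norm w = 1" for x w
    proof -
      have *: "h * x / w = q * (x / h / w)" using h by (auto simp: power2_eq_square)
      have "w \<noteq> 0" using that by auto
      then have "egam q p (q * (x / h / w)) = theta p (x / h / w) * egam q p (x / h / w)"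
        using that by (intro shift) (auto simp: norm_divide norm_mult)
      then show ?thesis unfolding G_def * by (simp only: mult_ac)
    qed
    \<comment> \<open>The balancing condition enters here: together with the reflection of theta it
      rewrites the fourth theta factor in terms of \<open>d\<close>, \<open>e\<close>,
      \<open>f\<close>, as the addition formula demands.\<close>
    have th: "theta p (h * a * b * c / w) = theta p (d / h * (e / h) * (f / h) * w)" if "w \<noteq> 0" for w
    proof -
      have "h * a * b * c / w = p / (d / h * (e / h) * (f / h) * w)"
        using bal h nz that q0 by (simp add: field_simps power2_eq_square[symmetric] power3_eq_cube)
      then show ?thesis using theta_reflect[of "d / h * (e / h) * (f / h) * w" p] nz h that p by simp
    qed
    have iz: "norm (1 / z) = 1" "1 / z \<noteq> 0" using z z0 by (auto simp: norm_divide)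
    have A: "\<Psi> z = K * (theta p (d / h / z) * theta p (e / h / z) * theta p (f / h / z) * theta p (d / h * (e / h) * (f / h) * z) * N z)"
      unfolding \<Psi>_def th[OF z0] G2[OF nzh(1) dh(1) z] G2[OF nzh(2) dh(2) z] G2[OF nzh(3) dh(3) z] K_def egam_pm_def
      by (simp only: G_def mult_ac)
    have B: "\<Psi> (1 / z) = K * (theta p (d / h * z) * theta p (e / h * z) * theta p (f / h * z) * theta p (d / h * (e / h) * (f / h) / z) * N (1 / z))"
      unfolding \<Psi>_def th[OF iz(2)] G2[OF nzh(1) dh(1) iz(1)] G2[OF nzh(2) dh(2) iz(1)] G2[OF nzh(3) dh(3) iz(1)] K_def egam_pm_def
      by (simp add: G_def mult_ac)
    have "\<Psi> z + \<Psi> (1 / z) = \<Psi> (1 / z) + \<Psi> z" by (rule add.commute)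
    also have "\<dots> = K * (theta p (d / h * (e / h)) * theta p (d / h * (f / h)) * theta p (e / h * (f / h)) * rec_egam_sq q p z)"
      unfolding A B distrib_left[symmetric] N_def theta_symmetrized[OF q p nzh z] ..
    finally show ?thesis unfolding prods K_def by (simp only: mult_ac)
  qed
  have "theta p (a * b) * theta p (a * c) * theta p (b * c) * beta6 q p a b c d e f =
     circle_integral (\<lambda>z. \<Psi> (h * z) + \<Psi> (h * (1 / z)))"
    unfolding beta6_def circle_integral_cmult[symmetric] by (intro circle_integral_cong) (simp only: 1)
  also have "\<dots> = 2 * circle_integral (\<lambda>z. \<Psi> (h * z))"
    by (rule circle_integral_symmetrize[OF cont'])
  also have "circle_integral (\<lambda>z. \<Psi> (h * z)) = circle_integral \<Psi>"
    using circle_integral_shift[OF hol S h(2) ann] nh by simp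
  also have "2 * \<dots> = circle_integral (\<lambda>z. \<Psi> z + \<Psi> (1 / z))"
    by (rule circle_integral_symmetrize[OF cont, symmetric])
  also have "\<dots> = theta p (d * e / q) * theta p (d * f / q) * theta p (e * f / q) *
      beta6 q p (h * a) (h * b) (h * c) (d / h) (e / h) (f / h)"
    unfolding beta6_def circle_integral_cmult[symmetric] by (intro circle_integral_cong) (simp only: 2)
  finally show ?thesis .
qed

section \<open>Invariance of the quotient under shifts of parameters\<close>

definition unit_punctured :: "complex set" where
  "unit_punctured = {x. x \<noteq> 0 \<and> norm x < 1}"

lemma unit_punctured_mult [intro, simp]:
  "x \<in> unit_punctured \<Longrightarrow> y \<in> unit_punctured \<Longrightarrow> x * y \<in> unit_punctured"
  unfolding unit_punctured_def using mult_strict_mono[of "norm x" 1 "norm y" 1] by (auto simp: norm_mult)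

lemma egam_nonzero_factor:
  assumes "norm q < 1" "norm p < 1" "x \<in> unit_punctured" "y \<in> unit_punctured" "x * y = p * q"
  shows "egam q p x \<noteq> 0"
proof (rule egam_nonzero)
  show "norm x < 1" using assms by (simp add: unit_punctured_def)
  have "norm (q * p) = norm x * norm y" using assms by (metis mult.commute norm_mult)
  also have "\<dots> < norm x * 1" using assms by (intro mult_strict_left_mono) (auto simp: unit_punctured_def)
  finally show "norm (q * p) < norm x" by simp
qed (use assms in auto)

text \<open>For each pair, the product of the other four parameters complements it to
  \<open>p * q\<close> and has norm below 1, so the argument of that gamma factor has norm above
  \<open>norm (p * q)\<close>.\<close>

lemma beta6_rhs_nonzero:
  assumes q: "norm q < 1" and p: "norm p < 1"
    and u: "a \<in> unit_punctured" "b \<in> unit_punctured" "c \<in> unit_punctured" "d \<in> unit_punctured"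
      "e \<in> unit_punctured" "f \<in> unit_punctured"
    and bal: "a * b * c * d * e * f = p * q"
  shows "beta6_rhs q p a b c d e f \<noteq> 0"
proof -
  have *: "egam q p (x * y) \<noteq> 0" if "x \<in> unit_punctured" "y \<in> unit_punctured" "v \<in> unit_punctured"
    "w \<in> unit_punctured" "s \<in> unit_punctured" "t \<in> unit_punctured" "x * y * (v * w * s * t) = a * b * c * d * e * f" for x y v w s t
    by (rule egam_nonzero_factor[OF q p, of _ "v * w * s * t"]) (use that bal in auto)
  show ?thesis unfolding beta6_rhs_def
    using *[of a b c d e f] *[of a c b d e f] *[of a d b c e f] *[of a e b c d f] *[of a f b c d e]
      *[of b c a d e f] *[of b d a c e f] *[of b e a c d f] *[of b f a c d e]
      *[of c d a b e f] *[of c e a b d f] *[of c f a b d e]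
      *[of d e a b c f] *[of d f a b c e] *[of e f a b c d] u
    by (simp add: mult_ac)
qed

text \<open>The thetas of the contiguous relation are those by which \<open>beta6_rhs\<close>
  changes: three pairs are multiplied by \<open>q\<close>, three are divided by it, and the nine
  mixed pairs stay the same.\<close>

lemma beta6_ratio_half_shift:
  assumes q: "norm q < 1" and p: "norm p < 1" "p \<noteq> 0" and h: "h ^ 2 = q" "h \<noteq> 0"
    and u: "a \<in> unit_punctured" "b \<in> unit_punctured" "c \<in> unit_punctured"
      "d / h \<in> unit_punctured" "e / h \<in> unit_punctured" "f / h \<in> unit_punctured"
    and bal: "a * b * c * d * e * f = p * q"
  shows "beta6 q p (h * a) (h * b) (h * c) (d / h) (e / h) (f / h) /
      beta6_rhs q p (h * a) (h * b) (h * c) (d / h) (e / h) (f / h) =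
      beta6 q p a b c d e f / beta6_rhs q p a b c d e f"
proof -
  have q0: "q \<noteq> 0" using h by auto
  have "norm h < 1" using q h(1) by (metis norm_ge_zero norm_power one_le_power linorder_not_le)
  then have hu: "h \<in> unit_punctured" using h by (simp add: unit_punctured_def)
  have u': "h * a \<in> unit_punctured" "h * b \<in> unit_punctured" "h * c \<in> unit_punctured" using u hu by auto
  have ud: "d \<in> unit_punctured" "e \<in> unit_punctured" "f \<in> unit_punctured"
    using unit_punctured_mult[OF hu u(4)] unit_punctured_mult[OF hu u(5)] unit_punctured_mult[OF hu u(6)] h by auto
  have nz: "a \<noteq> 0" "b \<noteq> 0" "c \<noteq> 0" "d \<noteq> 0" "e \<noteq> 0" "f \<noteq> 0" using u by (auto simp: unit_punctured_def)
  have n: "norm a < 1" "norm b < 1" "norm c < 1" "norm d < norm h" "norm e < norm h" "norm f < norm h"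
    using u h by (auto simp: unit_punctured_def norm_divide)
  have bal': "(h * a) * (h * b) * (h * c) * (d / h) * (e / h) * (f / h) = p * q"
  proof -
    have "(h * a) * (h * b) * (h * c) * (d / h) * (e / h) * (f / h) = a * b * c * d * e * f" using h by simp
    then show ?thesis using bal by (simp only:)
  qed
  let ?R = "beta6_rhs q p a b c d e f" and ?R' = "beta6_rhs q p (h * a) (h * b) (h * c) (d / h) (e / h) (f / h)"
  have R: "?R \<noteq> 0" by (rule beta6_rhs_nonzero[OF q p(1) u(1-3) ud bal])
  have R': "?R' \<noteq> 0" by (rule beta6_rhs_nonzero[OF q p(1) u' u(4-6) bal'])
  have up: "egam q p (h * x * (h * y)) = theta p (x * y) * egam q p (x * y)"
    if "x \<in> unit_punctured" "y \<in> unit_punctured" for x y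
  proof -
    have "h * x * (h * y) = q * (x * y)" using h by (simp add: power2_eq_square mult_ac)
    then show ?thesis using egam_shift[OF q p(1) _ _ q0, of "x * y"] unit_punctured_mult[OF that]
      by (simp only: unit_punctured_def mem_Collect_eq simp_thms)
  qed
  have down: "egam q p (x * y) = theta p (x * y / q) * egam q p (x / h * (y / h))"
    if "x / h \<in> unit_punctured" "y / h \<in> unit_punctured" for x y
  proof -
    have "x / h * (y / h) = x * y / q" using h by (simp add: power2_eq_square)
    then show ?thesis using egam_shift[OF q p(1) _ _ q0, of "x * y / q"] unit_punctured_mult[OF that] q0
      by (simp add: unit_punctured_def)
  qed
  have mixed: "h * x * (y / h) = x * y" for x y using h by simp
  have key: "theta p (d * e / q) * theta p (d * f / q) * theta p (e * f / q) * ?R' =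
       theta p (a * b) * theta p (a * c) * theta p (b * c) * ?R"
    unfolding beta6_rhs_def up[OF u(1,2)] up[OF u(1,3)] up[OF u(2,3)] mixed
      down[OF u(4,5)] down[OF u(4,6)] down[OF u(5,6)]
    by (simp only: mult_ac)
  define T where "T = theta p (a * b) * theta p (a * c) * theta p (b * c)"
  define T' where "T' = theta p (d * e / q) * theta p (d * f / q) * theta p (e * f / q)"
  \<comment> \<open>\<open>T\<close> divides \<open>?R'\<close>, whose factors are known not to
    vanish.\<close>
  have "T \<noteq> 0"
  proof
    assume "T = 0"
    then have "?R' = 0"
      unfolding beta6_rhs_def up[OF u(1,2)] up[OF u(1,3)] up[OF u(2,3)] T_def by auto
    then show False using R' by simp
  qed
  moreover have "T' * ?R' = T * ?R" using key by (simp add: T_def T'_def)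
  moreover have "T * beta6 q p a b c d e f = T' * beta6 q p (h * a) (h * b) (h * c) (d / h) (e / h) (f / h)"
    unfolding T_def T'_def by (rule beta6_contiguous[OF q p h nz n bal])
  moreover have "x' / r' = x / r" if "T \<noteq> 0" "T' * r' = T * r" "T * x = T' * x'" "r \<noteq> 0" "r' \<noteq> 0" for x x' r r'
  proof -
    have "T * (x' * r) = x' * (T * r)" by simp
    also have "\<dots> = x' * (T' * r')" using that by simp
    also have "\<dots> = (T' * x') * r'" by simp
    also have "\<dots> = T * (x * r')" using that by simp
    finally have "x' * r = x * r'" using that by simp
    then show ?thesis using that by (simp add: frac_eq_eq)
  qed
  ultimately show ?thesis using R R' by blast
qed

text \<open>Two half shifts: \<open>a, b, c\<close> against \<open>d, e, f\<close>, then
  \<open>a, d, e\<close> against \<open>b, c, f\<close>. The four parameters in the middle are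
  restored, while \<open>a\<close> gains and \<open>f\<close> loses a full factor
  \<open>q\<close>.\<close>

lemma beta6_ratio_shift:
  assumes q: "norm q < 1" and p: "norm p < 1" "p \<noteq> 0" and h: "h ^ 2 = q" "h \<noteq> 0"
    and u: "a \<in> unit_punctured" "b \<in> unit_punctured" "c \<in> unit_punctured"
      "d / h \<in> unit_punctured" "e / h \<in> unit_punctured" "f / q \<in> unit_punctured"
    and bal: "a * b * c * d * e * f = p * q"
  shows "beta6 q p (q * a) b c d e (f / q) / beta6_rhs q p (q * a) b c d e (f / q) =
      beta6 q p a b c d e f / beta6_rhs q p a b c d e f"
proof -
  have "norm h < 1" using q h(1) by (metis norm_ge_zero norm_power one_le_power linorder_not_le)
  then have hu: "h \<in> unit_punctured" using h by (simp add: unit_punctured_def)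
  have hh: "h * h = q" using h by (simp add: power2_eq_square)
  have fh: "f / h \<in> unit_punctured" using unit_punctured_mult[OF hu u(6)] hh[symmetric] h by simp
  have fq: "f / h / h \<in> unit_punctured" using u(6) hh by simp
  have sym: "beta6 q p (h * a) (h * b) (h * c) (d / h) (e / h) (f / h) /
      beta6_rhs q p (h * a) (h * b) (h * c) (d / h) (e / h) (f / h) =
      beta6 q p (h * a) (d / h) (e / h) (h * b) (h * c) (f / h) /
      beta6_rhs q p (h * a) (d / h) (e / h) (h * b) (h * c) (f / h)"
    by (simp only: beta6_def beta6_rhs_def mult_ac)
  have "beta6 q p (h * (h * a)) (h * (d / h)) (h * (e / h)) (h * b / h) (h * c / h) (f / h / h) /
      beta6_rhs q p (h * (h * a)) (h * (d / h)) (h * (e / h)) (h * b / h) (h * c / h) (f / h / h) =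
      beta6 q p (h * a) (d / h) (e / h) (h * b) (h * c) (f / h) /
      beta6_rhs q p (h * a) (d / h) (e / h) (h * b) (h * c) (f / h)"
    by (rule beta6_ratio_half_shift[OF q p h]) (use u hu fq h bal in \<open>auto simp: mult_ac\<close>)
  also have "\<dots> = beta6 q p a b c d e f / beta6_rhs q p a b c d e f"
    using beta6_ratio_half_shift[OF q p h u(1-5) fh bal] sym by simp
  finally have "beta6 q p (q * a) d e b c (f / q) / beta6_rhs q p (q * a) d e b c (f / q) =
    beta6 q p a b c d e f / beta6_rhs q p a b c d e f"
    using h(2) by (simp add: mult.assoc[symmetric] hh)
  then show ?thesis by (simp only: beta6_def beta6_rhs_def mult_ac)
qed

section \<open>The elliptic beta integral\<close>

text \<open>The sixth gamma pair, with parameter \<open>p * q / (a * b * c * d * e)\<close>, appears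
  through reflection as a denominator, which keeps its meaning when a base is 0.\<close>

definition beta5_integrand where
  "beta5_integrand q p a b c d e z =
     egam_pm q p a z * egam_pm q p b z * egam_pm q p c z * egam_pm q p d z * egam_pm q p e z *
     rec_egam_sq q p z / egam_pm q p (a * b * c * d * e) z"

definition beta5_rhs where
  "beta5_rhs q p a b c d e =
     egam q p (a * b) * egam q p (a * c) * egam q p (a * d) * egam q p (a * e) *
     egam q p (b * c) * egam q p (b * d) * egam q p (b * e) *
     egam q p (c * d) * egam q p (c * e) * egam q p (d * e) /
     (egam q p (b * c * d * e) * egam q p (a * c * d * e) * egam q p (a * b * d * e) *
      egam q p (a * b * c * e) * egam q p (a * b * c * d))"

definition beta5_ratio where
  "beta5_ratio q p a b c d e = circle_integral (beta5_integrand q p a b c d e) / beta5_rhs q p a b c d e"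

text \<open>The last inequality says that the sixth parameter has norm below 1.\<close>

definition beta5_domain where
  "beta5_domain q p a b c d e \<longleftrightarrow> norm q < 1 \<and> norm p < 1 \<and>
     a \<in> unit_punctured \<and> b \<in> unit_punctured \<and> c \<in> unit_punctured \<and> d \<in> unit_punctured \<and> e \<in> unit_punctured \<and>
     norm (p * q) < norm (a * b * c * d * e)"

lemma egam_nonzero_divisor:
  assumes "norm q < 1" "norm p < 1" "x \<in> unit_punctured" "norm (p * q) < norm (x * y)" "norm y \<le> 1"
  shows "egam q p x \<noteq> 0"
proof (rule egam_nonzero)
  have "norm (x * y) \<le> norm x * 1" using assms unfolding norm_mult by (intro mult_left_mono) auto
  then show "norm (q * p) < norm x" using assms(4) by (simp add: mult.commute)
qed (use assms in \<open>auto simp: unit_punctured_def\<close>)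

lemma unit_punctured_norm_le: "x \<in> unit_punctured \<Longrightarrow> norm x \<le> 1"
  by (simp add: unit_punctured_def)

lemma beta5_rhs_nonzero:
  assumes "beta5_domain q p a b c d e"
  shows "beta5_rhs q p a b c d e \<noteq> 0"
proof -
  have q: "norm q < 1" and p: "norm p < 1"
    and u: "a \<in> unit_punctured" "b \<in> unit_punctured" "c \<in> unit_punctured" "d \<in> unit_punctured" "e \<in> unit_punctured"
    and A: "norm (p * q) < norm (a * b * c * d * e)"
    using assms by (auto simp: beta5_domain_def)
  have *: "egam q p x \<noteq> 0" if "x \<in> unit_punctured" "y \<in> unit_punctured" "x * y = a * b * c * d * e" for x y
    using egam_nonzero_divisor[OF q p that(1) _ unit_punctured_norm_le[OF that(2)]] A that(3) by simp
  show ?thesis unfolding beta5_rhs_def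
    using *[of "a * b" "c * d * e"] *[of "a * c" "b * d * e"] *[of "a * d" "b * c * e"] *[of "a * e" "b * c * d"]
      *[of "b * c" "a * d * e"] *[of "b * d" "a * c * e"] *[of "b * e" "a * c * d"]
      *[of "c * d" "a * b * e"] *[of "c * e" "a * b * d"] *[of "d * e" "a * b * c"]
      *[of "b * c * d * e" a] *[of "a * c * d * e" b] *[of "a * b * d * e" c] *[of "a * b * c * e" d] *[of "a * b * c * d" e] u
    by (simp add: mult_ac)
qed

lemma beta5_ratio_eq_beta6_ratio:
  assumes dom: "beta5_domain q p a b c d e" and nz: "q \<noteq> 0" "p \<noteq> 0"
    and f: "a * b * c * d * e * f = p * q"
  shows "beta5_ratio q p a b c d e = beta6 q p a b c d e f / beta6_rhs q p a b c d e f"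
proof -
  have u: "a \<noteq> 0" "b \<noteq> 0" "c \<noteq> 0" "d \<noteq> 0" "e \<noteq> 0"
    using dom by (auto simp: beta5_domain_def unit_punctured_def)
  have refl: "egam q p y = 1 / egam q p x" if "y * x = p * q" "x \<noteq> 0" for x y
  proof -
    have "y = q * p / x" using that by (simp add: field_simps)
    then show ?thesis using egam_reflect[of x q p] that nz by simp
  qed
  have "circle_integral (beta5_integrand q p a b c d e) = beta6 q p a b c d e f"
    unfolding beta6_def
  proof (rule circle_integral_cong)
    fix z :: complex assume "norm z = 1"
    then have z: "z \<noteq> 0" by auto
    have "f * z * (a * b * c * d * e / z) = p * q" "f / z * (a * b * c * d * e * z) = p * q"
      using z f by (simp_all add: mult_ac)
    from refl[OF this(1)] refl[OF this(2)] u z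
    have "egam_pm q p f z = 1 / egam_pm q p (a * b * c * d * e) z"
      by (simp add: egam_pm_def mult_ac)
    then show "beta5_integrand q p a b c d e z = egam_pm q p a z * egam_pm q p b z * egam_pm q p c z *
         egam_pm q p d z * egam_pm q p e z * egam_pm q p f z * rec_egam_sq q p z"
      by (simp add: beta5_integrand_def)
  qed
  moreover have "beta6_rhs q p a b c d e f = beta5_rhs q p a b c d e"
  proof -
    have "egam q p (a * f) = 1 / egam q p (b * c * d * e)" "egam q p (b * f) = 1 / egam q p (a * c * d * e)"
      "egam q p (c * f) = 1 / egam q p (a * b * d * e)" "egam q p (d * f) = 1 / egam q p (a * b * c * e)"
      "egam q p (e * f) = 1 / egam q p (a * b * c * d)"
      by (rule refl; use f u in \<open>simp add: mult_ac\<close>)+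
    then show ?thesis by (simp add: beta6_rhs_def beta5_rhs_def)
  qed
  ultimately show ?thesis by (simp add: beta5_ratio_def)
qed

lemma beta5_ratio_swap: "beta5_ratio q p a b c d e = beta5_ratio q p b a c d e"
  unfolding beta5_ratio_def beta5_rhs_def beta5_integrand_def by (simp only: mult_ac)

lemma egam_pm_nonzero:
  assumes "norm q < 1" "norm p < 1" "x \<in> unit_punctured" "norm (p * q) < norm x" "norm z = 1"
  shows "egam_pm q p x z \<noteq> 0"
proof -
  have "norm (q * p) < norm (x * z)" "norm (q * p) < norm (x / z)" "norm (x * z) < 1" "norm (x / z) < 1"
    using assms by (auto simp: norm_mult norm_divide unit_punctured_def mult.commute)
  then show ?thesis unfolding egam_pm_def using egam_nonzero[OF assms(1,2)] by simp
qed

lemma unit_punctured_circle: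
  "x \<in> unit_punctured \<Longrightarrow> norm z = 1 \<Longrightarrow> x * z \<in> unit_punctured \<and> x / z \<in> unit_punctured"
  by (auto simp: unit_punctured_def norm_mult norm_divide)

lemma continuous_on_egam_unit_punctured:
  assumes "continuous_on S x" "continuous_on S q" "continuous_on S p"
    "\<And>w. w \<in> S \<Longrightarrow> norm (q w) < 1" "\<And>w. w \<in> S \<Longrightarrow> norm (p w) < 1"
    "\<And>w. w \<in> S \<Longrightarrow> x w \<in> unit_punctured"
  shows "continuous_on S (\<lambda>w. egam (q w) (p w) (x w))"
  by (rule continuous_on_egam) (use assms in \<open>auto simp: unit_punctured_def\<close>)

lemma continuous_on_egam_pm:
  assumes "continuous_on S x" "continuous_on S q" "continuous_on S p" "continuous_on S z"
    "\<And>w. w \<in> S \<Longrightarrow> norm (q w) < 1" "\<And>w. w \<in> S \<Longrightarrow> norm (p w) < 1"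
    "\<And>w. w \<in> S \<Longrightarrow> x w \<in> unit_punctured" "\<And>w. w \<in> S \<Longrightarrow> norm (z w) = 1"
  shows "continuous_on S (\<lambda>w. egam_pm (q w) (p w) (x w) (z w))"
  unfolding egam_pm_def
  by (intro continuous_on_mult continuous_on_egam_unit_punctured continuous_on_divide assms)
     (use assms(5-8) unit_punctured_circle in fastforce)+

lemma rec_egam_sq_denominator_nonzero:
  assumes "norm q < 1" "norm p < 1" "norm z = 1"
  shows "qpoch2 q p (q * p * z ^ 2) * qpoch2 q p (q * p / z ^ 2) \<noteq> 0"
proof -
  have "norm q * norm p < 1 * 1" using assms by (intro mult_strict_mono) auto
  then show ?thesis using qpoch2_nonzero[OF assms(1,2)] assms(3) by (simp add: norm_mult norm_divide norm_power)
qed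

lemma continuous_on_rec_egam_sq:
  assumes "continuous_on S q" "continuous_on S p" "continuous_on S z"
    "\<And>w. w \<in> S \<Longrightarrow> norm (q w) < 1" "\<And>w. w \<in> S \<Longrightarrow> norm (p w) < 1" "\<And>w. w \<in> S \<Longrightarrow> norm (z w) = 1"
  shows "continuous_on S (\<lambda>w. rec_egam_sq (q w) (p w) (z w))"
proof -
  have "z w \<noteq> 0" if "w \<in> S" for w using assms(6)[OF that] by auto
  moreover have "qpoch2 (q w) (p w) (q w * p w * z w ^ 2) \<noteq> 0" "qpoch2 (q w) (p w) (q w * p w / z w ^ 2) \<noteq> 0"
    if "w \<in> S" for w
    using rec_egam_sq_denominator_nonzero[OF assms(4-6)[OF that]] by auto
  ultimately show ?thesis unfolding rec_egam_sq_def
    by (intro continuous_on_divide continuous_on_mult continuous_on_qpoch2 continuous_on_power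
         continuous_on_const assms) auto
qed

lemma continuous_on_beta5_integrand:
  assumes "continuous_on S a" "continuous_on S b" "continuous_on S c" "continuous_on S d" "continuous_on S e"
    "continuous_on S q" "continuous_on S p" "continuous_on S z"
    "\<And>w. w \<in> S \<Longrightarrow> beta5_domain (q w) (p w) (a w) (b w) (c w) (d w) (e w)" "\<And>w. w \<in> S \<Longrightarrow> norm (z w) = 1"
  shows "continuous_on S (\<lambda>w. beta5_integrand (q w) (p w) (a w) (b w) (c w) (d w) (e w) (z w))"
  unfolding beta5_integrand_def
  by (intro continuous_on_divide continuous_on_mult continuous_on_egam_pm continuous_on_rec_egam_sq assms
        egam_pm_nonzero ballI)
     (use assms(9,10) in \<open>auto simp: beta5_domain_def\<close>)

text \<open>All parameters and both bases vary at once, so one statement serves for moving a single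
  parameter, for the joint scaling of \<open>d, e, p\<close>, and for perturbing the bases.\<close>

lemma holomorphic_on_beta5_ratio:
  assumes U: "open U" and hol: "a holomorphic_on U" "b holomorphic_on U" "c holomorphic_on U"
      "d holomorphic_on U" "e holomorphic_on U" "q holomorphic_on U" "p holomorphic_on U"
    and dom: "\<And>w. w \<in> U \<Longrightarrow> beta5_domain (q w) (p w) (a w) (b w) (c w) (d w) (e w)"
  shows "(\<lambda>w. beta5_ratio (q w) (p w) (a w) (b w) (c w) (d w) (e w)) holomorphic_on U"
proof -
  have qp: "norm (q w) < 1" "norm (p w) < 1" if "w \<in> U" for w using dom[OF that] by (auto simp: beta5_domain_def)
  have u: "a w \<in> unit_punctured" "b w \<in> unit_punctured" "c w \<in> unit_punctured" "d w \<in> unit_punctured" "e w \<in> unit_punctured"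
    "norm (p w * q w) < norm (a w * b w * c w * d w * e w)"
    if "w \<in> U" for w using dom[OF that] by (auto simp: beta5_domain_def)
  have eg: "(\<lambda>w. egam (q w) (p w) (x w)) holomorphic_on U"
    if "x holomorphic_on U" "\<And>w. w \<in> U \<Longrightarrow> x w \<in> unit_punctured" for x
    by (rule holomorphic_on_egam[OF U that(1) hol(6,7)]) (use that qp in \<open>auto simp: unit_punctured_def\<close>)
  have pm: "(\<lambda>w. egam_pm (q w) (p w) (x w) z) holomorphic_on U"
    if "x holomorphic_on U" "\<And>w. w \<in> U \<Longrightarrow> x w \<in> unit_punctured" "norm z = 1" for x z
    unfolding egam_pm_def
    by (intro holomorphic_on_mult eg holomorphic_on_divide that holomorphic_on_const)
       (use that unit_punctured_circle in fastforce)+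
  have sq: "(\<lambda>w. rec_egam_sq (q w) (p w) z) holomorphic_on U" if "norm z = 1" for z
    unfolding rec_egam_sq_def
    by (intro holomorphic_on_divide holomorphic_on_mult holomorphic_on_qpoch2 U hol holomorphic_on_const qp
        rec_egam_sq_denominator_nonzero that) (use that in auto)
  have rhs: "(\<lambda>w. beta5_rhs (q w) (p w) (a w) (b w) (c w) (d w) (e w)) holomorphic_on U"
    unfolding beta5_rhs_def
  proof (intro holomorphic_on_divide holomorphic_on_mult eg hol unit_punctured_mult u)
    fix w assume "w \<in> U"
    from beta5_rhs_nonzero[OF dom[OF this]]
    show "egam (q w) (p w) (b w * c w * d w * e w) * egam (q w) (p w) (a w * c w * d w * e w) *
       egam (q w) (p w) (a w * b w * d w * e w) * egam (q w) (p w) (a w * b w * c w * e w) *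
       egam (q w) (p w) (a w * b w * c w * d w) \<noteq> 0"
      by (auto simp: beta5_rhs_def)
  qed
  have "(\<lambda>w. circle_integral (beta5_integrand (q w) (p w) (a w) (b w) (c w) (d w) (e w))) holomorphic_on U"
  proof (rule holomorphic_on_circle_integral[OF U])
    have c: "continuous_on (U \<times> sphere 0 1) (\<lambda>y. g (fst y))" if "g holomorphic_on U" for g :: "complex \<Rightarrow> complex"
      by (rule continuous_on_compose2[OF holomorphic_on_imp_continuous_on[OF that]])
         (auto intro!: continuous_intros)
    show "continuous_on (U \<times> sphere 0 1) (\<lambda>(w, z). beta5_integrand (q w) (p w) (a w) (b w) (c w) (d w) (e w) z)"
      unfolding split_beta
      by (intro continuous_on_beta5_integrand c hol continuous_on_snd continuous_on_id) (use dom in auto)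
    show "(\<lambda>w. beta5_integrand (q w) (p w) (a w) (b w) (c w) (d w) (e w) z) holomorphic_on U" if "norm z = 1" for z
      unfolding beta5_integrand_def
      by (intro holomorphic_on_divide holomorphic_on_mult pm sq hol that unit_punctured_mult u
            egam_pm_nonzero qp)
  qed
  then show ?thesis unfolding beta5_ratio_def
    by (intro holomorphic_on_divide rhs) (use beta5_rhs_nonzero dom in auto)
qed

text \<open>The domain condition is imposed at \<open>q * a\<close>, where it says that
  \<open>f / q\<close> lies in the unit disc. The conditions on \<open>d / h\<close> and
  \<open>e / h\<close> come from the intermediate half shift.\<close>

lemma beta5_ratio_shift:
  assumes dom: "beta5_domain q p (q * a) b c d e" and a: "norm a < 1" and nz: "q \<noteq> 0" "p \<noteq> 0"
    and h: "h ^ 2 = q" "d / h \<in> unit_punctured" "e / h \<in> unit_punctured"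
  shows "beta5_ratio q p (q * a) b c d e = beta5_ratio q p a b c d e"
proof -
  have q: "norm q < 1" and p: "norm p < 1" and h0: "h \<noteq> 0"
    and u: "a \<in> unit_punctured" "b \<in> unit_punctured" "c \<in> unit_punctured" "d \<in> unit_punctured" "e \<in> unit_punctured"
    and A: "norm (p * q) < norm (q * a * b * c * d * e)"
    using dom h(1) nz a by (auto simp: beta5_domain_def unit_punctured_def)
  define f where "f = p * q / (a * b * c * d * e)"
  have A0: "a * b * c * d * e \<noteq> 0" using u by (auto simp: unit_punctured_def)
  have f: "a * b * c * d * e * f = p * q" using A0 by (simp add: f_def)
  have f': "q * a * b * c * d * e * (f / q) = p * q"
    using f nz by (simp add: mult_ac)
  have "norm (f / q) < 1"
  proof -
    have "norm p < norm (a * b * c * d * e)" using A nz by (simp add: norm_mult mult_ac)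
    then show ?thesis using nz A0 by (simp add: f_def norm_divide norm_mult)
  qed
  then have fq: "f / q \<in> unit_punctured" using nz A0 by (simp add: unit_punctured_def f_def)
  have "norm q * norm (a * b * c * d * e) \<le> 1 * norm (a * b * c * d * e)" using q by (intro mult_right_mono) auto
  then have "norm (q * a * b * c * d * e) \<le> norm (a * b * c * d * e)" by (simp add: norm_mult mult_ac)
  then have dom': "beta5_domain q p a b c d e" using u q p A by (auto simp: beta5_domain_def)
  show ?thesis
    unfolding beta5_ratio_eq_beta6_ratio[OF dom nz f'] beta5_ratio_eq_beta6_ratio[OF dom' nz f]
    by (rule beta6_ratio_shift[OF q p nz(2) h(1) h0 u(1-3) h(2,3) fq f])
qed

text \<open>By \<open>small\<close>, the inner radius \<open>r\<close> of the annulus of admissible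
  first parameters is less than \<open>norm q\<close>, so the annulus is wider than a
  period.\<close>

lemma beta5_ratio_constant:
  assumes q: "norm q < 1" "q \<noteq> 0" and p: "norm p < 1" "p \<noteq> 0"
    and u: "b \<in> unit_punctured" "c \<in> unit_punctured" "d \<in> unit_punctured" "e \<in> unit_punctured"
    and h: "h ^ 2 = q" "d / h \<in> unit_punctured" "e / h \<in> unit_punctured"
    and small: "norm p < norm (b * c * d * e)"
    and a: "norm (p * q) < norm (a * (b * c * d * e))" "norm a < 1"
    and a': "norm (p * q) < norm (a' * (b * c * d * e))" "norm a' < 1"
  shows "beta5_ratio q p a b c d e = beta5_ratio q p a' b c d e"
proof -
  define B where "B = b * c * d * e"
  define r where "r = norm (p * q) / norm B"
  have B: "B \<noteq> 0" using u by (auto simp: B_def unit_punctured_def)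
  have r: "r < norm x \<longleftrightarrow> norm (p * q) < norm (x * B)" for x
    using B by (simp add: r_def divide_less_eq norm_mult)
  have r0: "0 \<le> r" by (simp add: r_def)
  have dom: "beta5_domain q p x b c d e" if "r < norm x" "norm x < 1" for x
  proof -
    have "x \<in> unit_punctured" using that r0 by (auto simp: unit_punctured_def)
    then show ?thesis using u q p r[of x] that by (simp add: beta5_domain_def B_def mult.assoc)
  qed
  show ?thesis
  proof (rule multiplicative_periodic_constant[where f = "\<lambda>x. beta5_ratio q p x b c d e" and p = q and r = r and R = 1])
    have "norm p < norm B" using small by (simp only: B_def)
    then show "r < norm q * 1"
      using q B by (simp add: r_def divide_less_eq norm_mult mult.commute)
    show "(\<lambda>x. beta5_ratio q p x b c d e) holomorphic_on {x. r < norm x \<and> norm x < 1}"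
      by (intro holomorphic_on_beta5_ratio holomorphic_intros open_Collect_conj open_Collect_less continuous_intros)
         (use dom in auto)
    show "beta5_ratio q p (q * x) b c d e = beta5_ratio q p x b c d e"
      if "r < norm x" "norm x < 1" "r < norm (q * x)" for x
    proof (rule beta5_ratio_shift[OF dom that(2) q(2) p(2) h])
      have "norm q * norm x < 1 * 1" using q that by (intro mult_strict_mono) auto
      then show "norm (q * x) < 1" by (simp add: norm_mult)
    qed (rule that)
  qed (use q r0 a a' r in \<open>auto simp: B_def\<close>)
qed

section \<open>Concentration of a Poisson kernel at i and -i\<close>

text \<open>The Poisson kernel of radius \<open>r ^ 2\<close> in the variable
  \<open>- (z ^ 2)\<close>. Its denominator is the product of the singular factors of the gamma
  functions with parameters \<open>\<i> * r\<close> and \<open>- \<i> * r\<close>.\<close>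

definition poisson :: "real \<Rightarrow> complex \<Rightarrow> complex" where
  "poisson r z = (1 - of_real r ^ 4) / ((1 + of_real r ^ 2 * z ^ 2) * (1 + of_real r ^ 2 / z ^ 2))"

lemma poisson_denominator:
  assumes r: "0 \<le> r" "r < 1" and z: "norm z \<le> 1"
  shows "1 + complex_of_real r ^ 2 * z ^ 2 \<noteq> 0"
proof
  assume "1 + complex_of_real r ^ 2 * z ^ 2 = 0"
  then have "norm (complex_of_real r ^ 2 * z ^ 2) = 1" by (metis add_eq_0_iff norm_minus_cancel norm_one)
  moreover have "norm (complex_of_real r ^ 2 * z ^ 2) = r ^ 2 * norm z ^ 2" using r by (simp add: norm_mult norm_power)
  moreover have "r ^ 2 * norm z ^ 2 \<le> r ^ 2 * 1" using z by (intro mult_left_mono power_le_one) auto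
  moreover have "r ^ 2 < 1" using r by (simp add: power_less_one_iff abs_square_less_1)
  ultimately show False by linarith
qed

lemma poisson_eq_norm:
  fixes z :: complex
  assumes z: "norm z = 1"
  shows "poisson r z = of_real ((1 - r ^ 4) / norm (1 + of_real r ^ 2 * z ^ 2) ^ 2)"
proof -
  have "z * cnj z = 1" using complex_norm_square[of z] z by simp
  then have "1 / z = cnj z" by (metis nonzero_mult_div_cancel_left mult_zero_left zero_neq_one)
  then have *: "1 / z ^ 2 = cnj (z ^ 2)" by (metis complex_cnj_power power_one_over)
  have "of_real r ^ 2 / z ^ 2 = of_real r ^ 2 * (1 / z ^ 2)" by simp
  then have "1 + of_real r ^ 2 / z ^ 2 = cnj (1 + of_real r ^ 2 * z ^ 2)"
    unfolding * by simp
  then have "(1 + of_real r ^ 2 * z ^ 2) * (1 + of_real r ^ 2 / z ^ 2) = of_real (norm (1 + of_real r ^ 2 * z ^ 2) ^ 2)"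
    by (simp only: complex_norm_square)
  then show ?thesis by (simp add: poisson_def)
qed

text \<open>By partial fractions the kernel is \<open>g z + g (1 / z) - 1\<close>. The mean of
  \<open>g\<close> is \<open>g 0 = 1\<close>, so the total mean is 1.\<close>

lemma circle_integral_poisson:
  assumes r: "0 \<le> r" "r < 1"
  shows "circle_integral (poisson r) = 2 * of_real pi * \<i>"
proof -
  define g where "g = (\<lambda>z. 1 / (1 + complex_of_real r ^ 2 * z ^ 2))"
  have "((\<lambda>z. g z / (z - 0)) has_contour_integral 2 * of_real pi * \<i> * g 0) (circlepath 0 1)"
    by (rule Cauchy_integral_circlepath_simple)
       (use poisson_denominator[OF r] in \<open>auto simp: g_def intro!: holomorphic_intros\<close>)
  then have g: "circle_integral g = 2 * of_real pi * \<i>"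
    unfolding circle_integral_def by (intro contour_integral_unique) (simp add: g_def)
  have cont: "continuous_on (sphere 0 1) g"
    unfolding g_def by (intro continuous_intros) (use poisson_denominator[OF r] in auto)
  have "circle_integral (poisson r) = circle_integral (\<lambda>z. (g z + g (1 / z)) + (- 1))"
  proof (rule circle_integral_cong)
    fix z :: complex assume z: "norm z = 1"
    have nz: "1 + complex_of_real r ^ 2 * z ^ 2 \<noteq> 0" "1 + complex_of_real r ^ 2 * (1 / z) ^ 2 \<noteq> 0"
      using poisson_denominator[OF r] z by (auto simp: norm_divide)
    define u v where "u = complex_of_real r ^ 2 * z ^ 2" and "v = complex_of_real r ^ 2 * (1 / z) ^ 2"
    have "z \<noteq> 0" using z by auto
    then have uv: "u * v = complex_of_real r ^ 4" by (simp add: u_def v_def power_divide)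
    have "1 + u \<noteq> 0" "1 + v \<noteq> 0" using nz by (auto simp: u_def v_def)
    moreover have "1 / a + 1 / b + - 1 = (b + a - a * b) / (a * b)" if "a \<noteq> 0" "b \<noteq> 0" for a b :: complex
      using that by (simp add: field_simps)
    ultimately have "(1 / (1 + u) + 1 / (1 + v)) + - 1 = ((1 + v) + (1 + u) - (1 + u) * (1 + v)) / ((1 + u) * (1 + v))"
      by blast
    also have "(1 + v) + (1 + u) - (1 + u) * (1 + v) = 1 - u * v" by (simp add: algebra_simps)
    finally have "(1 - of_real r ^ 4) / ((1 + u) * (1 + v)) = (1 / (1 + u) + 1 / (1 + v)) + - 1"
      unfolding uv ..
    then show "poisson r z = (g z + g (1 / z)) + (- 1)"
      unfolding poisson_def g_def u_def v_def by (simp add: power_divide)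
  qed
  also have "\<dots> = circle_integral (\<lambda>z. g z + g (1 / z)) + circle_integral (\<lambda>z. - 1)"
    by (intro circle_integral_add continuous_on_add continuous_on_const cont continuous_on_compose2[OF cont])
       (auto intro!: continuous_intros simp: norm_divide)
  also have "\<dots> = 2 * of_real pi * \<i>"
    unfolding circle_integral_symmetrize[OF cont] g by (simp add: circle_integral_eq)
  finally show ?thesis .
qed

lemma norm_circle_integral_le:
  assumes f: "continuous_on (sphere 0 1) f" and g: "continuous_on (sphere 0 1) (\<lambda>z. complex_of_real (g z))"
    and le: "\<And>z. norm z = 1 \<Longrightarrow> norm (f z) \<le> g z"
    and G: "circle_integral (\<lambda>z. of_real (g z)) = 2 * of_real pi * \<i> * of_real G"
  shows "norm (circle_integral f) \<le> 2 * pi * G"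
proof -
  have gi: "continuous_on {0..1} (\<lambda>x. g (unit_exp x))"
    using continuous_on_Re[OF continuous_on_circle_compose[OF g]] by simp
  have "norm (integral {0..1} (\<lambda>x. f (unit_exp x))) \<le> integral {0..1} (\<lambda>x. g (unit_exp x))"
    by (rule integral_norm_bound_integral)
       (use le in \<open>auto intro!: integrable_continuous_interval continuous_on_circle_compose f gi\<close>)
  moreover have "integral {0..1} (\<lambda>x. g (unit_exp x)) = G"
  proof -
    have "((\<lambda>x. g (unit_exp x)) has_integral integral {0..1} (\<lambda>x. g (unit_exp x))) {0..1}"
      using integrable_continuous_interval[OF gi] by (rule integrable_integral)
    then have "((\<lambda>x. complex_of_real (g (unit_exp x))) has_integral of_real (integral {0..1} (\<lambda>x. g (unit_exp x)))) {0..1}"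
      by (rule has_integral_of_real)
    then have "integral {0..1} (\<lambda>x. complex_of_real (g (unit_exp x))) = of_real (integral {0..1} (\<lambda>x. g (unit_exp x)))"
      by (rule integral_unique)
    then show ?thesis using G by (simp add: circle_integral_eq)
  qed
  ultimately show ?thesis by (simp add: circle_integral_eq norm_mult)
qed

text \<open>The double zeros of \<open>(1 + z ^ 2) ^ 2\<close> absorb the peaks: both
  \<open>1 - r ^ 2\<close> and, consequently, half of \<open>norm (1 + z ^ 2)\<close> are at most
  the norm \<open>D\<close> in the denominator.\<close>

lemma poisson_bound:
  fixes z :: complex
  assumes r: "0 \<le> r" "r < 1" and z: "norm z = 1"
  shows "norm (poisson r z) * norm (1 + z ^ 2) ^ 2 \<le> 4 * (1 - r ^ 4)"
proof -
  define D where "D = norm (1 + of_real r ^ 2 * z ^ 2)"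
  have D: "D > 0" using poisson_denominator[OF r, of z] z by (simp add: D_def)
  have r2: "r ^ 2 \<le> 1" "r ^ 4 \<le> 1" using r by (auto intro: power_le_one)
  have "norm (1 + z ^ 2 - (1 + of_real r ^ 2 * z ^ 2)) = norm (of_real (1 - r ^ 2) * z ^ 2)"
    by (simp add: algebra_simps)
  also have "\<dots> = 1 - r ^ 2" using z r2 unfolding norm_mult norm_of_real by (simp add: norm_power)
  finally have 1: "norm (1 + z ^ 2) \<le> D + (1 - r ^ 2)"
    using norm_triangle_ineq2[of "1 + z ^ 2" "1 + of_real r ^ 2 * z ^ 2"] by (simp add: D_def)
  have "norm (of_real r ^ 2 * z ^ 2) = r ^ 2" using z r by (simp add: norm_mult norm_power)
  then have "1 - r ^ 2 \<le> D"
    using norm_triangle_ineq4[of "1 + of_real r ^ 2 * z ^ 2" "of_real r ^ 2 * z ^ 2"] by (simp add: D_def)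
  with 1 have "norm (1 + z ^ 2) \<le> 2 * D" by linarith
  then have "norm (1 + z ^ 2) ^ 2 \<le> (2 * D) ^ 2" by (intro power_mono) auto
  then have "(1 - r ^ 4) * norm (1 + z ^ 2) ^ 2 \<le> (1 - r ^ 4) * (4 * D ^ 2)"
    using r2 by (intro mult_left_mono) (auto simp: power_mult_distrib)
  then have "((1 - r ^ 4) * norm (1 + z ^ 2) ^ 2) / D ^ 2 \<le> ((1 - r ^ 4) * (4 * D ^ 2)) / D ^ 2"
    by (intro divide_right_mono) auto
  moreover have "norm (poisson r z) = (1 - r ^ 4) / D ^ 2"
    unfolding poisson_eq_norm[OF z] norm_of_real using r2 D by (simp add: D_def)
  ultimately show ?thesis using D by simp
qed

text \<open>A single estimate
  \<open>norm (H r z - C) \<le> \<epsilon> + L * norm (1 + z ^ 2) ^ 2\<close> holds on the whole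
  circle for r near 1. Integrated against the kernel, its first term gives \<open>\<epsilon>\<close>
  and its second one a multiple of \<open>1 - r ^ 4\<close>, so the contour is never split.\<close>

lemma poisson_concentration:
  fixes H :: "real \<Rightarrow> complex \<Rightarrow> complex"
  assumes r0: "0 \<le> r0" "r0 < 1" and cont: "continuous_on ({r0..1} \<times> sphere 0 1) (\<lambda>(r, z). H r z)"
    and C: "H 1 \<i> = C" "H 1 (- \<i>) = C"
  shows "((\<lambda>r. circle_integral (\<lambda>z. poisson r z * H r z)) \<longlongrightarrow> 2 * of_real pi * \<i> * C) (at_left 1)"
proof -
  let ?I = "\<lambda>r. circle_integral (\<lambda>z. poisson r z * H r z)"
  let ?T = "{r0..1} \<times> sphere 0 1 :: (real \<times> complex) set"
  have contC: "continuous_on ?T (\<lambda>(r, z). H r z - C)"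
    using cont unfolding split_beta by (intro continuous_intros)
  have compT: "compact ?T" by (intro compact_Times) auto
  obtain M where M: "0 \<le> M" "\<And>y. y \<in> ?T \<Longrightarrow> norm ((\<lambda>(r, z). H r z - C) y) \<le> M"
    using compact_norm_bound[OF compT contC] by blast
  have bound: "\<exists>L. eventually (\<lambda>r. norm (?I r - 2 * of_real pi * \<i> * C) \<le> 2 * pi * (\<epsilon> + L * (1 - r ^ 4))) (at_left 1)"
    if \<epsilon>: "\<epsilon> > 0" for \<epsilon>
  proof -
    obtain \<delta> where \<delta>: "\<delta> > 0" "\<And>x y. x \<in> ?T \<Longrightarrow> y \<in> ?T \<Longrightarrow> dist y x < \<delta> \<Longrightarrow>
        dist ((\<lambda>(r, z). H r z - C) y) ((\<lambda>(r, z). H r z - C) x) < \<epsilon>"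
      using compact_uniformly_continuous[OF contC compT] \<epsilon> unfolding uniformly_continuous_on_def by metis
    \<comment> \<open>Outside the discs of radius \<open>\<delta> / 2\<close> about i and -i,
      \<open>norm (1 + z ^ 2)\<close> is at least \<open>(\<delta> / 2) ^ 2\<close>, so with this
      \<open>L\<close> the second term alone exceeds the global bound \<open>M\<close>.\<close>
    define L where "L = M / (\<delta> / 2) ^ 4"
    have L: "L \<ge> 0" using M \<delta> by (simp add: L_def)
    have pt: "norm (H r z - C) \<le> \<epsilon> + L * norm (1 + z ^ 2) ^ 2"
      if r: "r0 \<le> r" "r < 1" "1 - \<delta> / 2 < r" and z: "norm z = 1" for r z
    proof (cases "\<exists>s\<in>{\<i>, - \<i>}. norm (z - s) < \<delta> / 2")
      case True
      then obtain s where s: "s \<in> {\<i>, - \<i>}" "norm (z - s) < \<delta> / 2" by blast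
      have "dist (r, z) (1, s) \<le> dist r 1 + dist z s"
        unfolding dist_prod_def using sqrt_sum_squares_le_sum[of "dist r 1" "dist z s"] by simp
      also have "\<dots> < \<delta>" using s r by (simp add: dist_norm)
      finally have "dist ((\<lambda>(r, z). H r z - C) (r, z)) ((\<lambda>(r, z). H r z - C) (1, s)) < \<epsilon>"
        using r r0 z s by (intro \<delta>) auto
      then have "norm (H r z - C) < \<epsilon>" using s C by auto
      then show ?thesis using L by (smt (verit) zero_le_power2 mult_nonneg_nonneg)
    next
      case False
      have "1 + z ^ 2 = (z - \<i>) * (z + \<i>)" by (simp add: algebra_simps power2_eq_square)
      then have "norm (1 + z ^ 2) = norm (z - \<i>) * norm (z + \<i>)" by (simp add: norm_mult)
      moreover have "\<delta> / 2 * (\<delta> / 2) \<le> norm (z - \<i>) * norm (z + \<i>)"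
        using False \<delta>(1) by (intro mult_mono) auto
      ultimately have "(\<delta> / 2 * (\<delta> / 2)) ^ 2 \<le> norm (1 + z ^ 2) ^ 2"
        using \<delta>(1) by (intro power_mono) auto
      moreover have "(\<delta> / 2 * (\<delta> / 2)) ^ 2 = (\<delta> / 2) ^ 4"
        by (simp only: power2_eq_square power4_eq_xxxx mult.assoc)
      ultimately have "(\<delta> / 2) ^ 4 \<le> norm (1 + z ^ 2) ^ 2" by (simp only:)
      then have "L * (\<delta> / 2) ^ 4 \<le> L * norm (1 + z ^ 2) ^ 2" using L by (intro mult_left_mono)
      moreover have "L * (\<delta> / 2) ^ 4 = M" using \<delta>(1) by (simp add: L_def)
      moreover have "norm (H r z - C) \<le> M" using M(2)[of "(r, z)"] r z by simp
      ultimately show ?thesis using \<epsilon> by linarith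
    qed
    have "norm (?I r - 2 * of_real pi * \<i> * C) \<le> 2 * pi * (\<epsilon> + (4 * L) * (1 - r ^ 4))"
      if r: "r0 \<le> r" "r < 1" "1 - \<delta> / 2 < r" for r
    proof -
      have rr: "0 \<le> r" using r r0 by simp
      define P where "P = (\<lambda>z :: complex. (1 - r ^ 4) / norm (1 + of_real r ^ 2 * z ^ 2) ^ 2)"
      have P: "poisson r z = of_real (P z)" if "norm z = 1" for z
        using poisson_eq_norm[OF that, of r] by (simp add: P_def)
      have P0: "P z \<ge> 0" for z using rr r by (auto simp: P_def intro!: divide_nonneg_nonneg power_le_one)
      have contP: "continuous_on (sphere 0 1) (\<lambda>z. complex_of_real (P z))" unfolding P_def
        by (intro continuous_intros) (use poisson_denominator[OF rr r(2)] in auto)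
      then have contK: "continuous_on (sphere 0 1) (poisson r)"
        by (rule continuous_on_eq) (use P in auto)
      have contH: "continuous_on (sphere 0 1) (H r)"
      proof -
        have "continuous_on (sphere 0 1) (\<lambda>z. (\<lambda>(r, z). H r z) (r, z))"
          by (rule continuous_on_compose2[OF cont]) (use r r0 in \<open>auto intro!: continuous_intros\<close>)
        then show ?thesis by simp
      qed
      have "?I r = circle_integral (\<lambda>z. poisson r z * (H r z - C) + C * poisson r z)"
        by (intro circle_integral_cong) (simp add: algebra_simps)
      also have "\<dots> = circle_integral (\<lambda>z. poisson r z * (H r z - C)) + C * circle_integral (poisson r)"
        unfolding circle_integral_cmult[symmetric]
        by (intro circle_integral_add continuous_intros contK contH)
      finally have "?I r - 2 * of_real pi * \<i> * C = circle_integral (\<lambda>z. poisson r z * (H r z - C))"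
        using circle_integral_poisson[OF rr r(2)] by simp
      also have "norm \<dots> \<le> 2 * pi * (\<epsilon> + (4 * L) * (1 - r ^ 4))"
      proof (rule norm_circle_integral_le[where g = "\<lambda>z. \<epsilon> * P z + (4 * L) * (1 - r ^ 4)"])
        show "continuous_on (sphere 0 1) (\<lambda>z. poisson r z * (H r z - C))"
          by (intro continuous_intros contK contH)
        show "continuous_on (sphere 0 1) (\<lambda>z. complex_of_real (\<epsilon> * P z + (4 * L) * (1 - r ^ 4)))"
          unfolding of_real_add of_real_mult by (intro continuous_intros contP)
        fix z :: complex assume z: "norm z = 1"
        have "norm (poisson r z * (H r z - C)) = P z * norm (H r z - C)"
          using P0 by (simp add: norm_mult P[OF z])
        also have "\<dots> \<le> P z * (\<epsilon> + L * norm (1 + z ^ 2) ^ 2)"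
          using pt[OF r z] P0 by (intro mult_left_mono)
        also have "\<dots> = \<epsilon> * P z + L * (P z * norm (1 + z ^ 2) ^ 2)" by (simp add: algebra_simps)
        also have "\<dots> \<le> \<epsilon> * P z + L * (4 * (1 - r ^ 4))"
          using poisson_bound[OF rr r(2) z] P[OF z] P0[of z] L by (intro add_left_mono mult_left_mono) auto
        finally show "norm (poisson r z * (H r z - C)) \<le> \<epsilon> * P z + (4 * L) * (1 - r ^ 4)"
          by (simp only: mult_ac)
      next
        have "circle_integral (\<lambda>z. complex_of_real (\<epsilon> * P z + (4 * L) * (1 - r ^ 4))) =
            circle_integral (\<lambda>z. of_real \<epsilon> * poisson r z + of_real ((4 * L) * (1 - r ^ 4)))"
          by (intro circle_integral_cong) (simp add: P)
        also have "\<dots> = of_real \<epsilon> * circle_integral (poisson r) + circle_integral (\<lambda>z. of_real ((4 * L) * (1 - r ^ 4)))"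
          unfolding circle_integral_cmult[symmetric] by (intro circle_integral_add continuous_intros contK)
        also have "\<dots> = 2 * of_real pi * \<i> * of_real (\<epsilon> + (4 * L) * (1 - r ^ 4))"
          unfolding circle_integral_poisson[OF rr r(2)] by (simp add: circle_integral_eq algebra_simps)
        finally show "circle_integral (\<lambda>z. complex_of_real (\<epsilon> * P z + (4 * L) * (1 - r ^ 4))) =
          2 * of_real pi * \<i> * of_real (\<epsilon> + (4 * L) * (1 - r ^ 4))" .
      qed
      finally show ?thesis .
    qed
    moreover have "eventually (\<lambda>r. r \<in> {max r0 (1 - \<delta> / 2)<..<1}) (at_left 1)"
      using r0 \<delta>(1) by (intro eventually_at_left_real) auto
    ultimately have "eventually (\<lambda>r. norm (?I r - 2 * of_real pi * \<i> * C) \<le> 2 * pi * (\<epsilon> + (4 * L) * (1 - r ^ 4))) (at_left 1)"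
      by (auto elim!: eventually_mono)
    then show ?thesis by blast
  qed
  show ?thesis
  proof (rule tendstoI)
    fix e :: real assume e: "e > 0"
    \<comment> \<open>With this choice the bound tends to \<open>e / 2\<close>.\<close>
    obtain L where L: "eventually (\<lambda>r. norm (?I r - 2 * of_real pi * \<i> * C) \<le> 2 * pi * (e / (4 * pi) + L * (1 - r ^ 4))) (at_left 1)"
      using bound[of "e / (4 * pi)"] e by auto
    have "((\<lambda>r. 2 * pi * (e / (4 * pi) + L * (1 - r ^ 4))) \<longlongrightarrow> 2 * pi * (e / (4 * pi) + L * (1 - 1 ^ 4))) (at_left 1)"
      by (intro tendsto_intros)
    then have "eventually (\<lambda>r. 2 * pi * (e / (4 * pi) + L * (1 - r ^ 4)) < e) (at_left 1)"
      by (rule order_tendstoD) (use e in simp)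
    with L show "eventually (\<lambda>r. dist (?I r) (2 * of_real pi * \<i> * C) < e) (at_left 1)"
      by eventually_elim (simp add: dist_norm)
  qed
qed

section \<open>The limit that determines the constant\<close>

text \<open>The gamma function with its simple pole at 1 divided out; the remaining denominator has
  no zeros on the closed unit disc.\<close>

definition egam_reg where
  "egam_reg q p x = qpoch2 q p (q * p / x) / (qpoch p (p * x) * qpoch2 q p (q * x))"

lemma egam_eq_reg:
  assumes "norm q < 1" "norm p < 1" shows "egam q p x = egam_reg q p x / (1 - x)"
  unfolding egam_def egam_reg_def qpoch2_rec[OF assms, of x] qpoch_rec[OF assms(2), of x] by simp

lemma continuous_on_egam_reg:
  assumes q: "norm q < 1" and p: "norm p < 1" and x: "continuous_on S x" "\<And>w. w \<in> S \<Longrightarrow> x w \<noteq> 0" "\<And>w. w \<in> S \<Longrightarrow> norm (x w) \<le> 1"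
  shows "continuous_on S (\<lambda>w. egam_reg q p (x w))"
proof -
  have "norm (c * x w) < 1" if "w \<in> S" "norm c < 1" for c w
  proof -
    have "norm c * norm (x w) \<le> norm c * 1" using x(3)[OF that(1)] by (intro mult_left_mono) auto
    then show ?thesis using that by (simp add: norm_mult)
  qed
  then have "qpoch p (p * x w) \<noteq> 0" "qpoch2 q p (q * x w) \<noteq> 0" if "w \<in> S" for w
    using qpoch_nonzero[OF p] qpoch2_nonzero[OF q p] that p q by auto
  then show ?thesis unfolding egam_reg_def
    by (intro continuous_on_divide continuous_on_mult continuous_on_qpoch continuous_on_qpoch2 continuous_on_const x(1))
       (use x q p in auto)
qed

text \<open>Multiplied by \<open>1 - r ^ 4\<close>, the integral becomes a Poisson integral and the
  expected value stays finite. Their limits are \<open>2 * pi * \<i> * 4 * g1 ^ 2 * Rest 1\<close>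
  and \<open>2 * g1 * Rest 1\<close>, and the quotient is \<open>4 * pi * \<i> * g1\<close>.\<close>

lemma beta5_ratio_limit:
  assumes q: "norm q < 1" and p: "norm p < 1"
    and u: "c \<in> unit_punctured" "d \<in> unit_punctured" "e \<in> unit_punctured"
    and A: "norm (p * q) < norm (c * d * e)"
  shows "((\<lambda>r. beta5_ratio q p (\<i> * of_real r) (- \<i> * of_real r) c d e) \<longlongrightarrow>
           4 * of_real pi * \<i> / (qpoch p p * qpoch q q)) (at_left 1)"
proof -
  \<comment> \<open>Keeps the parameters admissible up to and including r = 1, so that compactness
    of \<open>{r0..1}\<close> can be used.\<close>
  obtain r0 where r0: "0 < r0" "r0 < 1" "\<And>r. r0 \<le> r \<Longrightarrow> r \<le> 1 \<Longrightarrow> norm (p * q) < r ^ 2 * norm (c * d * e)"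
  proof -
    have "((\<lambda>r::real. r ^ 2 * norm (c * d * e)) \<longlongrightarrow> 1 ^ 2 * norm (c * d * e)) (at_left 1)"
      by (intro tendsto_intros)
    then have "eventually (\<lambda>r::real. norm (p * q) < r ^ 2 * norm (c * d * e)) (at_left 1)"
      by (rule order_tendstoD) (use A in simp)
    moreover have "eventually (\<lambda>r::real. r \<in> {0<..<1}) (at_left 1)" by (intro eventually_at_left_real) auto
    ultimately have "eventually (\<lambda>r::real. norm (p * q) < r ^ 2 * norm (c * d * e) \<and> r \<in> {0<..<1}) (at_left 1)"
      by eventually_elim simp
    then obtain r :: real where r: "norm (p * q) < r ^ 2 * norm (c * d * e)" "0 < r" "r < 1"
      using eventually_happens'[of "at_left (1::real)"] by (auto simp: trivial_limit_at_left_real)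
    have "norm (p * q) < r' ^ 2 * norm (c * d * e)" if "r \<le> r'" for r'
    proof -
      have "r ^ 2 * norm (c * d * e) \<le> r' ^ 2 * norm (c * d * e)"
        using r that by (intro mult_right_mono power_mono) auto
      then show ?thesis using r by linarith
    qed
    then show ?thesis using that[of r] r by blast
  qed
  have ru: "of_real r * x \<in> unit_punctured" "\<i> * of_real r * x \<in> unit_punctured" "- \<i> * of_real r * x \<in> unit_punctured" "of_real r ^ 2 * x \<in> unit_punctured"
    if "r0 \<le> r" "r \<le> 1" "x \<in> unit_punctured" for r x
  proof -
    have *: "s * norm x < 1" if "s \<le> 1" for s
    proof -
      have "s * norm x \<le> 1 * norm x" by (rule mult_right_mono[OF that]) simp
      moreover have "norm x < 1" using \<open>x \<in> unit_punctured\<close> by (simp add: unit_punctured_def)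
      ultimately show ?thesis by linarith
    qed
    have "r ^ 2 \<le> 1" using that r0 by (intro power_le_one) auto
    then show "of_real r * x \<in> unit_punctured" "\<i> * of_real r * x \<in> unit_punctured" "- \<i> * of_real r * x \<in> unit_punctured" "of_real r ^ 2 * x \<in> unit_punctured"
      using that r0 * by (auto simp: unit_punctured_def norm_mult norm_power)
  qed
  \<comment> \<open>What remains of the integrand after the singular factors have gone into the
    kernel; it extends continuously to r = 1.\<close>
  define H where "H = (\<lambda>r z. egam_reg q p (\<i> * of_real r * z) * egam_reg q p (\<i> * of_real r / z) *
      egam_reg q p (- \<i> * of_real r * z) * egam_reg q p (- \<i> * of_real r / z) *
      egam_pm q p c z * egam_pm q p d z * egam_pm q p e z * rec_egam_sq q p z /
      egam_pm q p (of_real r ^ 2 * (c * d * e)) z)"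
  \<comment> \<open>The factors of the expected value other than \<open>egam q p (a * b)\<close>,
    the only one that is singular at r = 1.\<close>
  define Rest where "Rest = (\<lambda>r. egam q p (\<i> * of_real r * c) * egam q p (\<i> * of_real r * d) * egam q p (\<i> * of_real r * e) *
      egam q p (- \<i> * of_real r * c) * egam q p (- \<i> * of_real r * d) * egam q p (- \<i> * of_real r * e) *
      egam q p (c * d) * egam q p (c * e) * egam q p (d * e) /
      (egam q p (- \<i> * of_real r * (c * d * e)) * egam q p (\<i> * of_real r * (c * d * e)) *
       egam q p (of_real r ^ 2 * (d * e)) * egam q p (of_real r ^ 2 * (c * e)) * egam q p (of_real r ^ 2 * (c * d))))"
  have den: "norm (p * q) < norm (of_real r ^ 2 * (c * d * e))" if "r0 \<le> r" "r \<le> 1" for r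
    using r0(3)[OF that] by (simp add: norm_mult norm_power)
  have contH: "continuous_on ({r0..1} \<times> sphere 0 1) (\<lambda>(r, z). H r z)"
  proof -
    let ?T = "{r0..1} \<times> sphere 0 1 :: (real \<times> complex) set"
    have T: "r0 \<le> fst y" "0 < fst y" "fst y \<le> 1" "norm (snd y) = 1" "snd y \<noteq> 0" if "y \<in> ?T" for y
      using that r0 by auto
    have snd: "continuous_on ?T snd" by (intro continuous_on_snd continuous_on_id)
    have reg: "continuous_on ?T (\<lambda>y. egam_reg q p (s * of_real (fst y) * snd y))"
      "continuous_on ?T (\<lambda>y. egam_reg q p (s * of_real (fst y) / snd y))" if s: "norm s = 1" for s
    proof -
      have cs: "continuous_on ?T (\<lambda>y. s * of_real (fst y) * snd y)" "continuous_on ?T (\<lambda>y. s * of_real (fst y) / snd y)"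
        using T(5) by (auto intro!: continuous_intros)
      have n: "s * of_real (fst y) * snd y \<noteq> 0" "s * of_real (fst y) / snd y \<noteq> 0"
        "norm (s * of_real (fst y) * snd y) \<le> 1" "norm (s * of_real (fst y) / snd y) \<le> 1" if "y \<in> ?T" for y
        using T[OF that] s by (auto simp: norm_mult norm_divide)
      show "continuous_on ?T (\<lambda>y. egam_reg q p (s * of_real (fst y) * snd y))"
        "continuous_on ?T (\<lambda>y. egam_reg q p (s * of_real (fst y) / snd y))"
        by (rule continuous_on_egam_reg[OF q p cs(1) n(1,3)] continuous_on_egam_reg[OF q p cs(2) n(2,4)]; assumption)+
    qed
    have pm: "continuous_on ?T (\<lambda>y. egam_pm q p (x y) (snd y))"
      if "continuous_on ?T x" "\<And>y. y \<in> ?T \<Longrightarrow> x y \<in> unit_punctured" for x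
      by (rule continuous_on_egam_pm[OF that(1) continuous_on_const continuous_on_const snd q p that(2) T(4)])
    have sq: "continuous_on ?T (\<lambda>y. rec_egam_sq q p (snd y))"
      by (rule continuous_on_rec_egam_sq[OF continuous_on_const continuous_on_const snd q p T(4)])
    have nz: "egam_pm q p (of_real (fst y) ^ 2 * (c * d * e)) (snd y) \<noteq> 0" if y: "y \<in> ?T" for y
      by (rule egam_pm_nonzero[OF q p ru(4) den T(4)[OF y]]) (use T[OF y] u in auto)
    show ?thesis
      unfolding H_def split_beta
      by (intro continuous_on_divide continuous_on_mult reg pm sq nz continuous_on_const u ru unit_punctured_mult)
         (use T nz in \<open>auto intro!: continuous_intros\<close>)
  qed
  have eg0: "egam q p x \<noteq> 0" if "x \<in> unit_punctured" "norm (p * q) < norm x" for x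
    using egam_nonzero_divisor[OF q p that(1), of 1] that by simp
  have den2: "egam q p (- \<i> * of_real r * (c * d * e)) * egam q p (\<i> * of_real r * (c * d * e)) *
       egam q p (of_real r ^ 2 * (d * e)) * egam q p (of_real r ^ 2 * (c * e)) * egam q p (of_real r ^ 2 * (c * d)) \<noteq> 0"
    if r: "r0 \<le> r" "r \<le> 1" for r
  proof -
    have s: "egam q p (s * (c * d * e)) \<noteq> 0" if "norm s = r" "s * (c * d * e) \<in> unit_punctured" for s
    proof (rule eg0[OF that(2)])
      have "r ^ 2 * norm (c * d * e) \<le> r * norm (c * d * e)"
        using r r0 by (intro mult_right_mono) (auto simp: power2_eq_square mult_left_le)
      then show "norm (p * q) < norm (s * (c * d * e))" using that r0(3)[OF r] by (simp add: norm_mult)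
    qed
    have "egam q p (of_real r ^ 2 * x) \<noteq> 0" if "x \<in> unit_punctured" "y \<in> unit_punctured" "x * y = c * d * e" for x y
      by (rule egam_nonzero_divisor[OF q p ru(4)[OF r that(1)], of y]) (use that den[OF r] unit_punctured_norm_le in \<open>auto simp: mult.assoc\<close>)
    from this[of "d * e" c] this[of "c * e" d] this[of "c * d" e]
    have "egam q p (of_real r ^ 2 * (d * e)) \<noteq> 0" "egam q p (of_real r ^ 2 * (c * e)) \<noteq> 0" "egam q p (of_real r ^ 2 * (c * d)) \<noteq> 0"
      using u by (auto simp: mult_ac)
    moreover have "egam q p (- \<i> * of_real r * (c * d * e)) \<noteq> 0" "egam q p (\<i> * of_real r * (c * d * e)) \<noteq> 0"
      by (rule s; use ru(2,3)[OF r, of "c * d * e"] u r0 r in \<open>simp add: norm_mult\<close>)+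
    ultimately show ?thesis by simp
  qed
  have contR: "continuous_on {r0..1} Rest"
  proof -
    have c: "continuous_on {r0..1} (\<lambda>r. s * complex_of_real r * x)" "continuous_on {r0..1} (\<lambda>r. of_real r ^ 2 * x)" for s x :: complex
      by (intro continuous_intros)+
    have e1: "continuous_on {r0..1} (\<lambda>r. egam q p (\<i> * of_real r * x))" "continuous_on {r0..1} (\<lambda>r. egam q p (- \<i> * of_real r * x))"
      "continuous_on {r0..1} (\<lambda>r. egam q p (of_real r ^ 2 * x))" if x: "x \<in> unit_punctured" for x
      by (rule continuous_on_egam_unit_punctured[OF c(1) continuous_on_const continuous_on_const q p ru(2)[OF _ _ x]]
            continuous_on_egam_unit_punctured[OF c(1) continuous_on_const continuous_on_const q p ru(3)[OF _ _ x]]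
            continuous_on_egam_unit_punctured[OF c(2) continuous_on_const continuous_on_const q p ru(4)[OF _ _ x]]; simp)+
    have "\<forall>r\<in>{r0..1}. egam q p (- \<i> * of_real r * (c * d * e)) * egam q p (\<i> * of_real r * (c * d * e)) *
       egam q p (of_real r ^ 2 * (d * e)) * egam q p (of_real r ^ 2 * (c * e)) * egam q p (of_real r ^ 2 * (c * d)) \<noteq> 0"
      using den2 by simp
    then show ?thesis
      unfolding Rest_def
      by (intro continuous_on_divide continuous_on_mult continuous_on_const e1 unit_punctured_mult u)
  qed
  have contE: "continuous_on {r0..1} (\<lambda>r. (1 + of_real r ^ 2) * egam_reg q p (of_real r ^ 2))"
    by (intro continuous_intros continuous_on_egam_reg q p) (use r0 in \<open>auto simp: norm_power intro: power_le_one\<close>)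
  define g1 where "g1 = egam_reg q p 1"
  have P1: "qpoch2 q p q = qpoch q q * qpoch2 q p (q * p)"
    using qpoch2_rec'[OF q p, of q] by (simp add: mult.commute)
  have nz: "qpoch p p \<noteq> 0" "qpoch q q \<noteq> 0" "qpoch2 q p (q * p) \<noteq> 0"
  proof -
    have "norm q * norm p < 1 * 1" using q p by (intro mult_strict_mono) auto
    then show "qpoch p p \<noteq> 0" "qpoch q q \<noteq> 0" "qpoch2 q p (q * p) \<noteq> 0"
      using qpoch_nonzero q p qpoch2_nonzero[OF q p, of "q * p"] by (auto simp: norm_mult)
  qed
  have g1: "g1 = 1 / (qpoch p p * qpoch q q)"
    using nz by (simp add: g1_def egam_reg_def P1)
  have H1: "H 1 s = 4 * g1 ^ 2 * Rest 1" if s: "s = \<i> \<or> s = - \<i>" for s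
  proof -
    \<comment> \<open>The factor 2 is \<open>1 - (-1)\<close>. It enters the weight at i twice,
      because the square of i and its inverse are both -1; this produces the 4.\<close>
    have "qpoch2 q p (-1) = 2 * qpoch p (- p) * qpoch2 q p (- q)"
      using qpoch2_rec[OF q p, of "-1"] qpoch_rec[OF p, of "-1"] by simp
    moreover have "qpoch p (- p) \<noteq> 0" "qpoch2 q p (- q) \<noteq> 0" "qpoch2 q p (- (q * p)) \<noteq> 0"
      using qpoch_nonzero[OF p, of "- p"] qpoch2_nonzero[OF q p, of "-q"] q p
        rec_egam_sq_denominator_nonzero[OF q p, of \<i>] by auto
    ultimately have four: "egam_reg q p (-1) ^ 2 * rec_egam_sq q p \<i> = 4"
      by (simp add: egam_reg_def rec_egam_sq_def power2_eq_square)
    have s4: "rec_egam_sq q p s = rec_egam_sq q p \<i>" using s by (auto simp: rec_egam_sq_def)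
    have reg: "egam_reg q p (\<i> * of_real 1 * s) * egam_reg q p (\<i> * of_real 1 / s) *
      egam_reg q p (- \<i> * of_real 1 * s) * egam_reg q p (- \<i> * of_real 1 / s) = g1 ^ 2 * egam_reg q p (-1) ^ 2"
      using s by (auto simp: g1_def power2_eq_square)
    have pm: "egam_pm q p x s = egam q p (\<i> * x) * egam q p (- \<i> * x)" for x
      using s by (auto simp: egam_pm_def mult_ac)
    have cc: "egam q p (d * e) \<noteq> 0" "egam q p (c * e) \<noteq> 0" "egam q p (c * d) \<noteq> 0"
      using den2[of 1] r0 by auto
    have "H 1 s = g1 ^ 2 * (egam_reg q p (-1) ^ 2 * rec_egam_sq q p \<i>) *
        (egam_pm q p c s * egam_pm q p d s * egam_pm q p e s / egam_pm q p (c * d * e) s)"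
      unfolding H_def reg s4 by (simp add: mult_ac)
    also have "\<dots> = 4 * g1 ^ 2 * Rest 1"
      unfolding four pm Rest_def using cc by (simp add: mult_ac)
    finally show ?thesis .
  qed
  have lim1: "((\<lambda>r. circle_integral (\<lambda>z. poisson r z * H r z)) \<longlongrightarrow> 2 * of_real pi * \<i> * (4 * g1 ^ 2 * Rest 1)) (at_left 1)"
    by (rule poisson_concentration[OF _ r0(2) contH]) (use r0 H1 in auto)
  have lim2: "((\<lambda>r. (1 + of_real r ^ 2) * egam_reg q p (of_real r ^ 2) * Rest r) \<longlongrightarrow> 2 * g1 * Rest 1) (at_left 1)"
    using continuous_on_Icc_at_leftD[OF continuous_on_mult[OF contE contR] r0(2)] by (simp add: g1_def)
  have Rest1: "Rest 1 \<noteq> 0"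
  proof -
    have *: "egam q p (s * x) \<noteq> 0" if "x \<in> unit_punctured" "y \<in> unit_punctured" "x * y = c * d * e" "norm s = 1" for s x y
    proof (rule egam_nonzero_divisor[OF q p, of _ y])
      show "s * x \<in> unit_punctured" using unit_punctured_circle[OF that(1,4)] by (simp add: mult.commute)
      show "norm (p * q) < norm (s * x * y)" using A that by (simp add: mult.assoc norm_mult[of s])
    qed (use that unit_punctured_norm_le in auto)
    have "egam q p (s * c) \<noteq> 0" "egam q p (s * d) \<noteq> 0" "egam q p (s * e) \<noteq> 0"
       "egam q p (s * (c * d)) \<noteq> 0" "egam q p (s * (c * e)) \<noteq> 0" "egam q p (s * (d * e)) \<noteq> 0" if "norm s = 1" for s
      by (rule *[OF _ _ _ that, of _ "d * e"] *[OF _ _ _ that, of _ "c * e"] *[OF _ _ _ that, of _ "c * d"]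
         *[OF _ _ _ that, of _ e] *[OF _ _ _ that, of _ d] *[OF _ _ _ that, of _ c]; use u in \<open>simp add: mult_ac\<close>)+
    from this[of \<i>] this[of "-\<i>"] this[of 1] show ?thesis
      unfolding Rest_def using den2[of 1] r0 by simp
  qed
  have "((\<lambda>r. circle_integral (\<lambda>z. poisson r z * H r z) / ((1 + of_real r ^ 2) * egam_reg q p (of_real r ^ 2) * Rest r)) \<longlongrightarrow>
      2 * of_real pi * \<i> * (4 * g1 ^ 2 * Rest 1) / (2 * g1 * Rest 1)) (at_left 1)"
    by (intro tendsto_divide lim1 lim2) (use Rest1 g1 nz in auto)
  moreover have "2 * of_real pi * \<i> * (4 * g1 ^ 2 * Rest 1) / (2 * g1 * Rest 1) = 4 * of_real pi * \<i> / (qpoch p p * qpoch q q)"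
    using Rest1 nz by (simp add: g1 power2_eq_square)
  moreover have "eventually (\<lambda>r. circle_integral (\<lambda>z. poisson r z * H r z) / ((1 + of_real r ^ 2) * egam_reg q p (of_real r ^ 2) * Rest r) =
      beta5_ratio q p (\<i> * of_real r) (- \<i> * of_real r) c d e) (at_left 1)"
  proof -
    have "eventually (\<lambda>r. r \<in> {r0<..<1}) (at_left 1)" using r0 by (intro eventually_at_left_real) auto
    then show ?thesis
    proof eventually_elim
      case (elim r)
      then have r: "r0 \<le> r" "r < 1" "0 < r" using r0 by auto
      define x where "x = complex_of_real r"
      have "r ^ 4 < 1" using r by (simp add: power_less_one_iff)
      then have x4: "1 - x ^ 4 \<noteq> 0" unfolding x_def
        by (metis eq_iff_diff_eq_0 of_real_eq_1_iff of_real_power order_less_irrefl)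
      \<comment> \<open>One part of this factor cancels the pole of \<open>egam q p (x ^ 2)\<close>,
        while the whole of it normalizes the Poisson kernel.\<close>
      have fac: "1 - x ^ 4 = (1 - x ^ 2) * (1 + x ^ 2)" by (simp add: algebra_simps power_add[symmetric])
      have ab: "\<i> * x * (- \<i> * x) = x ^ 2" by (simp add: power2_eq_square mult_ac)
      have prod: "\<i> * x * (- \<i> * x) * c * d * e = x ^ 2 * (c * d * e)" unfolding ab by (simp add: mult_ac)
      have int: "circle_integral (\<lambda>z. poisson r z * H r z) = (1 - x ^ 4) * circle_integral (beta5_integrand q p (\<i> * x) (- \<i> * x) c d e)"
        unfolding circle_integral_cmult[symmetric]
      proof (rule circle_integral_cong)
        fix z :: complex assume z: "norm z = 1"
        then have z0: "z \<noteq> 0" by auto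
        have "(1 - \<i> * x * z) * (1 - (- \<i> * x * z)) = 1 + x ^ 2 * z ^ 2"
          "(1 - \<i> * x / z) * (1 - (- \<i> * x / z)) = 1 + x ^ 2 / z ^ 2"
          using z0 by (simp_all add: algebra_simps power2_eq_square)
        then have d: "(1 + x ^ 2 * z ^ 2) * (1 + x ^ 2 / z ^ 2) = (1 - \<i> * x * z) * (1 - (- \<i> * x * z)) * ((1 - \<i> * x / z) * (1 - (- \<i> * x / z)))"
          by simp
        show "poisson r z * H r z = (1 - x ^ 4) * beta5_integrand q p (\<i> * x) (- \<i> * x) c d e z"
          unfolding poisson_def H_def beta5_integrand_def prod x_def[symmetric] d
            egam_pm_def[of q p "\<i> * x"] egam_pm_def[of q p "- \<i> * x"]
            egam_eq_reg[OF q p, of "\<i> * x * z"] egam_eq_reg[OF q p, of "\<i> * x / z"]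
            egam_eq_reg[OF q p, of "- \<i> * x * z"] egam_eq_reg[OF q p, of "- \<i> * x / z"]
          by (simp add: mult_ac)
      qed
      have rhs: "(1 + x ^ 2) * egam_reg q p (x ^ 2) * Rest r = (1 - x ^ 4) * beta5_rhs q p (\<i> * x) (- \<i> * x) c d e"
      proof -
        have "(1 - x ^ 4) * egam q p (x ^ 2) = (1 + x ^ 2) * egam_reg q p (x ^ 2)"
          unfolding egam_eq_reg[OF q p, of "x ^ 2"] fac using x4 fac by auto
        then have 1: "(1 + x ^ 2) * egam_reg q p (x ^ 2) * Rest r = (1 - x ^ 4) * (egam q p (x ^ 2) * Rest r)"
          by (simp only: mult.assoc[symmetric])
        have "beta5_rhs q p (\<i> * x) (- \<i> * x) c d e = egam q p (x ^ 2) * Rest r"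
          unfolding beta5_rhs_def Rest_def ab x_def[symmetric] mult.assoc[of _ c] mult.assoc[of _ d] by (simp add: mult_ac)
        then show ?thesis unfolding 1 by simp
      qed
      show ?case unfolding beta5_ratio_def x_def[symmetric] int rhs using x4 by simp
    qed
  qed
  ultimately show ?thesis by (simp add: tendsto_cong)
qed


section \<open>Evaluation of the integral and analytic continuation\<close>

text \<open>Only the first parameter can be moved freely, so \<open>a\<close> is moved to ir, the
  first two parameters are exchanged, and \<open>b\<close> is moved to -ir. The quotient is thus
  equal to its values along the limiting family for all r near 1.\<close>

lemma elliptic_beta_integral_restricted:
  assumes q: "norm q < 1" "q \<noteq> 0" and p: "norm p < 1" "p \<noteq> 0"
    and u: "a \<in> unit_punctured" "b \<in> unit_punctured" "c \<in> unit_punctured" "d \<in> unit_punctured" "e \<in> unit_punctured"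
    and h: "h ^ 2 = q" "d / h \<in> unit_punctured" "e / h \<in> unit_punctured"
    and small: "norm p < norm (a * b * c * d * e)"
  shows "beta5_ratio q p a b c d e = 4 * of_real pi * \<i> / (qpoch p p * qpoch q q)"
proof -
  define B where "B = norm (b * c * d * e)"
  have pq: "norm (p * q) \<le> norm p" using q by (simp add: norm_mult mult_left_le)
  have aB: "norm (a * (b * c * d * e)) = norm a * B" by (simp add: B_def norm_mult mult_ac)
  have a1: "norm a < 1" "norm b \<le> 1" using u by (auto simp: unit_punctured_def)
  have "norm a * B \<le> 1 * B" using a1 by (intro mult_right_mono) (auto simp: B_def)
  moreover have pa: "norm p < norm a * B" using small aB by (simp add: mult.assoc)
  ultimately have pB: "norm p < B" by linarith
  have bcde: "norm (b * (x * c * d * e)) = norm x * B" for x by (simp add: B_def norm_mult mult_ac)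
  have "norm b * norm (c * d * e) \<le> 1 * norm (c * d * e)" using a1 by (intro mult_right_mono) auto
  then have B: "0 \<le> B" "B \<le> norm (c * d * e)" by (auto simp: B_def norm_mult mult_ac)
  \<comment> \<open>For r near 1 this keeps \<open>norm p\<close> below every product met while
    \<open>a\<close> and \<open>b\<close> are replaced.\<close>
  have "((\<lambda>r::real. r ^ 2 * B) \<longlongrightarrow> 1 ^ 2 * B) (at_left 1)" by (intro tendsto_intros)
  then have "eventually (\<lambda>r. norm p < r ^ 2 * B) (at_left 1)"
    by (rule order_tendstoD) (use pB in simp)
  moreover have "eventually (\<lambda>r::real. r \<in> {0<..<1}) (at_left 1)" by (intro eventually_at_left_real) auto
  ultimately have ev: "eventually (\<lambda>r. beta5_ratio q p (\<i> * of_real r) (- \<i> * of_real r) c d e = beta5_ratio q p a b c d e) (at_left 1)"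
  proof eventually_elim
    case (elim r)
    define x where "x = \<i> * complex_of_real r"
    have x: "norm x = r" "norm (- x) = r" "x \<in> unit_punctured" using elim by (auto simp: x_def norm_mult unit_punctured_def)
    have r: "r < 1" "0 < r" and K: "norm p < r ^ 2 * B" using elim by auto
    have "r ^ 2 * B \<le> r * B" using r B by (intro mult_right_mono) (auto simp: power2_eq_square mult_left_le)
    then have K1: "norm p < r * B" using K by linarith
    have xB: "norm (x * (b * c * d * e)) = r * B" using x by (simp add: B_def norm_mult mult_ac)
    have xc: "norm (x * c * d * e) = r * norm (c * d * e)" using x by (simp add: norm_mult mult_ac)
    have "r * B \<le> r * norm (c * d * e)" using r B by (intro mult_left_mono) auto
    then have K2: "norm p < norm (x * c * d * e)" using K1 xc by linarith
    have "norm (- x * (x * c * d * e)) = r ^ 2 * norm (c * d * e)"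
      using x xc by (simp add: norm_mult power2_eq_square)
    moreover have "r ^ 2 * B \<le> r ^ 2 * norm (c * d * e)" using B by (intro mult_left_mono) auto
    ultimately have K3: "norm p < norm (- x * (x * c * d * e))" using K by linarith
    have "beta5_ratio q p a b c d e = beta5_ratio q p x b c d e"
      by (rule beta5_ratio_constant[OF q p u(2-5) h])
         (use pB pa aB a1 x xB K1 pq r in \<open>auto simp: B_def\<close>)
    also have "\<dots> = beta5_ratio q p b x c d e" by (rule beta5_ratio_swap)
    also have "\<dots> = beta5_ratio q p (- x) x c d e"
    proof (rule beta5_ratio_constant[OF q p x(3) u(3-5) h])
      show "norm p < norm (x * c * d * e)" by (rule K2)
      show "norm (p * q) < norm (b * (x * c * d * e))" unfolding bcde x(1) using K1 pq by linarith
      show "norm (p * q) < norm (- x * (x * c * d * e))" using K3 pq by linarith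
      show "norm b < 1" "norm (- x) < 1" using u x r by (auto simp: unit_punctured_def)
    qed
    also have "\<dots> = beta5_ratio q p x (- x) c d e" by (rule beta5_ratio_swap)
    finally show ?case by (simp add: x_def)
  qed
  have "norm (p * q) < norm (c * d * e)" using pq pB B by linarith
  from beta5_ratio_limit[OF q(1) p(1) u(3-5) this]
  have "((\<lambda>r::real. beta5_ratio q p a b c d e) \<longlongrightarrow> 4 * of_real pi * \<i> / (qpoch p p * qpoch q q)) (at_left 1)"
    by (rule Lim_transform_eventually) (use ev in simp)
  then show ?thesis by (simp add: tendsto_const_iff trivial_limit_at_left_real)
qed

text \<open>Scaling \<open>d, e, p\<close> by \<open>w, w, w\<^sup>3\<close> connects the given parameters to the range of the
  restricted lemma, where \<open>d\<close>, \<open>e\<close> and \<open>p\<close> are small.\<close>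
lemma elliptic_beta_integral_nonzero_bases:
  assumes dom: "beta5_domain q p a b c d e" and nz: "q \<noteq> 0" "p \<noteq> 0"
  shows "beta5_ratio q p a b c d e * (qpoch p p * qpoch q q) = 4 * of_real pi * \<i>"
proof -
  have q: "norm q < 1" and p: "norm p < 1"
    and u: "a \<in> unit_punctured" "b \<in> unit_punctured" "c \<in> unit_punctured" "d \<in> unit_punctured" "e \<in> unit_punctured"
    and A: "norm (p * q) < norm (a * b * c * d * e)"
    using dom by (auto simp: beta5_domain_def)
  define A where "A = norm (a * b * c * d * e)"
  define h where "h = csqrt q"
  have h: "h ^ 2 = q" "h \<noteq> 0" using nz by (auto simp: h_def)
  have d1: "norm d < 1" "norm e < 1" "d \<noteq> 0" "e \<noteq> 0" using u by (auto simp: unit_punctured_def)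
  \<comment> \<open>Because \<open>R > 1\<close>, the target point w = 1 lies in the open domain
    \<open>U\<close> of continuation.\<close>
  obtain R where R: "1 < R" "R * norm d < 1" "R * norm e < 1" "R ^ 3 * norm p < 1" "R * norm (p * q) < A"
  proof -
    have "((\<lambda>R::real. R * norm d) \<longlongrightarrow> 1 * norm d) (at_right 1)" "((\<lambda>R::real. R * norm e) \<longlongrightarrow> 1 * norm e) (at_right 1)"
      "((\<lambda>R::real. R ^ 3 * norm p) \<longlongrightarrow> 1 ^ 3 * norm p) (at_right 1)" "((\<lambda>R::real. R * norm (p * q)) \<longlongrightarrow> 1 * norm (p * q)) (at_right 1)"
      by (intro tendsto_intros)+
    then have "eventually (\<lambda>R. R * norm d < 1) (at_right 1)" "eventually (\<lambda>R. R * norm e < 1) (at_right 1)"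
      "eventually (\<lambda>R. R ^ 3 * norm p < 1) (at_right 1)" "eventually (\<lambda>R. R * norm (p * q) < A) (at_right 1)"
      using d1 p A unfolding A_def by (auto elim!: order_tendstoD)
    moreover have "eventually (\<lambda>R::real. R \<in> {1<..<2}) (at_right 1)" by (intro eventually_at_right_real) auto
    ultimately have "eventually (\<lambda>R. 1 < R \<and> R * norm d < 1 \<and> R * norm e < 1 \<and> R ^ 3 * norm p < 1 \<and> R * norm (p * q) < A) (at_right 1)"
      by eventually_elim simp
    then show ?thesis
      using that eventually_happens'[of "at_right (1::real)"] by (auto simp: trivial_limit_at_right_real)
  qed
  define U where "U = {w::complex. 0 < norm w \<and> norm w < R}"
  \<comment> \<open>Below \<open>norm h\<close> the parameters \<open>w * d / h\<close> and
    \<open>w * e / h\<close> lie in the unit disc. Below \<open>A\<close> the base is small enough: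
    it scales like the cube of w, but the product of the parameters only like the square.\<close>
  define \<delta> where "\<delta> = min (norm h) A"
  define V where "V = {w::complex. 0 < norm w \<and> norm w < \<delta>}"
  have A0: "A > 0" using A norm_ge_zero[of "p * q"] unfolding A_def by linarith
  have "norm h < 1" using q h(1) by (metis norm_ge_zero norm_power one_le_power linorder_not_le)
  then have \<delta>: "0 < \<delta>" "\<delta> < 1" using h A0 by (auto simp: \<delta>_def)
  have domw: "beta5_domain q (w ^ 3 * p) a b c (w * d) (w * e)" if w: "0 < norm w" "norm w < R" for w
  proof -
    have "norm w * norm d \<le> R * norm d" "norm w * norm e \<le> R * norm e" "norm w ^ 3 * norm p \<le> R ^ 3 * norm p"
      "norm w * norm (p * q) \<le> R * norm (p * q)"
      using w by (intro mult_right_mono power_mono; simp)+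
    then have le: "norm w * norm d < 1" "norm w * norm e < 1" "norm w ^ 3 * norm p < 1" "norm w * norm (p * q) < A"
      using R by linarith+
    have "norm (w ^ 3 * p * q) = norm w ^ 2 * (norm w * norm (p * q))"
      by (simp add: norm_mult norm_power power3_eq_cube power2_eq_square)
    also have "\<dots> < norm w ^ 2 * A" using le w by (intro mult_strict_left_mono) auto
    also have "\<dots> = norm (a * b * c * (w * d) * (w * e))" by (simp add: A_def norm_mult power2_eq_square)
    finally show ?thesis using le q u w d1 by (auto simp: beta5_domain_def unit_punctured_def norm_mult norm_power)
  qed
  have "beta5_ratio q (1 ^ 3 * p) a b c (1 * d) (1 * e) * (qpoch (1 ^ 3 * p) (1 ^ 3 * p) * qpoch q q) = 4 * of_real pi * \<i>"
  proof (rule analytic_continuation_open[where s = V and s' = U and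
        f = "\<lambda>w. beta5_ratio q (w ^ 3 * p) a b c (w * d) (w * e) * (qpoch (w ^ 3 * p) (w ^ 3 * p) * qpoch q q)" and g = "\<lambda>w. 4 * of_real pi * \<i>"])
    show "open V" "open U" unfolding U_def V_def
      by (intro open_Collect_conj open_Collect_less continuous_intros)+
    show "connected U" using connected_annulus(1)[of 0 "0::complex" R] by (simp add: U_def)
    have "of_real (\<delta> / 2) \<in> V" using \<delta> by (simp add: V_def)
    then show "V \<noteq> {}" by blast
    show "V \<subseteq> U" using \<delta> R by (auto simp: U_def V_def)
    have pw: "norm (w ^ 3 * p) < 1" if "w \<in> U" for w
      using domw[of w] that by (auto simp: U_def beta5_domain_def)
    show "(\<lambda>w. beta5_ratio q (w ^ 3 * p) a b c (w * d) (w * e) * (qpoch (w ^ 3 * p) (w ^ 3 * p) * qpoch q q)) holomorphic_on U"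
      by (intro holomorphic_on_mult holomorphic_on_beta5_ratio holomorphic_on_qpoch holomorphic_intros \<open>open U\<close> pw)
         (use domw in \<open>auto simp: U_def\<close>)
    fix w assume w: "w \<in> V"
    then have wU: "0 < norm w" "norm w < R" "w \<noteq> 0" and wh: "norm w < norm h" "norm w < A" "norm w < 1"
      using \<delta> R by (auto simp: V_def \<delta>_def)
    have D: "beta5_domain q (w ^ 3 * p) a b c (w * d) (w * e)" using domw wU by blast
    then have uw: "a \<in> unit_punctured" "b \<in> unit_punctured" "c \<in> unit_punctured" "w * d \<in> unit_punctured" "w * e \<in> unit_punctured"
      and pw: "norm (w ^ 3 * p) < 1"
      by (auto simp: beta5_domain_def)
    have hu: "w * x / h \<in> unit_punctured" if "norm x < 1" "x \<noteq> 0" for x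
    proof -
      have "norm w * norm x < norm h * 1" using wh that wU by (intro mult_strict_mono) auto
      then show ?thesis using h wU that by (simp add: unit_punctured_def norm_mult norm_divide)
    qed
    have "norm (w ^ 3 * p) = norm w ^ 2 * (norm w * norm p)"
      by (simp add: norm_mult norm_power power3_eq_cube power2_eq_square)
    also have "\<dots> < norm w ^ 2 * A"
    proof -
      have "norm w * norm p \<le> norm w * 1" using p by (intro mult_left_mono) auto
      then have "norm w * norm p < A" using wh by linarith
      then show ?thesis using wU by (intro mult_strict_left_mono) auto
    qed
    also have "\<dots> = norm (a * b * c * (w * d) * (w * e))" by (simp add: A_def norm_mult power2_eq_square)
    finally have sm: "norm (w ^ 3 * p) < norm (a * b * c * (w * d) * (w * e))" .
    have "beta5_ratio q (w ^ 3 * p) a b c (w * d) (w * e) = 4 * of_real pi * \<i> / (qpoch (w ^ 3 * p) (w ^ 3 * p) * qpoch q q)"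
      by (rule elliptic_beta_integral_restricted[OF q nz(1) pw _ uw h(1) hu hu sm]) (use d1 wU nz in auto)
    then show "beta5_ratio q (w ^ 3 * p) a b c (w * d) (w * e) * (qpoch (w ^ 3 * p) (w ^ 3 * p) * qpoch q q) = 4 * of_real pi * \<i>"
      using qpoch_nonzero[OF q q] qpoch_nonzero[OF pw pw] by simp
  qed (use R in \<open>auto simp: U_def\<close>)
  then show ?thesis by simp
qed

text \<open>For zero bases the sixth parameter is lost, so they are reached by continuity. Adding
  the same small nonzero w to both bases makes both of them nonzero.\<close>

theorem elliptic_beta_integral:
  assumes dom: "beta5_domain q p a b c d e"
  shows "beta5_ratio q p a b c d e * (qpoch p p * qpoch q q) = 4 * of_real pi * \<i>"
proof -
  define U where "U = {w::complex. norm (q + w) < 1 \<and> norm (p + w) < 1 \<and> norm ((p + w) * (q + w)) < norm (a * b * c * d * e)}"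
  have U: "open U" unfolding U_def
    by (intro open_Collect_conj open_Collect_less continuous_intros)
  have domw: "beta5_domain (q + w) (p + w) a b c d e" if "w \<in> U" for w
    using that dom by (auto simp: beta5_domain_def U_def)
  have "(\<lambda>w. beta5_ratio (q + w) (p + w) a b c d e * (qpoch (p + w) (p + w) * qpoch (q + w) (q + w))) holomorphic_on U"
    by (intro holomorphic_on_mult holomorphic_on_beta5_ratio holomorphic_on_qpoch holomorphic_intros U)
       (use domw in \<open>auto simp: U_def\<close>)
  then have cont: "continuous_on U (\<lambda>w. beta5_ratio (q + w) (p + w) a b c d e * (qpoch (p + w) (p + w) * qpoch (q + w) (q + w)))"
    by (rule holomorphic_on_imp_continuous_on)
  have "beta5_ratio (q + 0) (p + 0) a b c d e * (qpoch (p + 0) (p + 0) * qpoch (q + 0) (q + 0)) = 4 * of_real pi * \<i>"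
  proof (rule eq_by_continuity[OF cont continuous_on_const U, where h = "\<lambda>w. (q + w) * (p + w)"])
    show "0 \<in> U" using dom by (auto simp: U_def beta5_domain_def)
    have "((\<lambda>w. x + w) has_field_derivative 1) (at 0)" for x :: complex
      by (auto intro!: derivative_eq_intros)
    then have "eventually (\<lambda>w. x + w \<noteq> 0) (at 0)" for x :: complex
      by (rule DERIV_nonzero_eventually_nonzero) simp
    from this[of q] this[of p] show "eventually (\<lambda>w. (q + w) * (p + w) \<noteq> 0) (at 0)"
      by eventually_elim simp
    show "beta5_ratio (q + w) (p + w) a b c d e * (qpoch (p + w) (p + w) * qpoch (q + w) (q + w)) = 4 * of_real pi * \<i>"
      if "w \<in> U" "(q + w) * (p + w) \<noteq> 0" for w
      by (rule elliptic_beta_integral_nonzero_bases[OF domw]) (use that in auto)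
  qed
  then show ?thesis by simp
qed

section \<open>The Bailey lemma\<close>

lemma unit_circle_integrable_iff:
  "unit_circle_integrable (\<lambda>z. g z / z) \<longleftrightarrow> (\<lambda>x. g (unit_exp x)) absolutely_integrable_on {0..1}"
proof -
  have vd: "vector_derivative (circlepath 0 1) (at x within {0..1}) = 2 * of_real pi * \<i> * unit_exp x"
    if "x \<in> {0..1}" for x
    by (rule vector_derivative_within_cbox[of 0 1, unfolded box_real])
       (use that has_vector_derivative_circlepath_unit in auto)
  have "unit_circle_integrable (\<lambda>z. g z / z) \<longleftrightarrow>
      (\<lambda>x. 2 * of_real pi * \<i> * g (unit_exp x)) absolutely_integrable_on {0..1}"
    unfolding unit_circle_integrable_def
    by (rule absolutely_integrable_spike_eq[of "{}"]) (auto simp: vd circlepath_unit)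
  also have "\<dots> \<longleftrightarrow> (\<lambda>x. g (unit_exp x)) absolutely_integrable_on {0..1}"
    by (subst set_integrable_mult_right_iff) auto
  finally show ?thesis .
qed

lemma absolutely_integrable_continuous_mult:
  fixes k f :: "real \<Rightarrow> complex"
  assumes "continuous_on {a..b} k" "f absolutely_integrable_on {a..b}"
  shows "(\<lambda>x. k x * f x) absolutely_integrable_on {a..b}"
proof -
  have "bilinear (\<lambda>x y :: complex. x * y)"
    by (simp add: bilinear_conv_bounded_bilinear bounded_bilinear_mult)
  moreover have "k \<in> borel_measurable (lebesgue_on {a..b})"
    by (rule continuous_imp_measurable_on_sets_lebesgue[OF assms(1)]) simp
  moreover have "bounded (k ` {a..b})"
    using assms(1) compact_continuous_image compact_imp_bounded by blast
  ultimately show ?thesis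
    using absolutely_integrable_bounded_measurable_product[of "\<lambda>x y. x * y" k "{a..b}" f] assms(2) by simp
qed

text \<open>The kernel is bounded and the circle has finite measure, so integrability of
  \<open>a\<close> alone dominates the double integral. The first conclusion is what yields
  integrability of the new \<open>\<alpha>\<close>.\<close>

lemma circle_fubini:
  fixes k :: "complex \<Rightarrow> complex \<Rightarrow> complex"
  assumes k: "continuous_on (sphere 0 1 \<times> sphere 0 1) (\<lambda>(z, x). k z x)"
    and a: "(\<lambda>x. a (unit_exp x)) absolutely_integrable_on {0..1}"
  shows "(\<lambda>y. circle_integral (\<lambda>x. k (unit_exp y) x * a x)) absolutely_integrable_on {0..1}"
    and "circle_integral (\<lambda>z. circle_integral (\<lambda>x. k z x * a x)) =
         circle_integral (\<lambda>x. circle_integral (\<lambda>z. k z x) * a x)"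
proof -
  define M where "M = lebesgue_on {0..1::real}"
  interpret fin: finite_measure M unfolding M_def by (rule finite_measure_lebesgue_on) simp
  interpret pair_sigma_finite M M ..
  define g where "g = (\<lambda>y x. k (unit_exp y) (unit_exp x) * a (unit_exp x))"
  have S: "{0..1::real} \<in> sets lebesgue" by simp
  have ai: "integrable M (\<lambda>x. a (unit_exp x))"
    unfolding M_def by (rule absolutely_integrable_imp_integrable[OF a S])
  have contk: "continuous_on UNIV (\<lambda>y. k (unit_exp (fst y)) (unit_exp (snd y)))"
  proof -
    have "continuous_on UNIV (\<lambda>y. (\<lambda>(z, x). k z x) (unit_exp (fst y), unit_exp (snd y)))"
      by (rule continuous_on_compose2[OF k]) (auto intro!: continuous_intros)
    then show ?thesis by simp
  qed
  have kz: "continuous_on {0..1} (\<lambda>x. k (unit_exp y) (unit_exp x))" "continuous_on {0..1} (\<lambda>y. k (unit_exp y) (unit_exp x))" for x y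
  proof -
    have "continuous_on {0..1} (\<lambda>x. (\<lambda>y. k (unit_exp (fst y)) (unit_exp (snd y))) (y, x))"
      "continuous_on {0..1} (\<lambda>y. (\<lambda>y. k (unit_exp (fst y)) (unit_exp (snd y))) (y, x))"
      by (rule continuous_on_compose2[OF contk]; auto intro!: continuous_intros)+
    then show "continuous_on {0..1} (\<lambda>x. k (unit_exp y) (unit_exp x))" "continuous_on {0..1} (\<lambda>y. k (unit_exp y) (unit_exp x))"
      by simp_all
  qed
  obtain C where C: "0 \<le> C" "\<And>y. y \<in> sphere 0 1 \<times> sphere 0 1 \<Longrightarrow> norm ((\<lambda>(z, x). k z x) y) \<le> C"
    using compact_norm_bound[OF _ k] by (metis compact_Times compact_sphere)
  have kC: "norm (k (unit_exp y) (unit_exp x)) \<le> C" for x y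
    using C(2)[of "(unit_exp y, unit_exp x)"] by simp
  \<comment> \<open>\<open>M\<close> carries the Lebesgue sets, whereas continuity yields Borel
    measurability on the plane; the identity map into the Borel sets, applied in each coordinate,
    connects the two.\<close>
  have id: "(\<lambda>x. x) \<in> borel_measurable M" unfolding M_def
    by (rule continuous_imp_measurable_on_sets_lebesgue) (auto intro!: continuous_intros)
  have km: "(\<lambda>y. k (unit_exp (fst y)) (unit_exp (snd y))) \<in> borel_measurable (M \<Otimes>\<^sub>M M)"
  proof -
    have 1: "(\<lambda>y. k (unit_exp (fst y)) (unit_exp (snd y))) \<in> borel_measurable borel"
      by (rule borel_measurable_continuous_onI[OF contk])
    have 2: "(\<lambda>y. (fst y, snd y)) \<in> (M \<Otimes>\<^sub>M M) \<rightarrow>\<^sub>M (borel :: (real \<times> real) measure)"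
      unfolding borel_prod[symmetric]
      by (intro measurable_Pair measurable_compose[OF measurable_fst id] measurable_compose[OF measurable_snd id])
    from measurable_compose[OF 2 1] show ?thesis by simp
  qed
  have gm: "case_prod g \<in> borel_measurable (M \<Otimes>\<^sub>M M)"
    unfolding g_def split_beta
    by (intro borel_measurable_times km measurable_compose[OF measurable_snd borel_measurable_integrable[OF ai]])
  have gi: "integrable M (g y)" for y
    unfolding g_def M_def
    by (rule absolutely_integrable_imp_integrable[OF absolutely_integrable_continuous_mult[OF kz(1) a] S])
  have int: "integrable (M \<Otimes>\<^sub>M M) (case_prod g)"
  proof (rule Fubini_integrable[OF gm])
    have "norm (\<integral>x. norm (g y x) \<partial>M) \<le> (\<integral>x. C * norm (a (unit_exp x)) \<partial>M)" for y
    proof -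
      have "(\<integral>x. norm (g y x) \<partial>M) \<le> (\<integral>x. C * norm (a (unit_exp x)) \<partial>M)"
        using kC by (intro integral_mono integrable_norm gi integrable_mult_right ai)
          (auto simp: g_def norm_mult intro!: mult_right_mono)
      moreover have "(\<integral>x. norm (g y x) \<partial>M) \<ge> 0" by simp
      ultimately show ?thesis by simp
    qed
    moreover have "(\<lambda>y. \<integral>x. norm (case_prod g (y, x)) \<partial>M) \<in> borel_measurable M"
      using gm by measurable
    ultimately show "integrable M (\<lambda>y. \<integral>x. norm (case_prod g (y, x)) \<partial>M)"
      by (intro fin.integrable_const_bound[where B = "\<integral>x. C * norm (a (unit_exp x)) \<partial>M"]) auto
    show "AE y in M. integrable M (\<lambda>x. case_prod g (y, x))" using gi by simp
  qed
  have c1: "circle_integral (\<lambda>x. k (unit_exp y) x * a x) = 2 * of_real pi * \<i> * (\<integral>x. g y x \<partial>M)" for y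
    using lebesgue_integral_eq_integral[OF gi[of y, unfolded M_def] S]
    by (simp add: circle_integral_eq M_def g_def)
  have int1: "integrable M (\<lambda>y. \<integral>x. g y x \<partial>M)"
    using integrable_fst'[OF int] by simp
  have "(\<lambda>y. 2 * of_real pi * \<i> * (\<integral>x. g y x \<partial>M)) absolutely_integrable_on {0..1}"
    using int1 unfolding M_def set_integrable_def
    by (subst integrable_restrict_space[symmetric]) (auto simp: S)
  then show "(\<lambda>y. circle_integral (\<lambda>x. k (unit_exp y) x * a x)) absolutely_integrable_on {0..1}"
    by (simp only: c1)
  have c2: "circle_integral (\<lambda>z. k z (unit_exp x)) * a (unit_exp x) = 2 * of_real pi * \<i> * (\<integral>y. g y x \<partial>M)" for x
  proof -
    have "integrable M (\<lambda>y. k (unit_exp y) (unit_exp x))"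
      unfolding M_def
      by (rule absolutely_integrable_imp_integrable[OF absolutely_integrable_continuous_real[OF kz(2)] S])
    from lebesgue_integral_eq_integral[OF this[unfolded M_def] S] show ?thesis
      by (simp add: circle_integral_eq M_def g_def)
  qed
  have int2: "integrable M (\<lambda>x. \<integral>y. g y x \<partial>M)"
    using integrable_snd[OF int] by simp
  have "circle_integral (\<lambda>z. circle_integral (\<lambda>x. k z x * a x)) =
      (2 * of_real pi * \<i>) * ((2 * of_real pi * \<i>) * (\<integral>y. (\<integral>x. g y x \<partial>M) \<partial>M))"
    unfolding circle_integral_eq[of "\<lambda>z. circle_integral (\<lambda>x. k z x * a x)"] c1
    using lebesgue_integral_eq_integral[OF int1[unfolded M_def] S] by (simp add: M_def)
  also have "(\<integral>y. (\<integral>x. g y x \<partial>M) \<partial>M) = (\<integral>x. (\<integral>y. g y x \<partial>M) \<partial>M)"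
    by (rule Fubini_integral[OF int, symmetric])
  also have "(2 * of_real pi * \<i>) * ((2 * of_real pi * \<i>) * \<dots>) =
      circle_integral (\<lambda>x. circle_integral (\<lambda>z. k z x) * a x)"
    unfolding circle_integral_eq[of "\<lambda>x. circle_integral (\<lambda>z. k z x) * a x"] c2
    using lebesgue_integral_eq_integral[OF int2[unfolded M_def] S] by (simp add: M_def)
  finally show "circle_integral (\<lambda>z. circle_integral (\<lambda>x. k z x * a x)) =
         circle_integral (\<lambda>x. circle_integral (\<lambda>z. k z x) * a x)" .
qed

section \<open>From the functions of the statement to the regularized ones\<close>

lemma ell_gamma_pm_eq:
  assumes "norm q < 1" "norm p < 1" shows "ell_gamma_pm q p a z = egam_pm q p a z"
  by (simp add: ell_gamma_pm_def egam_pm_def ell_gamma_eq[OF assms] divide_inverse)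

lemma ell_gamma_pm2_eq:
  assumes "norm q < 1" "norm p < 1"
  shows "ell_gamma_pm2 q p a z x = egam_pm q p (a * z) x * egam_pm q p (a / z) x"
  by (simp add: ell_gamma_pm2_def egam_pm_def ell_gamma_eq[OF assms] divide_inverse mult_ac)

text \<open>The same four factors grouped by the other variable: here \<open>a * x\<close> and
  \<open>a / x\<close> become two parameters of a beta integral over z.\<close>

lemma ell_gamma_pm2_eq':
  assumes "norm q < 1" "norm p < 1"
  shows "ell_gamma_pm2 q p a z x = egam_pm q p (a * x) z * egam_pm q p (a / x) z"
  by (simp add: ell_gamma_pm2_def egam_pm_def ell_gamma_eq[OF assms] divide_inverse mult_ac)

text \<open>\<open>rec_egam_sq\<close> is continuous on an open neighbourhood of the circle and
  agrees there with the function whose singularities are removed, so its value is the limit.\<close>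

lemma rec_ell_gamma_sq_eq:
  assumes q: "norm q < 1" and p: "norm p < 1" and z: "norm z = 1"
  shows "rec_ell_gamma_sq q p z = rec_egam_sq q p z"
proof -
  define W where "W = {w::complex. w \<noteq> 0 \<and> norm (q * p) * norm w ^ 2 < 1 \<and> norm (q * p) < norm w ^ 2}"
  have z0: "z \<noteq> 0" using z by auto
  have W: "open W" unfolding W_def
    by (intro open_Collect_conj open_Collect_less open_Collect_neq continuous_intros)
  have "norm q * norm p < 1 * 1" using q p by (intro mult_strict_mono) auto
  then have zW: "z \<in> W" using z z0 by (simp add: W_def norm_mult)
  have nzW: "qpoch2 q p (q * p * w ^ 2) \<noteq> 0" "qpoch2 q p (q * p / w ^ 2) \<noteq> 0" if "w \<in> W" for w
    using that by (auto simp: W_def norm_mult norm_divide norm_power intro!: qpoch2_nonzero[OF q p])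
  \<comment> \<open>Valid at the poles too: there the numerator on the right vanishes, and the left
    side is 0 through division by zero.\<close>
  have eq: "1 / (ell_gamma q p (w ^ 2) * ell_gamma q p (inverse (w ^ 2))) = rec_egam_sq q p w" if "w \<in> W" for w
    using nzW[OF that] by (simp add: ell_gamma_eq[OF q p] egam_def rec_egam_sq_def divide_inverse mult_ac)
  have "continuous_on W (rec_egam_sq q p)"
    unfolding rec_egam_sq_def by (intro continuous_intros q p) (use nzW in \<open>auto simp: W_def\<close>)
  then have "(rec_egam_sq q p \<longlongrightarrow> rec_egam_sq q p z) (at z)"
    using W zW continuous_on_eq_continuous_at isCont_def by blast
  moreover have "eventually (\<lambda>w. rec_egam_sq q p w = 1 / (ell_gamma q p (w ^ 2) * ell_gamma q p (inverse (w ^ 2)))) (at z)"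
    using eventually_at_in_open'[OF W zW] by eventually_elim (use eq in simp)
  ultimately have "((\<lambda>w. 1 / (ell_gamma q p (w ^ 2) * ell_gamma q p (inverse (w ^ 2)))) \<longlongrightarrow> rec_egam_sq q p z) (at z)"
    by (rule Lim_transform_eventually)
  then show ?thesis unfolding rec_ell_gamma_sq_def by (rule remove_sings_eqI)
qed

lemma bailey_kappa_eq: "bailey_kappa q p = qpoch p p * qpoch q q / (4 * of_real pi * \<i>)"
  by (simp add: bailey_kappa_def qpoch_inf_eq)

lemma elliptic_beta_integral_kappa:
  assumes dom: "beta5_domain q p a b c d e"
  shows "bailey_kappa q p * circle_integral (beta5_integrand q p a b c d e) = beta5_rhs q p a b c d e"
  using elliptic_beta_integral[OF dom] beta5_rhs_nonzero[OF dom]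
  by (simp add: bailey_kappa_eq beta5_ratio_def field_simps)

theorem theorem2:
  fixes q p t s u :: complex
    and \<alpha> \<beta> :: "complex \<Rightarrow> complex \<Rightarrow> complex"
  assumes "norm q < 1" and "norm p < 1"
    and "norm t < 1" and "norm s < 1" and "norm u < 1"
    and "norm (p * q) < norm (t ^ 2 * s ^ 2 * u)"
    and "ell_bailey_pair q p \<alpha> \<beta> (s * t)"
  shows "(\<forall>w\<in>sphere 0 1. unit_circle_integrable (bailey_kernel q p s u \<alpha> w t)) \<and>
         ell_bailey_pair q p (bailey_alpha' q p s u \<alpha>) (bailey_beta' q p s u \<beta>) t"
proof -
  note q = assms(1) and p = assms(2)
  have "t ^ 2 * s ^ 2 * u \<noteq> 0" using assms(6) norm_ge_zero[of "p * q"] by auto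
  then have nz: "t \<in> unit_punctured" "s \<in> unit_punctured" "u \<in> unit_punctured"
    using assms(3-5) by (auto simp: unit_punctured_def)
  define a where "a = (\<lambda>x. \<alpha> x (s * t))"
  define \<psi> where "\<psi> = (\<lambda>x. egam_pm q p (t ^ 2 * s * u) x / egam_pm q p (s * u) x)"
  define G where "G = egam q p (s ^ 2 * t ^ 2) / (egam q p (s ^ 2) * egam q p (t ^ 2))"
  define K where "K = (\<lambda>w x. egam_pm q p (s * t * w) x * egam_pm q p (s * t / w) x)"
  have circ: "c * z \<in> unit_punctured" "c / z \<in> unit_punctured" if "c \<in> unit_punctured" "norm z = 1" for c z
    using unit_punctured_circle that by auto
  \<comment> \<open>The product depends on neither w nor x, so the denominator of the beta integrand
    can be part of the prefactor of \<open>bailey_alpha'\<close>.\<close>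
  have prod: "(t * w) * (t / w) * u * (s * x) * (s / x) = t ^ 2 * s ^ 2 * u" if "norm w = 1" "norm x = 1" for w x
  proof -
    have "w \<noteq> 0" "x \<noteq> 0" using that by auto
    then show ?thesis by (simp add: power2_eq_square)
  qed
  have dom: "beta5_domain q p (t * w) (t / w) u (s * x) (s / x)" if "norm w = 1" "norm x = 1" for w x
    unfolding beta5_domain_def prod[OF that] using circ nz that q p assms(6) by auto
  \<comment> \<open>Grouped for cancellation: the factors in x other than \<open>K\<close> cancel
    against \<open>\<psi>\<close>, the constant ones against \<open>G\<close>, and what is left is
    the prefactor of \<open>bailey_beta'\<close> times the kernel at the parameter
    \<open>s * t\<close>.\<close>
  have rhs: "beta5_rhs q p (t * w) (t / w) u (s * x) (s / x) =
      egam q p (t ^ 2) * egam_pm q p (t * u) w * K w x * egam_pm q p (s * u) x * egam q p (s ^ 2) /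
      (egam_pm q p (t * s ^ 2 * u) w * egam q p (s ^ 2 * t ^ 2) * egam_pm q p (t ^ 2 * s * u) x)"
    if "norm w = 1" "norm x = 1" for w x
  proof -
    define A B D E where "A = t * w" and "B = t / w" and "D = s * x" and "E = s / x"
    note defs = A_def B_def D_def E_def
    have nz: "w \<noteq> 0" "x \<noteq> 0" using that by auto
    have 4: "B * u * D * E = t * s ^ 2 * u / w" "A * u * D * E = t * s ^ 2 * u * w" "A * B * D * E = s ^ 2 * t ^ 2"
      "A * B * u * E = t ^ 2 * s * u / x" "A * B * u * D = t ^ 2 * s * u * x"
      using nz by (simp_all add: defs power2_eq_square)
    have 2: "A * B = t ^ 2" "A * u = t * u * w" "A * D = s * t * w * x" "A * E = s * t * w / x"
      "B * u = t * u / w" "B * D = s * t / w * x" "B * E = s * t / w / x"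
      "u * D = s * u * x" "u * E = s * u / x" "D * E = s ^ 2"
      using nz by (simp_all add: defs power2_eq_square)
    show ?thesis
      unfolding beta5_rhs_def defs[symmetric] 4 unfolding 2 egam_pm_def K_def by (simp only: mult_ac)
  qed
  have nzr: "egam q p (t ^ 2) \<noteq> 0" "K w x \<noteq> 0" "egam_pm q p (s * u) x \<noteq> 0" "egam q p (s ^ 2) \<noteq> 0"
    "egam q p (s ^ 2 * t ^ 2) \<noteq> 0" "egam_pm q p (t ^ 2 * s * u) x \<noteq> 0" if "norm w = 1" "norm x = 1" for w x
    using beta5_rhs_nonzero[OF dom[OF that]] unfolding rhs[OF that] by auto
  have pm_cont: "continuous_on (sphere 0 1) (egam_pm q p c)" if "c \<in> unit_punctured" for c
    by (rule continuous_on_egam_pm[OF continuous_on_const continuous_on_const continuous_on_const continuous_on_id q p that]) auto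
  have \<psi>: "continuous_on (sphere 0 1) \<psi>"
    unfolding \<psi>_def using nzr(3)[of 1]
    by (intro continuous_on_divide pm_cont) (use nz in \<open>auto simp: power2_eq_square\<close>)
  have Kc: "continuous_on (sphere 0 1) (K w)" if "norm w = 1" for w
    unfolding K_def by (intro continuous_on_mult pm_cont circ that unit_punctured_mult nz)
  have hyp: "(\<lambda>x. K w (unit_exp x) * a (unit_exp x)) absolutely_integrable_on {0..1}"
    "\<beta> w (s * t) = bailey_kappa q p * circle_integral (\<lambda>x. K w x * a x)" if "norm w = 1" for w
    using assms(7) that unfolding ell_bailey_pair_def ell_gamma_pm2_eq[OF q p] unit_circle_integrable_iff
    by (auto simp: K_def a_def circle_integral_def)
  \<comment> \<open>The hypothesis at w = 1 gives integrability of \<open>K 1 x * a x\<close>, and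
    \<open>1 / K 1 x\<close> is continuous on the circle.\<close>
  have a_int: "(\<lambda>x. a (unit_exp x)) absolutely_integrable_on {0..1}"
  proof -
    have "continuous_on (sphere 0 1) (\<lambda>x. 1 / K 1 x)"
      by (intro continuous_on_divide continuous_on_const Kc) (use nzr(2)[of 1] in auto)
    from absolutely_integrable_continuous_mult[OF continuous_on_circle_compose[OF this] hyp(1)[of 1]]
    show ?thesis using nzr(2)[of 1] by simp
  qed
  define N where "N = (\<lambda>z x. \<psi> x * (egam_pm q p (s * x) z * egam_pm q p (s / x) z))"
  have kernel: "bailey_kernel q p s u \<alpha> z t = (\<lambda>x. N z x * a x / x)" for z
    by (rule ext) (simp add: bailey_kernel_def N_def \<psi>_def a_def ell_gamma_pm_eq[OF q p] ell_gamma_pm2_eq'[OF q p])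
  have N_sym: "N z x = \<psi> x * (egam_pm q p (s * z) x * egam_pm q p (s / z) x)" for z x
    unfolding N_def ell_gamma_pm2_eq'[OF q p, of s z x, symmetric] ell_gamma_pm2_eq[OF q p, of s z x, symmetric] ..
  have kernel_int: "unit_circle_integrable (bailey_kernel q p s u \<alpha> w t)" if "norm w = 1" for w
  proof -
    have "continuous_on (sphere 0 1) (N w)"
      unfolding N_sym by (intro continuous_on_mult \<psi> pm_cont circ that nz)
    from absolutely_integrable_continuous_mult[OF continuous_on_circle_compose[OF this] a_int]
    show ?thesis unfolding kernel unit_circle_integrable_iff .
  qed
  have pair: "unit_circle_integrable (\<lambda>z. ell_gamma_pm2 q p t w z * bailey_alpha' q p s u \<alpha> z t / z) \<and>
      bailey_beta' q p s u \<beta> w t = bailey_kappa q p *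
        contour_integral (circlepath 0 1) (\<lambda>z. ell_gamma_pm2 q p t w z * bailey_alpha' q p s u \<alpha> z t / z)"
    if w: "norm w = 1" for w
  proof -
    \<comment> \<open>The double integrand without \<open>a\<close>: in z it is a beta integrand,
      while \<open>\<psi>\<close> depends on x alone.\<close>
    define k where "k = (\<lambda>z x. beta5_integrand q p (t * w) (t / w) u (s * x) (s / x) z * \<psi> x)"
    let ?\<kappa> = "bailey_kappa q p"
    have alpha': "ell_gamma_pm2 q p t w z * bailey_alpha' q p s u \<alpha> z t =
        ?\<kappa> * G * circle_integral (\<lambda>x. k z x * a x)" if z: "norm z = 1" for z
    proof -
      \<comment> \<open>The part of \<open>k z x\<close> that is independent of x; with
        \<open>G\<close> and the constant \<open>?\<kappa>\<close> it makes up the prefactor of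
        \<open>bailey_alpha'\<close> times the outer kernel.\<close>
      define L where "L = egam_pm q p (t * w) z * egam_pm q p (t / w) z * egam_pm q p u z * rec_egam_sq q p z / egam_pm q p (t ^ 2 * s ^ 2 * u) z"
      have "circle_integral (\<lambda>x. k z x * a x) = circle_integral (\<lambda>x. L * (N z x * a x))"
      proof (rule circle_integral_cong)
        fix x :: complex assume x: "norm x = 1"
        show "k z x * a x = L * (N z x * a x)"
          unfolding k_def N_def L_def beta5_integrand_def prod[OF w x] by (simp add: mult_ac)
      qed
      also have "\<dots> = L * circle_integral (\<lambda>x. N z x * a x)" by (rule circle_integral_cmult)
      also have "circle_integral (\<lambda>x. N z x * a x) = contour_integral (circlepath 0 1) (bailey_kernel q p s u \<alpha> z t)"
        unfolding kernel circle_integral_def ..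
      finally show ?thesis
        unfolding bailey_alpha'_def ell_gamma_pm_eq[OF q p] ell_gamma_pm2_eq[OF q p] ell_gamma_eq[OF q p]
          rec_ell_gamma_sq_eq[OF q p z] L_def G_def
        by (simp add: mult_ac)
    qed
    have k_cont: "continuous_on (sphere 0 1 \<times> sphere 0 1) (\<lambda>(z, x). k z x)"
    proof -
      let ?T = "sphere 0 1 \<times> sphere 0 1 :: (complex \<times> complex) set"
      have sx: "continuous_on ?T (\<lambda>y. s * snd y)" "continuous_on ?T (\<lambda>y. s / snd y)"
        by (intro continuous_intros; force)+
      have "continuous_on ?T (\<lambda>y. beta5_integrand q p (t * w) (t / w) u (s * snd y) (s / snd y) (fst y))"
        by (rule continuous_on_beta5_integrand[OF continuous_on_const continuous_on_const continuous_on_const sx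
              continuous_on_const continuous_on_const continuous_on_fst[OF continuous_on_id]])
           (use dom w in auto)
      moreover have "continuous_on ?T (\<lambda>y. \<psi> (snd y))"
        by (rule continuous_on_compose2[OF \<psi>]) (auto intro!: continuous_intros)
      ultimately show ?thesis unfolding k_def split_beta by (rule continuous_on_mult)
    qed
    note fubini = circle_fubini[OF k_cont a_int]
    have "(\<lambda>y. ?\<kappa> * G * circle_integral (\<lambda>x. k (unit_exp y) x * a x)) absolutely_integrable_on {0..1}"
      by (rule absolutely_integrable_continuous_mult[OF continuous_on_const fubini(1)])
    then have int: "unit_circle_integrable (\<lambda>z. ell_gamma_pm2 q p t w z * bailey_alpha' q p s u \<alpha> z t / z)"
      unfolding unit_circle_integrable_iff by (simp add: alpha')
    \<comment> \<open>The elliptic beta integral uses up one of the two constants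
      \<open>?\<kappa>\<close>; the other belongs to the original Bailey pair.\<close>
    have inner: "?\<kappa> * G * circle_integral (\<lambda>z. k z x) = egam_pm q p (t * u) w / egam_pm q p (t * s ^ 2 * u) w * K w x"
      if x: "norm x = 1" for x
    proof -
      have "circle_integral (\<lambda>z. k z x) = \<psi> x * circle_integral (beta5_integrand q p (t * w) (t / w) u (s * x) (s / x))"
        unfolding circle_integral_cmult[symmetric] by (simp add: k_def mult.commute)
      then have "?\<kappa> * G * circle_integral (\<lambda>z. k z x) = G * \<psi> x * beta5_rhs q p (t * w) (t / w) u (s * x) (s / x)"
        using elliptic_beta_integral_kappa[OF dom[OF w x]] by (simp add: mult_ac)
      also have "\<dots> = egam_pm q p (t * u) w / egam_pm q p (t * s ^ 2 * u) w * K w x"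
        unfolding rhs[OF w x] G_def \<psi>_def using nzr[OF w x] by simp
      finally show ?thesis .
    qed
    have "?\<kappa> * contour_integral (circlepath 0 1) (\<lambda>z. ell_gamma_pm2 q p t w z * bailey_alpha' q p s u \<alpha> z t / z) =
        ?\<kappa> * circle_integral (\<lambda>z. ?\<kappa> * G * circle_integral (\<lambda>x. k z x * a x))"
      unfolding circle_integral_def[of "\<lambda>z. ell_gamma_pm2 q p t w z * bailey_alpha' q p s u \<alpha> z t", symmetric]
      by (intro arg_cong[where f = "\<lambda>y. ?\<kappa> * y"] circle_integral_cong) (rule alpha')
    also have "\<dots> = ?\<kappa> * (?\<kappa> * G * circle_integral (\<lambda>x. circle_integral (\<lambda>z. k z x) * a x))"
      unfolding circle_integral_cmult fubini(2) ..
    also have "\<dots> = ?\<kappa> * circle_integral (\<lambda>x. ?\<kappa> * G * circle_integral (\<lambda>z. k z x) * a x)"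
      unfolding circle_integral_cmult[of "?\<kappa> * G" "\<lambda>x. circle_integral (\<lambda>z. k z x) * a x", symmetric]
      by (simp only: mult.assoc)
    also have "\<dots> = ?\<kappa> * circle_integral (\<lambda>x. egam_pm q p (t * u) w / egam_pm q p (t * s ^ 2 * u) w * (K w x * a x))"
      by (intro arg_cong[where f = "\<lambda>y. ?\<kappa> * y"] circle_integral_cong)
         (simp only: inner, simp only: mult.assoc)
    also have "\<dots> = egam_pm q p (t * u) w / egam_pm q p (t * s ^ 2 * u) w * \<beta> w (s * t)"
      unfolding circle_integral_cmult hyp(2)[OF w] by (simp only: mult_ac)
    also have "\<dots> = bailey_beta' q p s u \<beta> w t"
      by (simp add: bailey_beta'_def ell_gamma_pm_eq[OF q p])
    finally show ?thesis using int by simp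
  qed
  show ?thesis unfolding ell_bailey_pair_def using kernel_int pair by simp
qed

end
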